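(* The operator $\mathcal{A}_1$ is dissipative on $\mathcal{H}_1$, with $\mathrm{Re}\langle \mathcal{A}_1 y,y\rangle_{\mathcal{H}_1}=-\frac{\gamma_1}{\kappa_1}\|q_1\|^2$ for $y=(u_1,u_2,v_1,v_2,\theta_1,q_1)\in\mathcal{D}(\mathcal{A}_1)$, and $0\in\rho(\mathcal{A}_1)$. Consequently $\mathcal{A}_1$ generates a $C_0$-semigroup of contractions $(S_1(t))_{t\ge 0}$ on $\mathcal{H}_1$. Moreover, this semigroup is strongly stable: $\lim_{t\to\infty}\|S_1(t)y^0\|_{\mathcal{H}_1}=0$ for every $y^0\in\mathcal{H}_1$.
   Context: Let $\ell_1,\ell_2>0$ and positive constants $\alpha_1,\beta_1,\gamma_1,\delta_1,\tau_1,\kappa_1,\alpha_2$. $\|\cdot\|$ denotes the $L^2$ norm on the relevant interval; primes denote $x$-derivatives. Let $V=\{(f_1,f_2)\in H^1(0,\ell_1)\times H^2(0,\ell_2): f_1(\ell_1)=0,\ f_2(\ell_2)=0,\ f_1(0)=f_2(0),\ f_2'(0)=0\}$. Let $\mathcal{H}_1=V\times L^2(0,\ell_1)\times L^2(0,\ell_2)\times L^2(0,\ell_1)\times L^2(0,\ell_1)$ with elements $(f_1,f_2,g_1,g_2,h_1,d_1)$ and norm $\|(f,g,h_1,d_1)\|_{\mathcal{H}_1}^2=\frac{\delta_1\alpha_1}{\beta_1}\|f_1'\|^2+\frac{\delta_1}{\beta_1}\|g_1\|^2+\|h_1\|^2+\frac{\gamma_1\tau_1}{\kappa_1}\|d_1\|^2+\alpha_2\|f_2''\|^2+\|g_2\|^2$.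 Define $\mathcal{D}(\mathcal{A}_1)$ as the set of $(u_1,u_2,v_1,v_2,\theta_1,q_1)$ with $(u_1,u_2)\in V$, $u_1\in H^2(0,\ell_1)$, $u_2\in H^4(0,\ell_2)$, $(v_1,v_2)\in V$, $\theta_1\in H^1_0(0,\ell_1)$, $q_1\in H^1(0,\ell_1)$, $u_2''(\ell_2)=0$ and $\alpha_2u_2'''(0)=\frac{\delta_1}{\beta_1}\alpha_1u_1'(0)$, and $\mathcal{A}_1(u_1,u_2,v_1,v_2,\theta_1,q_1)=\big(v_1,\ v_2,\ \alpha_1u_1''-\beta_1\theta_1',\ -\alpha_2u_2'''',\ -\delta_1v_1'-\gamma_1q_1',\ -\tfrac1{\tau_1}q_1-\tfrac{\kappa_1}{\tau_1}\theta_1'\big)$. This is the first-order formulation of the thermoelastic string (Cattaneo law) $u_{1,tt}-\alpha_1u_{1,xx}+\beta_1\theta_{1,x}=0$, $\theta_{1,t}+\gamma_1q_{1,x}+\delta_1u_{1,tx}=0$, $\tau_1q_{1,t}+q_1+\kappa_1\theta_{1,x}=0$ on $(0,\ell_1)$ coupled at $x=0$ with the elastic beam $u_{2,tt}+\alpha_2u_{2,xxxx}=0$ on $(0,\ell_2)$, with $u_1(0)=u_2(0)$, $\theta_1(0)=\theta_1(\ell_1)=0$, $u_{2,x}(0)=0$, $\alpha_2u_{2,xxx}(0)=\frac{\delta_1}{\beta_1}\alpha_1u_{1,x}(0)$, $u_1(\ell_1)=u_2(\ell_2)=u_{2,xx}(\ell_2)=0$. *)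

theory Defs
  imports "HOL-Analysis.Analysis"
begin

text \<open>Lebesgue (completed) measure is used so that a.e. modifications stay measurable.\<close>

definition L2 :: "real \<Rightarrow> (real \<Rightarrow> complex) \<Rightarrow> bool" where
  "L2 l f \<longleftrightarrow> set_borel_measurable lebesgue {0..l} f \<and>
               set_integrable lebesgue {0..l} (\<lambda>x. (cmod (f x))^2)"

definition nrm2 :: "real \<Rightarrow> (real \<Rightarrow> complex) \<Rightarrow> real" where
  "nrm2 l f = (LINT x:{0..l}|lebesgue. (cmod (f x))^2)"

definition ip :: "real \<Rightarrow> (real \<Rightarrow> complex) \<Rightarrow> (real \<Rightarrow> complex) \<Rightarrow> complex" where
  "ip l f g = (LINT x:{0..l}|lebesgue. f x * cnj (g x))"

text \<open>Derivative of the (continuous) representative, one-sided at the end points.\<close>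
definition Dw :: "real \<Rightarrow> (real \<Rightarrow> complex) \<Rightarrow> (real \<Rightarrow> complex)" where
  "Dw l f = (\<lambda>x. vector_derivative f (at x within {0..l}))"

text \<open>H^1(0,l): f is (on [0,l]) the indefinite integral of an L^2 function,
  i.e. the absolutely continuous representative of an H^1 class.\<close>
definition H1 :: "real \<Rightarrow> (real \<Rightarrow> complex) \<Rightarrow> bool" where
  "H1 l f \<longleftrightarrow> (\<exists>g. L2 l g \<and> (\<forall>x\<in>{0..l}. f x = f 0 + (LINT t:{0..x}|lebesgue. g t)))"

fun Hk :: "nat \<Rightarrow> real \<Rightarrow> (real \<Rightarrow> complex) \<Rightarrow> bool" where
  "Hk 0 l f = L2 l f"
| "Hk (Suc k) l f = (H1 l f \<and> Hk k l (Dw l f))"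

record st =
  su1 :: "real \<Rightarrow> complex"
  su2 :: "real \<Rightarrow> complex"
  sv1 :: "real \<Rightarrow> complex"
  sv2 :: "real \<Rightarrow> complex"
  sth :: "real \<Rightarrow> complex"
  sq  :: "real \<Rightarrow> complex"

definition st_lin :: "complex \<Rightarrow> st \<Rightarrow> complex \<Rightarrow> st \<Rightarrow> st" where
  "st_lin a y b z =
     \<lparr> su1 = (\<lambda>x. a * su1 y x + b * su1 z x), su2 = (\<lambda>x. a * su2 y x + b * su2 z x),
       sv1 = (\<lambda>x. a * sv1 y x + b * sv1 z x), sv2 = (\<lambda>x. a * sv2 y x + b * sv2 z x),
       sth = (\<lambda>x. a * sth y x + b * sth z x), sq = (\<lambda>x. a * sq y x + b * sq z x) \<rparr>"

definition inV :: "real \<Rightarrow> real \<Rightarrow> (real \<Rightarrow> complex) \<Rightarrow> (real \<Rightarrow> complex) \<Rightarrow> bool" where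
  "inV l1 l2 f1 f2 \<longleftrightarrow> Hk 1 l1 f1 \<and> Hk 2 l2 f2 \<and> f1 l1 = 0 \<and> f2 l2 = 0 \<and>
      f1 0 = f2 0 \<and> Dw l2 f2 0 = 0"

definition inH :: "real \<Rightarrow> real \<Rightarrow> st \<Rightarrow> bool" where
  "inH l1 l2 y \<longleftrightarrow> inV l1 l2 (su1 y) (su2 y) \<and> L2 l1 (sv1 y) \<and> L2 l2 (sv2 y) \<and>
      L2 l1 (sth y) \<and> L2 l1 (sq y)"

definition Hnorm2 :: "real \<Rightarrow> real \<Rightarrow> real \<Rightarrow> real \<Rightarrow> real \<Rightarrow> real \<Rightarrow> real \<Rightarrow> real \<Rightarrow> real
    \<Rightarrow> st \<Rightarrow> real" where
  "Hnorm2 l1 l2 \<alpha>1 \<beta>1 \<gamma>1 \<delta>1 \<tau>1 \<kappa>1 \<alpha>2 y =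
     \<delta>1 * \<alpha>1 / \<beta>1 * nrm2 l1 (Dw l1 (su1 y)) + \<delta>1 / \<beta>1 * nrm2 l1 (sv1 y) + nrm2 l1 (sth y)
     + \<gamma>1 * \<tau>1 / \<kappa>1 * nrm2 l1 (sq y) + \<alpha>2 * nrm2 l2 (Dw l2 (Dw l2 (su2 y))) + nrm2 l2 (sv2 y)"

definition Hinner :: "real \<Rightarrow> real \<Rightarrow> real \<Rightarrow> real \<Rightarrow> real \<Rightarrow> real \<Rightarrow> real \<Rightarrow> real \<Rightarrow> real
    \<Rightarrow> st \<Rightarrow> st \<Rightarrow> complex" where
  "Hinner l1 l2 \<alpha>1 \<beta>1 \<gamma>1 \<delta>1 \<tau>1 \<kappa>1 \<alpha>2 y z =
     complex_of_real (\<delta>1 * \<alpha>1 / \<beta>1) * ip l1 (Dw l1 (su1 y)) (Dw l1 (su1 z))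
     + complex_of_real (\<delta>1 / \<beta>1) * ip l1 (sv1 y) (sv1 z) + ip l1 (sth y) (sth z)
     + complex_of_real (\<gamma>1 * \<tau>1 / \<kappa>1) * ip l1 (sq y) (sq z)
     + complex_of_real \<alpha>2 * ip l2 (Dw l2 (Dw l2 (su2 y))) (Dw l2 (Dw l2 (su2 z)))
     + ip l2 (sv2 y) (sv2 z)"

definition domA :: "real \<Rightarrow> real \<Rightarrow> real \<Rightarrow> real \<Rightarrow> real \<Rightarrow> real \<Rightarrow> st \<Rightarrow> bool" where
  "domA l1 l2 \<alpha>1 \<beta>1 \<delta>1 \<alpha>2 y \<longleftrightarrow>
     inV l1 l2 (su1 y) (su2 y) \<and> Hk 2 l1 (su1 y) \<and> Hk 4 l2 (su2 y) \<and>
     inV l1 l2 (sv1 y) (sv2 y) \<and>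
     Hk 1 l1 (sth y) \<and> sth y 0 = 0 \<and> sth y l1 = 0 \<and>
     Hk 1 l1 (sq y) \<and>
     Dw l2 (Dw l2 (su2 y)) l2 = 0 \<and>
     complex_of_real \<alpha>2 * Dw l2 (Dw l2 (Dw l2 (su2 y))) 0
       = complex_of_real (\<delta>1 / \<beta>1 * \<alpha>1) * Dw l1 (su1 y) 0"

definition opA :: "real \<Rightarrow> real \<Rightarrow> real \<Rightarrow> real \<Rightarrow> real \<Rightarrow> real \<Rightarrow> real \<Rightarrow> real \<Rightarrow> real
    \<Rightarrow> st \<Rightarrow> st" where
  "opA l1 l2 \<alpha>1 \<beta>1 \<gamma>1 \<delta>1 \<tau>1 \<kappa>1 \<alpha>2 y =
     \<lparr> su1 = sv1 y, su2 = sv2 y,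
       sv1 = (\<lambda>x. of_real \<alpha>1 * Dw l1 (Dw l1 (su1 y)) x - of_real \<beta>1 * Dw l1 (sth y) x),
       sv2 = (\<lambda>x. - of_real \<alpha>2 * Dw l2 (Dw l2 (Dw l2 (Dw l2 (su2 y)))) x),
       sth = (\<lambda>x. - of_real \<delta>1 * Dw l1 (sv1 y) x - of_real \<gamma>1 * Dw l1 (sq y) x),
       sq = (\<lambda>x. - of_real (1 / \<tau>1) * sq y x - of_real (\<kappa>1 / \<tau>1) * Dw l1 (sth y) x) \<rparr>"

text \<open>Elements are identified when their difference has seminorm 0 (a.e. equality).\<close>
definition eqv :: "(st \<Rightarrow> real) \<Rightarrow> st \<Rightarrow> st \<Rightarrow> bool" where
  "eqv N y z \<longleftrightarrow> N (st_lin 1 y (-1) z) = 0"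

definition zero_in_resolvent :: "(st \<Rightarrow> bool) \<Rightarrow> (st \<Rightarrow> real) \<Rightarrow> (st \<Rightarrow> bool) \<Rightarrow> (st \<Rightarrow> st) \<Rightarrow> bool" where
  "zero_in_resolvent H N D A \<longleftrightarrow>
     (\<forall>f. H f \<longrightarrow> (\<exists>y. D y \<and> eqv N (A y) f)) \<and>
     (\<forall>y z. D y \<longrightarrow> D z \<longrightarrow> eqv N (A y) (A z) \<longrightarrow> eqv N y z) \<and>
     (\<exists>C. \<forall>y. D y \<longrightarrow> N y \<le> C * N (A y))"

definition generates_C0_contraction :: "(st \<Rightarrow> bool) \<Rightarrow> (st \<Rightarrow> real) \<Rightarrow> (st \<Rightarrow> bool) \<Rightarrow> (st \<Rightarrow> st)
    \<Rightarrow> (real \<Rightarrow> st \<Rightarrow> st) \<Rightarrow> bool" where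
  "generates_C0_contraction H N D A S \<longleftrightarrow>
     (\<forall>t y. t \<ge> 0 \<longrightarrow> H y \<longrightarrow> H (S t y)) \<and>
     (\<forall>t y z a b. t \<ge> 0 \<longrightarrow> H y \<longrightarrow> H z \<longrightarrow>
         eqv N (S t (st_lin a y b z)) (st_lin a (S t y) b (S t z))) \<and>
     (\<forall>t y z. t \<ge> 0 \<longrightarrow> H y \<longrightarrow> H z \<longrightarrow> eqv N y z \<longrightarrow> eqv N (S t y) (S t z)) \<and>
     (\<forall>y. H y \<longrightarrow> eqv N (S 0 y) y) \<and>
     (\<forall>t s y. t \<ge> 0 \<longrightarrow> s \<ge> 0 \<longrightarrow> H y \<longrightarrow> eqv N (S (t + s) y) (S t (S s y))) \<and>
     (\<forall>y. H y \<longrightarrow> ((\<lambda>t. N (st_lin 1 (S t y) (-1) y)) \<longlongrightarrow> 0) (at_right 0)) \<and>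
     (\<forall>t y. t \<ge> 0 \<longrightarrow> H y \<longrightarrow> N (S t y) \<le> N y) \<and>
     (\<forall>y. H y \<longrightarrow>
        ((\<exists>z. H z \<and> ((\<lambda>h. N (st_lin (of_real (1 / h)) (st_lin 1 (S h y) (-1) y) (-1) z))
                         \<longlongrightarrow> 0) (at_right 0))
         \<longleftrightarrow> (\<exists>w. D w \<and> eqv N w y))) \<and>
     (\<forall>y. D y \<longrightarrow>
        ((\<lambda>h. N (st_lin (of_real (1 / h)) (st_lin 1 (S h y) (-1) y) (-1) (A y))) \<longlongrightarrow> 0)
          (at_right 0))"

end

theory Submission
  imports Defs "HOL-Complex_Analysis.Great_Picard"
begin

text \<open>Dissipativity is integration by parts: all boundary terms cancel by the transmission conditions.
  Successive integration solves \<open>A y = f\<close>, and the bounded inverse \<open>B\<close> of \<open>A\<close> is compact, since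
  the components of \<open>B f\<close> are bounded and Hoelder continuous in terms of the norm of \<open>f\<close>.

  The rest is abstract. If \<open>B\<close> is bounded, injective and dissipative on a Hilbert space, then the
  resolvents \<open>J l = (1 - l A)\<^sup>-\<^sup>1\<close> of its inverse \<open>A\<close> are contractions, and the implicit Euler scheme
  converges to the semigroup because \<open>J a (J b x) - J (a + b) x\<close> is of order \<open>a b\<close> for smooth \<open>x\<close>.
  If some orbit does not tend to \<open>0\<close>, the limit of the norms along orbits is a nonzero Hilbert
  seminorm for which \<open>B\<close> is skew, and compactness yields \<open>w \<noteq> 0\<close> and \<open>M > 0\<close> with
  \<open>B (B w) = - M w\<close>. Dissipation vanishes at such a \<open>w\<close>: there is no heat flux, hence no
  temperature and no motion of the string, and the deflection of the beam is an eigenfunction of the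
  fourth derivative satisfying five boundary conditions, which forces it to be \<open>0\<close>.\<close>

subsection \<open>Contraction semigroups from a dissipative inverse\<close>

text \<open>Working with \<open>B\<close> instead of \<open>A\<close> keeps the operators bounded
  and defined on all of \<open>H\<close>; the unbounded generator enters only through
  \<open>AR\<close> and through statements about the range of \<open>B\<close>. Density of that
  range is not assumed: it follows from injectivity and dissipativity, and it is used both for the
  convergence of the Euler scheme and for the positivity of the maximum in the stability argument.
  \<open>H\<close> is a set rather than a type because it will be the image of the energy space in a
  sixfold product of Hilbert spaces, while elements of the energy space are representatives,
  determined only up to null energy. The scalars are real, which is why purely imaginary eigenvalues
  appear in the squared form \<open>B (B w) = - M *\<^sub>R w\<close>; complex scalars return later
  as bounded operators that commute with \<open>B\<close>. Maximizing the limit seminorm of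
  \<open>B\<close> takes the place of spectral theory for the limit semigroup.\<close>

locale dissipative_inverse =
  fixes H :: "'a::{real_inner,complete_space} set" and B :: "'a \<Rightarrow> 'a" and C :: real
  assumes subspace_H: "subspace H" and closed_H: "closed H"
    and B_in: "x \<in> H \<Longrightarrow> B x \<in> H"
    and B_add: "x \<in> H \<Longrightarrow> y \<in> H \<Longrightarrow> B (x + y) = B x + B y"
    and B_scale: "x \<in> H \<Longrightarrow> B (c *\<^sub>R x) = c *\<^sub>R B x"
    and B_bound: "x \<in> H \<Longrightarrow> norm (B x) \<le> C * norm x"
    and B_dissipative: "x \<in> H \<Longrightarrow> B x \<bullet> x \<le> 0"
    and B_inj: "x \<in> H \<Longrightarrow> B x = 0 \<Longrightarrow> x = 0"
begin

lemma H_add: "x \<in> H \<Longrightarrow> y \<in> H \<Longrightarrow> x + y \<in> H"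
  and H_diff: "x \<in> H \<Longrightarrow> y \<in> H \<Longrightarrow> x - y \<in> H"
  and H_scale: "x \<in> H \<Longrightarrow> c *\<^sub>R x \<in> H"
  and H_zero: "0 \<in> H"
  using subspace_H by (auto simp: subspace_add subspace_diff subspace_mul subspace_0)

lemmas H_intros = H_add H_diff H_scale H_zero B_in

lemma B_diff: "x \<in> H \<Longrightarrow> y \<in> H \<Longrightarrow> B (x - y) = B x - B y"
  using B_add[of x "(-1) *\<^sub>R y"] B_scale[of y "-1"] H_scale[of y "-1"] by simp

lemma B_zero: "B 0 = 0"
  using B_scale[of 0 0] H_zero by simp

lemma C_nonneg_bound: "x \<in> H \<Longrightarrow> norm (B x) \<le> \<bar>C\<bar> * norm x"
  using B_bound[of x] by (meson abs_ge_self mult_right_mono norm_ge_zero order_trans)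

text \<open>\<open>B\<close> is linear on \<open>H\<close> only, so continuity is derived from the
  bound applied to \<open>f i - x\<close>, which stays in \<open>H\<close>.\<close>

lemma B_tendsto:
  assumes "(f \<longlongrightarrow> x) F" "\<And>i. f i \<in> H" "x \<in> H"
  shows "((\<lambda>i. B (f i)) \<longlongrightarrow> B x) F"
proof (rule Lim_transform_bound[where g = "\<lambda>i. \<bar>C\<bar> *\<^sub>R (f i - x)", THEN LIM_zero_cancel])
  show "\<forall>\<^sub>F i in F. norm (B (f i) - B x) \<le> norm (\<bar>C\<bar> *\<^sub>R (f i - x))"
    using C_nonneg_bound[OF H_diff[OF assms(2) assms(3)]] assms by (simp add: B_diff[symmetric])
  show "((\<lambda>i. \<bar>C\<bar> *\<^sub>R (f i - x)) \<longlongrightarrow> 0) F"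
    using tendsto_scaleR[OF tendsto_const LIM_zero[OF assms(1)], of "\<bar>C\<bar>"] by simp
qed

section \<open>Resolvents of the unbounded inverse of \<open>B\<close>\<close>

text \<open>The difference \<open>d\<close> satisfies \<open>B d = l *\<^sub>R d\<close>, and
  pairing with \<open>d\<close> turns dissipativity into
  \<open>l * (norm d)\<^sup>2 \<le> 0\<close>.\<close>

lemma shifted_inverse_unique:
  assumes "l > 0" "g \<in> H" "h \<in> H" "B g - l *\<^sub>R g = B h - l *\<^sub>R h"
  shows "g = h"
proof -
  have "B (g - h) = l *\<^sub>R (g - h)"
    using assms by (simp add: B_diff algebra_simps)
  then have "l * (norm (g - h))\<^sup>2 \<le> 0"
    using B_dissipative[of "g - h"] assms(2,3) by (simp add: H_diff power2_norm_eq_inner)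
  then show ?thesis using assms(1) by (simp add: mult_le_0_iff)
qed

text \<open>The operator \<open>l - B\<close> is coercive, so a damped Richardson iteration solves the equation.\<close>

lemma shifted_inverse_exists:
  assumes l: "l > 0" and f: "f \<in> H"
  shows "\<exists>g\<in>H. B g - l *\<^sub>R g = f"
proof -
  \<comment> \<open>With \<open>l\<close> as coercivity constant of \<open>l - B\<close> and
    \<open>K\<close> as a bound of its norm, one step multiplies squared distances by at most
    \<open>1 - 2 * r * l + r\<^sup>2 * K\<^sup>2\<close>. The minimizing step size is
    \<open>r = l / K\<^sup>2\<close>, and the minimum is
    \<open>1 - l\<^sup>2 / K\<^sup>2\<close>.\<close>
  define K where "K = l + \<bar>C\<bar>"
  define r where "r = l / K\<^sup>2"
  define c where "c = sqrt (1 - l\<^sup>2 / K\<^sup>2)"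
  have K: "K \<ge> l" "K > 0" using l by (auto simp: K_def)
  have r: "r > 0" using l K by (simp add: r_def)
  have "l\<^sup>2 \<le> K\<^sup>2" using K l by (intro power_mono) auto
  then have lK: "l\<^sup>2 / K\<^sup>2 \<le> 1" "l\<^sup>2 / K\<^sup>2 > 0" using K l by (auto simp: divide_le_eq)
  have c: "0 \<le> c" "c < 1" using lK by (auto simp: c_def)
  define G where "G g = g - r *\<^sub>R (l *\<^sub>R g - B g + f)" for g
  have "\<exists>!g\<in>H. G g = g"
  proof (rule Banach_fix)
    show "complete H" using closed_H by (simp add: complete_eq_closed)
    show "H \<noteq> {}" using H_zero by auto
    show "G ` H \<subseteq> H" using f by (auto simp: G_def intro!: H_intros)
    fix x y assume xy: "x \<in> H" "y \<in> H"
    define d where "d = x - y"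
    have d: "d \<in> H" using xy by (auto simp: d_def H_intros)
    have e: "G x - G y = d - r *\<^sub>R (l *\<^sub>R d - B d)"
      using xy by (simp add: G_def d_def B_diff algebra_simps)
    have "norm (l *\<^sub>R d - B d) \<le> l * norm d + \<bar>C\<bar> * norm d"
      using norm_triangle_ineq4[of "l *\<^sub>R d" "B d"] C_nonneg_bound[OF d] l by simp
    then have n: "(norm (l *\<^sub>R d - B d))\<^sup>2 \<le> (K * norm d)\<^sup>2"
      by (intro power_mono) (auto simp: K_def algebra_simps)
    have "(norm (G x - G y))\<^sup>2
        = (norm d)\<^sup>2 - 2 * r * (l * (norm d)\<^sup>2 - B d \<bullet> d) + r\<^sup>2 * (norm (l *\<^sub>R d - B d))\<^sup>2"
      unfolding e power2_norm_eq_inner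
      by (simp add: inner_diff_left inner_diff_right inner_commute power2_eq_square algebra_simps)
    also have "\<dots> \<le> (norm d)\<^sup>2 - 2 * r * (l * (norm d)\<^sup>2) + r\<^sup>2 * (K * norm d)\<^sup>2"
    proof -
      have "2 * r * (B d \<bullet> d) \<le> 0" using B_dissipative[OF d] r by (simp add: mult_le_0_iff)
      moreover have "r\<^sup>2 * (norm (l *\<^sub>R d - B d))\<^sup>2 \<le> r\<^sup>2 * (K * norm d)\<^sup>2"
        using n by (intro mult_left_mono) auto
      ultimately show ?thesis by (simp add: algebra_simps)
    qed
    also have "\<dots> = (1 - l\<^sup>2 / K\<^sup>2) * (norm d)\<^sup>2"
      using K by (simp add: r_def field_simps power2_eq_square)
    also have "\<dots> = (c * norm d)\<^sup>2"
      using lK by (simp add: c_def power_mult_distrib)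
    finally show "dist (G x) (G y) \<le> c * dist x y"
      using c by (simp add: dist_norm d_def power2_le_iff_abs_le)
  qed (use c in auto)
  then obtain g where g: "g \<in> H" "G g = g" by auto
  then have "l *\<^sub>R g - B g + f = 0" using r by (simp add: G_def)
  then have "B g - l *\<^sub>R g = f" by (metis add.commute add_diff_cancel_left' diff_0 diff_eq_eq eq_diff_eq minus_diff_eq)
  then show ?thesis using g by auto
qed

text \<open>With \<open>A\<close> the inverse of \<open>B\<close>, \<open>AR l\<close> is \<open>A (1 - l A)\<^sup>-\<^sup>1\<close> and \<open>J l\<close> is the resolvent
  \<open>(1 - l A)\<^sup>-\<^sup>1\<close>; the value \<open>J 0 = id\<close> is set by hand.\<close>

definition AR :: "real \<Rightarrow> 'a \<Rightarrow> 'a" where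
  "AR l f = (THE g. g \<in> H \<and> B g - l *\<^sub>R g = f)"

definition J :: "real \<Rightarrow> 'a \<Rightarrow> 'a" where
  "J l f = (if l = 0 then f else B (AR l f))"

lemma AR:
  assumes "l > 0" "f \<in> H"
  shows "AR l f \<in> H" "B (AR l f) - l *\<^sub>R AR l f = f"
proof -
  have "\<exists>!g. g \<in> H \<and> B g - l *\<^sub>R g = f"
    using shifted_inverse_exists[OF assms] shifted_inverse_unique[OF assms(1)] by metis
  from theI'[OF this] show "AR l f \<in> H" "B (AR l f) - l *\<^sub>R AR l f = f"
    by (auto simp: AR_def)
qed

lemma AR_eq: "l > 0 \<Longrightarrow> g \<in> H \<Longrightarrow> AR l (B g - l *\<^sub>R g) = g"
  using AR[of l "B g - l *\<^sub>R g"] shifted_inverse_unique[of l "AR l (B g - l *\<^sub>R g)" g]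
  by (simp add: H_intros)

text \<open>Since \<open>A (B g) = g\<close>, the argument is \<open>(1 - l A) (B g)\<close>. Each
  element of \<open>H\<close> has this form, so identities for \<open>J\<close> reduce to identities
  for \<open>B\<close>.\<close>

lemma J_eq: "l > 0 \<Longrightarrow> g \<in> H \<Longrightarrow> J l (B g - l *\<^sub>R g) = B g"
  by (simp add: J_def AR_eq)

lemma J_minus: "l > 0 \<Longrightarrow> f \<in> H \<Longrightarrow> J l f = f + l *\<^sub>R AR l f"
  using AR[of l f] by (simp add: J_def algebra_simps)

lemma J_in: "l \<ge> 0 \<Longrightarrow> f \<in> H \<Longrightarrow> J l f \<in> H"
  using AR[of l f] by (auto simp: J_def H_intros)

lemma J_add: "l \<ge> 0 \<Longrightarrow> f \<in> H \<Longrightarrow> g \<in> H \<Longrightarrow> J l (f + g) = J l f + J l g"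
proof (cases "l = 0")
  case False
  assume "l \<ge> 0" and fg: "f \<in> H" "g \<in> H"
  with False have l: "l > 0" by simp
  note F = AR[OF l fg(1)] note G = AR[OF l fg(2)]
  have "B (AR l f + AR l g) - l *\<^sub>R (AR l f + AR l g)
      = (B (AR l f) - l *\<^sub>R AR l f) + (B (AR l g) - l *\<^sub>R AR l g)"
    using F(1) G(1) by (simp add: B_add algebra_simps)
  then have "B (AR l f + AR l g) - l *\<^sub>R (AR l f + AR l g) = f + g"
    using F(2) G(2) by simp
  then have "J l (f + g) = B (AR l f + AR l g)"
    using J_eq[OF l, of "AR l f + AR l g"] F(1) G(1) by (simp add: H_intros)
  then show ?thesis using F(1) G(1) False by (simp add: B_add J_def)
qed (simp add: J_def)

text \<open>Applying \<open>I\<close> to the equation that defines \<open>AR l f\<close> and using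
  uniqueness moves \<open>I\<close> through the resolvent. The same principle covers real scalars,
  \<open>B\<close> and the other resolvents.\<close>

lemma J_commute_linear:
  assumes I: "\<And>x. x \<in> H \<Longrightarrow> I x \<in> H" "\<And>x y. x \<in> H \<Longrightarrow> y \<in> H \<Longrightarrow> I (x - y) = I x - I y"
    "\<And>x c. x \<in> H \<Longrightarrow> I (c *\<^sub>R x) = c *\<^sub>R I x" "\<And>x. x \<in> H \<Longrightarrow> I (B x) = B (I x)"
    and "l \<ge> 0" "f \<in> H"
  shows "J l (I f) = I (J l f)"
proof (cases "l = 0")
  case False
  with assms have l: "l > 0" by simp
  note F = AR[OF l assms(6)]
  have "B (I (AR l f)) - l *\<^sub>R I (AR l f) = I f"
    using F I by (metis H_scale B_in)
  then show ?thesis using J_eq[OF l I(1)[OF F(1)]] I(4)[OF F(1)] False by (simp add: J_def)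
qed (simp add: J_def)

lemma J_scale: "l \<ge> 0 \<Longrightarrow> f \<in> H \<Longrightarrow> J l (c *\<^sub>R f) = c *\<^sub>R J l f"
  by (rule J_commute_linear) (auto simp: H_intros B_scale scaleR_diff_right)

lemma J_diff: "l \<ge> 0 \<Longrightarrow> f \<in> H \<Longrightarrow> g \<in> H \<Longrightarrow> J l (f - g) = J l f - J l g"
  using J_add[of l f "(-1) *\<^sub>R g"] J_scale[of l g "-1"] H_scale[of g "-1"] by simp

lemma J_B: "l \<ge> 0 \<Longrightarrow> f \<in> H \<Longrightarrow> J l (B f) = B (J l f)"
  by (rule J_commute_linear) (auto simp: H_intros B_diff B_scale)

lemma J_J: "a \<ge> 0 \<Longrightarrow> b \<ge> 0 \<Longrightarrow> f \<in> H \<Longrightarrow> J a (J b f) = J b (J a f)"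
  by (rule J_commute_linear) (auto simp: J_in J_diff J_scale J_B)

text \<open>Pairing \<open>f = B g - l *\<^sub>R g\<close>, where \<open>g = AR l f\<close>, with
  \<open>J l f = B g\<close> leaves \<open>(norm (J l f))\<^sup>2 \<le> J l f \<bullet> f\<close>,
  because the remaining term has a sign by dissipativity.\<close>

lemma J_contraction:
  assumes "l \<ge> 0" "f \<in> H"
  shows "norm (J l f) \<le> norm f"
proof (cases "l = 0")
  case False
  with assms have l: "l > 0" by simp
  note F = AR[OF l assms(2)]
  have "(norm (J l f))\<^sup>2 \<le> J l f \<bullet> f"
  proof -
    have "J l f \<bullet> f = (norm (J l f))\<^sup>2 - l * (B (AR l f) \<bullet> AR l f)"
      using F(2) False by (simp add: J_def power2_norm_eq_inner)
        (metis inner_diff_right inner_scaleR_right)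
    then show ?thesis using B_dissipative[OF F(1)] l by (simp add: mult_le_0_iff)
  qed
  also have "\<dots> \<le> norm (J l f) * norm f" by (rule norm_cauchy_schwarz)
  finally have "norm (J l f) * norm (J l f) \<le> norm (J l f) * norm f"
    by (simp add: power2_eq_square)
  then show ?thesis
    by (cases "norm (J l f) = 0") (auto simp: mult_le_cancel_left)
qed (simp add: J_def)

text \<open>On the range of \<open>B\<close> the resolvent deviates from the identity by order
  \<open>l\<close>: \<open>A\<close> commutes with \<open>J l\<close>, hence
  \<open>l A (J l (B f)) = l J l f\<close>.\<close>

lemma J_B_minus: "l \<ge> 0 \<Longrightarrow> f \<in> H \<Longrightarrow> J l (B f) = B f + l *\<^sub>R J l f"
proof (cases "l = 0")
  case False
  assume "l \<ge> 0" and f: "f \<in> H"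
  with False have l: "l > 0" by simp
  note F = AR[OF l f]
  have "AR l (B f) = J l f"
  proof -
    have "B (J l f) - l *\<^sub>R J l f = B (f + l *\<^sub>R AR l f) - l *\<^sub>R B (AR l f)"
      using J_minus[OF l f] False by (metis J_def)
    also have "\<dots> = B f" using F(1) f by (simp add: B_add B_scale H_intros)
    finally have "B (J l f) - l *\<^sub>R J l f = B f" .
    then show ?thesis using AR_eq[OF l J_in[of l f]] l f by simp
  qed
  then show ?thesis using J_minus[OF l, of "B f"] f by (simp add: B_in)
qed (simp add: J_def)

text \<open>With \<open>c = a + b\<close>, the identity
  \<open>(1 - c A) - (1 - a A) (1 - b A) = - a b A\<^sup>2\<close> gives
  \<open>J a J b - J c = - a b A\<^sup>2 J a J b J c\<close>. On \<open>B (B z)\<close> the factor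
  \<open>A\<^sup>2\<close> cancels, and three contractions remain.\<close>

lemma J_local_error:
  assumes a: "a \<ge> 0" and b: "b \<ge> 0" and z: "z \<in> H"
  shows "norm (J a (J b (B (B z))) - J (a + b) (B (B z))) \<le> a * b * norm z"
proof -
  let ?c = "a + b"
  have c: "?c \<ge> 0" using a b by simp
  note m = a b c z H_intros J_in
  define w where "w = J ?c z"
  have w: "w \<in> H" using m by (simp add: w_def)
  have Bz: "B z = B w - ?c *\<^sub>R w"
    using J_B_minus[OF c z] J_B[OF c z] by (simp add: w_def)
  define y where "y = J a (J b w)"
  have y: "y \<in> H" using m w by (simp add: y_def)
  have 1: "J b (B w) = B w + b *\<^sub>R J b w" using J_B_minus[OF b w] .
  have Jbw: "J b w \<in> H" using m w by simp
  have Bw: "B w = B (J b w) - b *\<^sub>R J b w" using 1 J_B[OF b w] by simp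
  have Bjw: "B (J b w) = B y - a *\<^sub>R y"
    using J_B_minus[OF a Jbw] J_B[OF a Jbw] by (simp add: y_def)
  have BBz: "J ?c (B (B z)) = B (B w)" using m by (simp add: J_B w_def)
  have "J a (J b (B (B z))) = J a (J b (B (B w - ?c *\<^sub>R w)))" using Bz by simp
  also have "\<dots> = B (B y) - ?c *\<^sub>R B y"
    using w m by (simp add: B_diff B_scale J_diff J_scale J_B y_def)
  finally have L: "J a (J b (B (B z))) = B (B y) - ?c *\<^sub>R B y" .
  have "B (B w) = B (B (J b w)) - b *\<^sub>R B (J b w)"
    using Bw Jbw by (simp add: B_diff B_scale H_intros)
  also have "\<dots> = B (B y) - a *\<^sub>R B y - b *\<^sub>R (B y - a *\<^sub>R y)"
    using Bjw y by (simp add: B_diff B_scale H_intros)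
  finally have "J a (J b (B (B z))) - J ?c (B (B z)) = - (a * b) *\<^sub>R y"
    unfolding L BBz by (simp add: algebra_simps)
  moreover have "norm y \<le> norm z"
    using J_contraction[OF a Jbw] J_contraction[OF b w] J_contraction[OF c z]
    by (simp add: y_def w_def)
  ultimately show ?thesis using a b by (simp add: mult_left_mono)
qed

section \<open>Density of the range of \<open>B\<close>\<close>

text \<open>Dissipativity between two resolvents makes the defects
  \<open>a n = J (l n) x - x\<close> a Cauchy sequence, without weak compactness. Their limit is
  annihilated by \<open>B\<close>, because \<open>B (a n) = l n *\<^sub>R J (l n) x\<close> tends to
  \<open>0\<close>, and injectivity forces it to be \<open>0\<close>.\<close>

lemma J_tendsto_id:
  assumes x: "x \<in> H"
  shows "(\<lambda>n. J (inverse (real (Suc n))) x) \<longlonglongrightarrow> x"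
proof -
  define l where "l n = inverse (real (Suc n))" for n
  have l: "l n > 0" for n by (simp add: l_def)
  define g where "g n = AR (l n) x" for n
  define a where "a n = J (l n) x - x" for n
  have a_eq: "a n = l n *\<^sub>R g n" for n using J_minus[OF l x] by (simp add: a_def g_def)
  have gH: "g n \<in> H" for n using AR(1)[OF l x] by (simp add: g_def)
  have aH: "a n \<in> H" for n by (simp add: a_eq H_scale gH)
  \<comment> \<open>The defects are \<open>l n\<close> times the elements \<open>g n\<close>, and
    dissipativity for \<open>g m - g n\<close> reads
    \<open>(a m - a n) \<bullet> (a m / l m - a n / l n) \<le> 0\<close>. As
    \<open>l m < l n\<close>, this bounds the squared distance by the drop of the squared
    norms.\<close>
  have key: "(norm (a m - a n))\<^sup>2 \<le> (norm (a n))\<^sup>2 - (norm (a m))\<^sup>2" if "n < m" for m n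
  proof -
    have lt: "l m < l n" using that by (simp add: l_def)
    have "B (g m - g n) = a m - a n"
      using gH l by (simp add: B_diff a_def J_def g_def less_imp_neq[symmetric])
    then have "(a m - a n) \<bullet> (g m - g n) \<le> 0"
      using B_dissipative[OF H_diff[OF gH gH]] by metis
    moreover have "g k = (1 / l k) *\<^sub>R a k" for k using l[of k] by (simp add: a_eq)
    ultimately have "(a m - a n) \<bullet> ((1 / l m) *\<^sub>R a m - (1 / l n) *\<^sub>R a n) \<le> 0" by metis
    then have "(a m \<bullet> a m) / l m + (a n \<bullet> a n) / l n \<le> (1 / l m + 1 / l n) * (a m \<bullet> a n)"
      by (simp add: inner_diff_left inner_diff_right inner_commute algebra_simps)
    then have "l m * l n * ((a m \<bullet> a m) / l m + (a n \<bullet> a n) / l n) \<le> l m * l n * ((1 / l m + 1 / l n) * (a m \<bullet> a n))"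
      using l[of m] l[of n] by (intro mult_left_mono) auto
    moreover have "l m * l n * ((a m \<bullet> a m) / l m + (a n \<bullet> a n) / l n) = l n * (a m \<bullet> a m) + l m * (a n \<bullet> a n)"
      using l[of m] l[of n] by (simp add: field_simps)
    moreover have "l m * l n * ((1 / l m + 1 / l n) * (a m \<bullet> a n)) = (l n + l m) * (a m \<bullet> a n)"
      using l[of m] l[of n] by (simp add: field_simps)
    ultimately have le: "l n * (a m \<bullet> a m) + l m * (a n \<bullet> a n) \<le> (l n + l m) * (a m \<bullet> a n)"
      by simp
    have "(l n + l m) * (norm (a m - a n))\<^sup>2
        = (l n + l m) * (a m \<bullet> a m + a n \<bullet> a n) - 2 * ((l n + l m) * (a m \<bullet> a n))"
      by (simp add: power2_norm_eq_inner inner_diff_left inner_diff_right inner_commute algebra_simps)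
    also have "\<dots> \<le> (l n + l m) * (a m \<bullet> a m + a n \<bullet> a n) - 2 * (l n * (a m \<bullet> a m) + l m * (a n \<bullet> a n))"
      using le by (intro diff_left_mono mult_left_mono) auto
    also have "\<dots> = (l n - l m) * (a n \<bullet> a n - a m \<bullet> a m)"
      by (simp add: algebra_simps)
    finally have "(l n + l m) * (norm (a m - a n))\<^sup>2 \<le> (l n - l m) * (a n \<bullet> a n - a m \<bullet> a m)" .
    then have 1: "(l n + l m) * (norm (a m - a n))\<^sup>2 \<le> (l n - l m) * ((norm (a n))\<^sup>2 - (norm (a m))\<^sup>2)"
      by (simp add: power2_norm_eq_inner)
    have "0 \<le> (l n + l m) * (norm (a m - a n))\<^sup>2" using l[of m] l[of n] by simp
    with 1 have "0 \<le> (l n - l m) * ((norm (a n))\<^sup>2 - (norm (a m))\<^sup>2)" by linarith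
    then have 2: "0 \<le> (norm (a n))\<^sup>2 - (norm (a m))\<^sup>2" using lt by (simp add: zero_le_mult_iff)
    have "(l n - l m) * ((norm (a n))\<^sup>2 - (norm (a m))\<^sup>2) \<le> (l n + l m) * ((norm (a n))\<^sup>2 - (norm (a m))\<^sup>2)"
      using 2 l[of m] by (intro mult_right_mono) auto
    with 1 have "(l n + l m) * (norm (a m - a n))\<^sup>2 \<le> (l n + l m) * ((norm (a n))\<^sup>2 - (norm (a m))\<^sup>2)" by linarith
    then show ?thesis using l[of m] l[of n] by (simp add: mult_le_cancel_left)
  qed
  have dec: "decseq (\<lambda>n. (norm (a n))\<^sup>2)"
  proof (rule decseq_SucI)
    fix n have "0 \<le> (norm (a (Suc n) - a n))\<^sup>2" by simp
    with key[of n "Suc n"] show "(norm (a (Suc n)))\<^sup>2 \<le> (norm (a n))\<^sup>2" by linarith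
  qed
  then obtain L where "(\<lambda>n. (norm (a n))\<^sup>2) \<longlonglongrightarrow> L"
    using decseq_convergent[of _ 0] by (metis zero_le_power2)
  then have Cn: "Cauchy (\<lambda>n. (norm (a n))\<^sup>2)" by (auto intro: convergent_Cauchy convergentI)
  have "Cauchy a"
    unfolding Cauchy_altdef
  proof (intro allI impI)
    fix e :: real assume "e > 0"
    then obtain M where M: "\<And>m n. m \<ge> M \<Longrightarrow> n > m \<Longrightarrow> dist ((norm (a m))\<^sup>2) ((norm (a n))\<^sup>2) < e\<^sup>2"
      using Cn unfolding Cauchy_altdef by (meson zero_less_power)
    have "dist (a m) (a n) < e" if mn: "m \<ge> M" "n > m" for m n
    proof -
      have "(norm (a n - a m))\<^sup>2 < e\<^sup>2"
        using key[OF mn(2)] M[OF mn] by (simp add: dist_real_def)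
      then show ?thesis using \<open>e > 0\<close>
        by (simp add: dist_norm norm_minus_commute power_less_imp_less_base)
    qed
    then show "\<exists>M. \<forall>m\<ge>M. \<forall>n>m. dist (a m) (a n) < e" by blast
  qed
  then obtain a' where a': "a \<longlonglongrightarrow> a'" using Cauchy_convergent convergent_def by blast
  have a'H: "a' \<in> H" using closed_sequentially[OF closed_H aH a'] .
  have "(\<lambda>n. B (a n)) \<longlonglongrightarrow> 0"
  proof (rule Lim_null_comparison)
    have "norm (B (a n)) \<le> l n * norm x" for n
    proof -
      have "B (a n) = l n *\<^sub>R J (l n) x"
        using gH l[of n] by (simp add: a_eq B_scale J_def g_def)
      then show ?thesis using J_contraction[OF less_imp_le[OF l] x, of n] l[of n]
        by (simp add: mult_left_mono)
    qed
    then show "\<forall>\<^sub>F n in sequentially. norm (B (a n)) \<le> l n * norm x" by simp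
    show "(\<lambda>n. l n * norm x) \<longlonglongrightarrow> 0"
      using tendsto_mult_left_zero[OF LIMSEQ_inverse_real_of_nat] by (simp add: l_def)
  qed
  then have "B a' = 0" using B_tendsto[OF a' aH a'H] LIMSEQ_unique by blast
  then have "a' = 0" using B_inj[OF a'H] by simp
  then have "(\<lambda>n. J (l n) x - x) \<longlonglongrightarrow> 0" using a' unfolding a_def by simp
  from LIM_zero_cancel[OF this] show ?thesis unfolding l_def .
qed

lemma dense_range_B:
  assumes "x \<in> H" "e > 0"
  obtains z where "z \<in> H" "norm (x - B z) < e"
proof -
  obtain n where "norm (J (inverse (real (Suc n))) x - x) < e"
    using J_tendsto_id[OF assms(1)] assms(2) by (metis LIMSEQ_iff order_refl)
  then show ?thesis
    using that[of "AR (inverse (real (Suc n))) x"] AR(1)[of "inverse (real (Suc n))" x] assms(1)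
    by (simp add: J_def norm_minus_commute)
qed

lemma dense_range_B2:
  assumes "x \<in> H" "e > 0"
  obtains z where "z \<in> H" "norm (x - B (B z)) < e"
proof -
  obtain y where y: "y \<in> H" "norm (x - B y) < e / 2" using dense_range_B[of x "e/2"] assms by auto
  define d where "d = e / (2 * (\<bar>C\<bar> + 1))"
  have d: "d > 0" using assms by (simp add: d_def)
  obtain z where z: "z \<in> H" "norm (y - B z) < d" using dense_range_B[OF y(1) d] by auto
  have "norm (B y - B (B z)) \<le> \<bar>C\<bar> * norm (y - B z)"
    using C_nonneg_bound[of "y - B z"] y z by (simp add: B_diff H_intros)
  also have "\<dots> \<le> \<bar>C\<bar> * d" using z by (intro mult_left_mono) auto
  also have "\<dots> \<le> e / 2" using assms by (simp add: d_def field_simps)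
  finally have "norm (x - B (B z)) < e"
    using y(2) norm_triangle_ineq[of "x - B y" "B y - B (B z)"] by simp
  then show ?thesis using that z by blast
qed

section \<open>Powers of resolvents and the limit of the dyadic Euler scheme\<close>

lemma JN_in: "l \<ge> 0 \<Longrightarrow> x \<in> H \<Longrightarrow> (J l ^^ n) x \<in> H"
  by (induction n) (auto simp: J_in)

lemma JN_diff: "l \<ge> 0 \<Longrightarrow> x \<in> H \<Longrightarrow> y \<in> H \<Longrightarrow> (J l ^^ n) (x - y) = (J l ^^ n) x - (J l ^^ n) y"
  by (induction n) (auto simp: J_diff JN_in)

lemma JN_contraction: "l \<ge> 0 \<Longrightarrow> x \<in> H \<Longrightarrow> norm ((J l ^^ n) x) \<le> norm x"
  by (induction n) (auto intro: order_trans[OF J_contraction] simp: JN_in)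

lemma JN_commute_linear:
  assumes I: "\<And>x. x \<in> H \<Longrightarrow> I x \<in> H" "\<And>x y. x \<in> H \<Longrightarrow> y \<in> H \<Longrightarrow> I (x - y) = I x - I y"
    "\<And>x c. x \<in> H \<Longrightarrow> I (c *\<^sub>R x) = c *\<^sub>R I x" "\<And>x. x \<in> H \<Longrightarrow> I (B x) = B (I x)"
    and "l \<ge> 0" "f \<in> H"
  shows "(J l ^^ n) (I f) = I ((J l ^^ n) f)"
proof (induction n)
  case (Suc n)
  have "J l (I ((J l ^^ n) f)) = I (J l ((J l ^^ n) f))"
    by (rule J_commute_linear) (use assms JN_in in auto)
  then show ?case using Suc by simp
qed simp

text \<open>For commuting contractions the next difference of powers is
  \<open>P (P^n x - Q^n x) + Q^n (P x - Q x)\<close>, so each of the \<open>n\<close> factors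
  contributes at most one copy of \<open>norm (P x - Q x)\<close>.\<close>

lemma telescope:
  assumes P: "\<And>x. x \<in> H \<Longrightarrow> P x \<in> H" "\<And>x y. x \<in> H \<Longrightarrow> y \<in> H \<Longrightarrow> P (x - y) = P x - P y"
      "\<And>x. x \<in> H \<Longrightarrow> norm (P x) \<le> norm x"
    and Q: "\<And>x. x \<in> H \<Longrightarrow> Q x \<in> H" "\<And>x y. x \<in> H \<Longrightarrow> y \<in> H \<Longrightarrow> Q (x - y) = Q x - Q y"
      "\<And>x. x \<in> H \<Longrightarrow> norm (Q x) \<le> norm x"
    and PQ: "\<And>x. x \<in> H \<Longrightarrow> P (Q x) = Q (P x)" and x: "x \<in> H"
  shows "norm ((P ^^ n) x - (Q ^^ n) x) \<le> real n * norm (P x - Q x)"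
proof (induction n)
  case (Suc n)
  have PH: "(P ^^ k) y \<in> H" and QH: "(Q ^^ k) y \<in> H" if "y \<in> H" for k y
    using that P Q by (induction k) auto
  have Qd: "(Q ^^ k) (u - v) = (Q ^^ k) u - (Q ^^ k) v" if "u \<in> H" "v \<in> H" for k u v
    using that Q QH by (induction k) auto
  have Qn: "norm ((Q ^^ k) u) \<le> norm u" if "u \<in> H" for k u
    using that
  proof (induction k)
    case (Suc k)
    then show ?case using Q(3)[OF QH[of u k]] by simp
  qed simp
  have PQn: "P ((Q ^^ k) u) = (Q ^^ k) (P u)" if "u \<in> H" for k u
    using that PQ QH by (induction k) auto
  have "(P ^^ Suc n) x - (Q ^^ Suc n) x
      = P ((P ^^ n) x - (Q ^^ n) x) + (Q ^^ n) (P x - Q x)"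
  proof -
    have "(Q ^^ n) (Q x) = Q ((Q ^^ n) x)" by (rule funpow_swap1[symmetric])
    then show ?thesis using P Q PH QH Qd PQn x by simp
  qed
  then have "norm ((P ^^ Suc n) x - (Q ^^ Suc n) x)
      \<le> norm (P ((P ^^ n) x - (Q ^^ n) x)) + norm ((Q ^^ n) (P x - Q x))"
    by (metis norm_triangle_ineq)
  also have "\<dots> \<le> norm ((P ^^ n) x - (Q ^^ n) x) + norm (P x - Q x)"
    using P(3)[of "(P ^^ n) x - (Q ^^ n) x"] Qn[of "P x - Q x"] PH QH P Q x H_diff
    by (meson add_mono)
  finally show ?case using Suc by (simp add: algebra_simps)
qed simp

text \<open>Commutation merges the two products into powers of the composed step, to which the
  telescoping estimate applies; the \<open>n\<close> local errors add up.\<close>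

lemma JN_product_error:
  assumes a: "a \<ge> 0" and b: "b \<ge> 0" and z: "z \<in> H"
  shows "norm ((J a ^^ n) ((J b ^^ n) (B (B z))) - (J (a + b) ^^ n) (B (B z))) \<le> real n * (a * b * norm z)"
proof -
  have comm: "(J a ^^ n) ((J b ^^ n) x) = ((\<lambda>x. J a (J b x)) ^^ n) x" if "x \<in> H" for x n
  proof (induction n)
    case (Suc n)
    have "(J a ^^ n) (J b y) = J b ((J a ^^ n) y)" if "y \<in> H" for y
      by (rule JN_commute_linear) (use a b that in \<open>auto simp: J_in J_diff J_scale J_B\<close>)
    then show ?case using Suc JN_in[OF b that] by simp
  qed simp
  have "norm (((\<lambda>x. J a (J b x)) ^^ n) (B (B z)) - (J (a + b) ^^ n) (B (B z)))
     \<le> real n * norm (J a (J b (B (B z))) - J (a + b) (B (B z)))"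
  proof (rule telescope)
    fix x assume x: "x \<in> H"
    show "norm (J a (J b x)) \<le> norm x"
      using J_contraction[OF a J_in[OF b x]] J_contraction[OF b x] by linarith
    show "J a (J b (J (a + b) x)) = J (a + b) (J a (J b x))"
      using a b x J_J[of b "a + b" x] J_J[of a "a + b" "J b x"] by (simp add: J_in)
  qed (use a b z in \<open>auto simp: J_in J_diff J_contraction H_intros\<close>)
  also have "\<dots> \<le> real n * (a * b * norm z)"
    using J_local_error[OF a b z] by (intro mult_left_mono) auto
  finally show ?thesis using z by (simp add: comm H_intros)
qed

text \<open>Halving the step size replaces \<open>J (2 h)\<close> by two applications of \<open>J h\<close>, so along dyadic steps
  consecutive Euler approximations differ by one local error per step.\<close>

definition euler :: "real \<Rightarrow> nat \<Rightarrow> 'a \<Rightarrow> 'a" where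
  "euler t k = J (t / 2 ^ k) ^^ (2 ^ k)"

definition T :: "real \<Rightarrow> 'a \<Rightarrow> 'a" where
  "T t x = lim (\<lambda>k. euler t k x)"

lemma euler_in: "t \<ge> 0 \<Longrightarrow> x \<in> H \<Longrightarrow> euler t k x \<in> H"
  and euler_diff: "t \<ge> 0 \<Longrightarrow> x \<in> H \<Longrightarrow> y \<in> H \<Longrightarrow> euler t k (x - y) = euler t k x - euler t k y"
  and euler_contraction: "t \<ge> 0 \<Longrightarrow> x \<in> H \<Longrightarrow> norm (euler t k x) \<le> norm x"
  by (auto simp: euler_def JN_in JN_diff JN_contraction)

lemma euler_step:
  assumes t: "t \<ge> 0" and z: "z \<in> H"
  shows "norm (euler t (Suc k) (B (B z)) - euler t k (B (B z))) \<le> t\<^sup>2 * norm z / 4 * (1/2) ^ k"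
proof -
  let ?h = "t / 2 ^ Suc k"
  have h: "?h \<ge> 0" using t by simp
  have "(2::nat) ^ Suc k = 2 ^ k + 2 ^ k" by simp
  then have "euler t (Suc k) x = (J ?h ^^ 2 ^ k) ((J ?h ^^ 2 ^ k) x)" for x
    unfolding euler_def by (metis comp_apply funpow_add)
  moreover have "?h + ?h = t / 2 ^ k" by simp
  ultimately have "norm (euler t (Suc k) (B (B z)) - euler t k (B (B z))) \<le> real (2 ^ k) * (?h * ?h * norm z)"
    using JN_product_error[OF h h z, of "2 ^ k"] by (metis euler_def)
  also have "\<dots> = t\<^sup>2 * norm z / 4 * (1/2) ^ k"
    by (simp add: field_simps power2_eq_square)
  finally show ?thesis .
qed

text \<open>The difference of two powers, instead of the cruder \<open>(1/2) ^ m\<close>, lets the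
  geometric series be summed inside the induction. The case \<open>m = 0\<close> later compares the
  limit with a single implicit step.\<close>

lemma euler_diff_bound:
  assumes t: "t \<ge> 0" and z: "z \<in> H" and mn: "m \<le> n"
  shows "norm (euler t n (B (B z)) - euler t m (B (B z))) \<le> t\<^sup>2 * norm z / 2 * ((1/2) ^ m - (1/2) ^ n)"
  using mn
proof (induction n rule: dec_induct)
  case (step n)
  have "norm (euler t (Suc n) (B (B z)) - euler t m (B (B z)))
      \<le> norm (euler t (Suc n) (B (B z)) - euler t n (B (B z))) + norm (euler t n (B (B z)) - euler t m (B (B z)))"
    using norm_triangle_ineq[of "euler t (Suc n) (B (B z)) - euler t n (B (B z))" "euler t n (B (B z)) - euler t m (B (B z))"] by simp
  also have "\<dots> \<le> t\<^sup>2 * norm z / 4 * (1/2) ^ n + t\<^sup>2 * norm z / 2 * ((1/2) ^ m - (1/2) ^ n)"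
    using step euler_step[OF t z, of n] by linarith
  also have "\<dots> = t\<^sup>2 * norm z / 2 * ((1/2) ^ m - (1/2) ^ Suc n)"
    by (simp add: algebra_simps)
  finally show ?case .
qed simp

text \<open>Only elements \<open>B (B z)\<close> have a controlled error. Contractivity of the
  approximations, uniform in \<open>k\<close>, transfers convergence to the closure of these
  elements, which is all of \<open>H\<close>.\<close>

lemma euler_Cauchy:
  assumes t: "t \<ge> 0" and x: "x \<in> H"
  shows "Cauchy (\<lambda>k. euler t k x)"
  unfolding Cauchy_altdef
proof (intro allI impI)
  fix e :: real assume e: "e > 0"
  obtain z where z: "z \<in> H" "norm (x - B (B z)) < e / 4" using dense_range_B2[OF x, of "e/4"] e by auto
  let ?w = "B (B z)"
  have w: "?w \<in> H" using z by (simp add: H_intros)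
  have "(\<lambda>m. t\<^sup>2 * norm z / 2 * (1/2) ^ m) \<longlonglongrightarrow> 0"
    by (intro tendsto_mult_right_zero LIMSEQ_realpow_zero) auto
  then obtain M where M: "\<And>m. m \<ge> M \<Longrightarrow> t\<^sup>2 * norm z / 2 * (1/2) ^ m < e / 4"
    using order_tendstoD(2)[OF \<open>(\<lambda>m. t\<^sup>2 * norm z / 2 * (1/2) ^ m) \<longlonglongrightarrow> 0\<close>, of "e/4"] e
    unfolding eventually_sequentially by (metis divide_pos_pos zero_less_numeral)
  have "dist (euler t m x) (euler t n x) < e" if mn: "m \<ge> M" "n > m" for m n
  proof -
    have A: "norm (euler t k x - euler t k ?w) < e / 4" for k
      using euler_contraction[OF t H_diff[OF x w], of k] z(2) euler_diff[OF t x w] by simp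
    have "norm (euler t n ?w - euler t m ?w) \<le> t\<^sup>2 * norm z / 2 * ((1/2) ^ m - (1/2) ^ n)"
      using euler_diff_bound[OF t z(1), of m n] mn by simp
    also have "\<dots> \<le> t\<^sup>2 * norm z / 2 * (1/2) ^ m" by (intro mult_left_mono) auto
    finally have "norm (euler t n ?w - euler t m ?w) < e / 4" using M[OF mn(1)] by linarith
    moreover have "norm (euler t m x - euler t n x) \<le> norm (euler t m x - euler t m ?w)
       + norm (euler t n ?w - euler t m ?w) + norm (euler t n x - euler t n ?w)"
      by norm
    ultimately show ?thesis using A[of m] A[of n] e by (simp add: dist_norm)
  qed
  then show "\<exists>M. \<forall>m\<ge>M. \<forall>n>m. dist (euler t m x) (euler t n x) < e" by blast
qed

lemma euler_tendsto: "t \<ge> 0 \<Longrightarrow> x \<in> H \<Longrightarrow> (\<lambda>k. euler t k x) \<longlonglongrightarrow> T t x"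
  using euler_Cauchy Cauchy_convergent convergent_LIMSEQ_iff unfolding T_def by blast

lemma T_in: "t \<ge> 0 \<Longrightarrow> x \<in> H \<Longrightarrow> T t x \<in> H"
  by (rule closed_sequentially[OF closed_H _ euler_tendsto]) (simp_all add: euler_in)

lemma T_diff:
  assumes "t \<ge> 0" "x \<in> H" "y \<in> H"
  shows "T t (x - y) = T t x - T t y"
proof (rule LIMSEQ_unique)
  show "(\<lambda>k. euler t k (x - y)) \<longlonglongrightarrow> T t (x - y)"
    using assms by (intro euler_tendsto H_diff)
  show "(\<lambda>k. euler t k (x - y)) \<longlonglongrightarrow> T t x - T t y"
    using tendsto_diff[OF euler_tendsto[of t x] euler_tendsto[of t y]] assms by (simp add: euler_diff)
qed

lemma T_contraction: "t \<ge> 0 \<Longrightarrow> x \<in> H \<Longrightarrow> norm (T t x) \<le> norm x"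
  by (rule LIMSEQ_le_const2[OF tendsto_norm[OF euler_tendsto]]) (auto simp: euler_contraction)

lemma T_zero: "T 0 x = x"
proof -
  have "(J 0 ^^ n) x = x" for n by (induction n) (auto simp: J_def)
  then show ?thesis by (simp add: T_def euler_def)
qed

text \<open>Boundedness of \<open>I\<close> allows passage to the limit. Besides \<open>B\<close>
  and the real scalars, the complex scalars of the concrete space will be instances.\<close>

lemma T_commute_linear:
  assumes I: "\<And>x. x \<in> H \<Longrightarrow> I x \<in> H" "\<And>x y. x \<in> H \<Longrightarrow> y \<in> H \<Longrightarrow> I (x - y) = I x - I y"
    "\<And>x c. x \<in> H \<Longrightarrow> I (c *\<^sub>R x) = c *\<^sub>R I x" "\<And>x. x \<in> H \<Longrightarrow> I (B x) = B (I x)"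
    and bd: "\<And>x. x \<in> H \<Longrightarrow> norm (I x) \<le> K * norm x"
    and t: "t \<ge> 0" and x: "x \<in> H"
  shows "T t (I x) = I (T t x)"
proof -
  have "(\<lambda>k. I (euler t k x)) \<longlonglongrightarrow> T t (I x)"
    using euler_tendsto[OF t I(1)[OF x]] JN_commute_linear[OF I] x t by (simp add: euler_def)
  moreover have "(\<lambda>k. I (euler t k x)) \<longlonglongrightarrow> I (T t x)"
  proof (rule LIM_zero_cancel, rule Lim_null_comparison)
    show "\<forall>\<^sub>F k in sequentially. norm (I (euler t k x) - I (T t x)) \<le> K * norm (euler t k x - T t x)"
      using bd I(2) t x by (metis (no_types, lifting) H_diff T_in eventually_sequentiallyI euler_in)
    show "(\<lambda>k. K * norm (euler t k x - T t x)) \<longlonglongrightarrow> 0"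
      using euler_tendsto[OF t x] by (intro tendsto_mult_right_zero tendsto_norm_zero LIM_zero)
  qed
  ultimately show ?thesis using LIMSEQ_unique by blast
qed

lemma T_B: "t \<ge> 0 \<Longrightarrow> x \<in> H \<Longrightarrow> T t (B x) = B (T t x)"
  by (rule T_commute_linear[where K = C]) (auto simp: H_intros B_diff B_scale B_bound)

lemma T_scale: "t \<ge> 0 \<Longrightarrow> x \<in> H \<Longrightarrow> T t (c *\<^sub>R x) = c *\<^sub>R T t x"
  by (rule T_commute_linear[where K = "\<bar>c\<bar>"]) (auto simp: H_intros B_scale scaleR_diff_right)

lemma T_add: "t \<ge> 0 \<Longrightarrow> x \<in> H \<Longrightarrow> y \<in> H \<Longrightarrow> T t (x + y) = T t x + T t y"
  using T_diff[of t x "(-1) *\<^sub>R y"] T_scale[of t y "-1"] H_scale[of y "-1"] by simp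

text \<open>On \<open>B (B z)\<close>, steps of size \<open>t / 2 ^ k\<close> followed by as many of
  size \<open>s / 2 ^ k\<close> differ from steps of size \<open>(t + s) / 2 ^ k\<close> by at most
  \<open>t * s * norm z * (1/2) ^ k\<close>, so arbitrary real times need no common subdivision.
  Density and contractivity give the rest.\<close>

lemma T_semigroup:
  assumes t: "t \<ge> 0" and s: "s \<ge> 0" and x: "x \<in> H"
  shows "T (t + s) x = T t (T s x)"
proof -
  have ts: "t + s \<ge> 0" using t s by simp
  have smooth: "T (t + s) (B (B z)) = T t (T s (B (B z)))" if z: "z \<in> H" for z
  proof -
    let ?x = "B (B z)"
    have x: "?x \<in> H" using z by (simp add: H_intros)
    have A: "(\<lambda>k. euler t k (euler s k ?x) - euler (t + s) k ?x) \<longlonglongrightarrow> 0"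
    proof (rule Lim_null_comparison)
      have "norm (euler t k (euler s k ?x) - euler (t + s) k ?x) \<le> t * s * norm z * (1/2) ^ k" for k
      proof -
        have "norm (euler t k (euler s k ?x) - euler (t + s) k ?x)
          \<le> real (2 ^ k) * (t / 2 ^ k * (s / 2 ^ k) * norm z)"
          using JN_product_error[of "t / 2 ^ k" "s / 2 ^ k" z "2 ^ k"] t s z
          by (simp add: euler_def add_divide_distrib)
        also have "\<dots> = t * s * norm z * (1/2) ^ k" by (simp add: field_simps)
        finally show ?thesis .
      qed
      then show "\<forall>\<^sub>F k in sequentially. norm (euler t k (euler s k ?x) - euler (t + s) k ?x) \<le> t * s * norm z * (1/2) ^ k"
        by simp
      show "(\<lambda>k. t * s * norm z * (1/2) ^ k) \<longlonglongrightarrow> 0"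
        by (intro tendsto_mult_right_zero LIMSEQ_realpow_zero) auto
    qed
    have Bt: "(\<lambda>k. euler t k (euler s k ?x) - euler t k (T s ?x)) \<longlonglongrightarrow> 0"
    proof (rule Lim_null_comparison)
      show "\<forall>\<^sub>F k in sequentially. norm (euler t k (euler s k ?x) - euler t k (T s ?x)) \<le> norm (euler s k ?x - T s ?x)"
        using euler_contraction[OF t] euler_diff[OF t] euler_in[OF s x] T_in[OF s x] H_diff
        by (metis (no_types, lifting) eventually_sequentiallyI)
      show "(\<lambda>k. norm (euler s k ?x - T s ?x)) \<longlonglongrightarrow> 0"
        using euler_tendsto[OF s x] by (intro tendsto_norm_zero LIM_zero)
    qed
    have "(\<lambda>k. euler (t + s) k ?x) \<longlonglongrightarrow> T t (T s ?x)"
      using tendsto_diff[OF tendsto_add[OF Bt euler_tendsto[OF t T_in[OF s x]]] A] by simp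
    then show ?thesis using euler_tendsto[OF ts x] LIMSEQ_unique by blast
  qed
  have "norm (T (t + s) x - T t (T s x)) \<le> e" if e: "e > 0" for e
  proof -
    obtain z where z: "z \<in> H" "norm (x - B (B z)) < e / 2" using dense_range_B2[OF x, of "e/2"] e by auto
    let ?w = "B (B z)"
    have w: "?w \<in> H" using z by (simp add: H_intros)
    have "norm (T (t + s) x - T (t + s) ?w) \<le> norm (x - ?w)"
      using T_contraction[OF ts H_diff[OF x w]] T_diff[OF ts x w] by simp
    moreover have "norm (T t (T s x) - T t (T s ?w)) \<le> norm (x - ?w)"
      using T_contraction[OF t T_in[OF s H_diff[OF x w]]] T_contraction[OF s H_diff[OF x w]]
        T_diff[OF s x w] T_diff[OF t T_in[OF s x] T_in[OF s w]] by simp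
    moreover have "norm (T (t + s) x - T t (T s x)) \<le> norm (T (t + s) x - T (t + s) ?w) + norm (T t (T s x) - T t (T s ?w))"
      unfolding smooth[OF z(1)] by norm
    ultimately show ?thesis using z(2) by linarith
  qed
  then have "norm (T (t + s) x - T t (T s x)) \<le> 0" by (rule field_le_epsilon) simp
  then show ?thesis by simp
qed

section \<open>Identification of the generator\<close>

text \<open>The identity is itself a commuting contraction, so by telescoping \<open>n\<close>
  resolvent steps of size \<open>h\<close> move \<open>B z\<close> by at most
  \<open>n * h * norm z\<close>.\<close>

lemma T_B_minus_bound:
  assumes t: "t \<ge> 0" and z: "z \<in> H"
  shows "norm (T t (B z) - B z) \<le> t * norm z"
proof (rule LIMSEQ_le_const2[OF tendsto_norm[OF tendsto_diff[OF euler_tendsto[OF t B_in[OF z]] tendsto_const]]])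
  have "norm (euler t k (B z) - B z) \<le> t * norm z" for k
  proof -
    let ?h = "t / 2 ^ k"
    have h: "?h \<ge> 0" using t by simp
    have "norm ((J ?h ^^ 2 ^ k) (B z) - ((\<lambda>x. x) ^^ 2 ^ k) (B z)) \<le> real (2 ^ k) * norm (J ?h (B z) - B z)"
      by (rule telescope) (use h z in \<open>auto simp: J_in J_diff J_contraction H_intros\<close>)
    also have "norm (J ?h (B z) - B z) \<le> ?h * norm z"
      using J_B_minus[OF h z] mult_left_mono[OF J_contraction[OF h z] h] t by simp
    finally have "norm ((J ?h ^^ 2 ^ k) (B z) - ((\<lambda>x. x) ^^ 2 ^ k) (B z)) \<le> t * norm z" by simp
    moreover have "((\<lambda>x. x) ^^ n) y = y" for n and y :: 'a by (induction n) auto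
    ultimately show ?thesis by (simp add: euler_def)
  qed
  then show "\<exists>N. \<forall>n\<ge>N. norm (euler t n (B z) - B z) \<le> t * norm z" by blast
qed

text \<open>A Taylor expansion with remainder: \<open>T t\<close> differs from one implicit step by
  at most \<open>t\<^sup>2 * norm z / 2\<close>, and that step differs from its linearization by
  exactly \<open>t\<^sup>2 *\<^sub>R J t z\<close>. This accounts for the constant
  \<open>3 / 2\<close>.\<close>

lemma T_B2_expansion:
  assumes t: "t \<ge> 0" and z: "z \<in> H"
  shows "norm (T t (B (B z)) - B (B z) - t *\<^sub>R B z) \<le> 3 / 2 * t\<^sup>2 * norm z"
proof -
  let ?x = "B (B z)"
  have x: "?x \<in> H" using z by (simp add: H_intros)
  have "norm (T t ?x - J t ?x) \<le> t\<^sup>2 * norm z / 2"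
  proof (rule LIMSEQ_le_const2[OF tendsto_norm[OF tendsto_diff[OF euler_tendsto[OF t x] tendsto_const]]])
    have "norm (euler t k ?x - J t ?x) \<le> t\<^sup>2 * norm z / 2" for k
    proof -
      have "norm (euler t k ?x - J t ?x) \<le> t\<^sup>2 * norm z / 2 * (1 - (1/2) ^ k)"
        using euler_diff_bound[OF t z, of 0 k] by (simp add: euler_def)
      also have "\<dots> \<le> t\<^sup>2 * norm z / 2 * 1" by (intro mult_left_mono) auto
      finally show ?thesis by simp
    qed
    then show "\<exists>N. \<forall>n\<ge>N. norm (euler t n ?x - J t ?x) \<le> t\<^sup>2 * norm z / 2" by blast
  qed
  moreover have "norm (J t ?x - ?x - t *\<^sub>R B z) \<le> t\<^sup>2 * norm z"
  proof -
    have "J t ?x - ?x - t *\<^sub>R B z = (t * t) *\<^sub>R J t z"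
      using J_B_minus[OF t B_in[OF z]] J_B_minus[OF t z] by (simp add: scaleR_add_right)
    then show ?thesis using J_contraction[OF t z] t by (simp add: power2_eq_square mult_left_mono)
  qed
  moreover have "norm (T t ?x - ?x - t *\<^sub>R B z) \<le> norm (T t ?x - J t ?x) + norm (J t ?x - ?x - t *\<^sub>R B z)"
    using norm_triangle_ineq[of "T t ?x - J t ?x" "J t ?x - ?x - t *\<^sub>R B z"]
    by (metis add_diff_eq diff_add_cancel)
  ultimately show ?thesis by simp
qed

text \<open>The quadratic remainder settles \<open>z\<close> in the range of \<open>B\<close>. For
  general \<open>z\<close> the error \<open>z - B w\<close> enters through
  \<open>T_B_minus_bound\<close>, whose contribution stays bounded after division by
  \<open>h\<close>.\<close>

lemma T_generator:
  assumes z: "z \<in> H"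
  shows "((\<lambda>h. (1 / h) *\<^sub>R (T h (B z) - B z)) \<longlongrightarrow> z) (at_right 0)"
proof (rule tendstoI)
  fix e :: real assume e: "e > 0"
  obtain w where w: "w \<in> H" "norm (z - B w) < e / 4" using dense_range_B[OF z, of "e/4"] e by auto
  \<comment> \<open>With this \<open>d\<close> the quadratic remainder contributes at most
    \<open>3 / 8 * e\<close> after division by \<open>h\<close>, and the two approximation terms
    less than \<open>e / 4\<close> each.\<close>
  define d where "d = e / (4 * (norm w + 1))"
  have d: "d > 0" using e by (simp add: d_def add_nonneg_pos)
  have "dist ((1 / h) *\<^sub>R (T h (B z) - B z)) z < e" if h: "0 < h" "h < d" for h
  proof -
    let ?w = "B w"
    have wH: "?w \<in> H" using w by (simp add: H_intros)
    have h0: "h \<ge> 0" using h by simp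
    define u where "u = T h (B z) - B z - h *\<^sub>R z"
    have "T h (B (z - ?w)) - B (z - ?w) = (T h (B z) - B z) - (T h (B ?w) - B ?w)"
      using z wH h0 by (simp add: B_diff T_diff H_intros)
    then have "u = (T h (B (z - ?w)) - B (z - ?w)) + (T h (B ?w) - B ?w - h *\<^sub>R ?w) - h *\<^sub>R (z - ?w)"
      by (simp add: u_def algebra_simps)
    then have "norm u = norm ((T h (B (z - ?w)) - B (z - ?w)) + (T h (B ?w) - B ?w - h *\<^sub>R ?w) - h *\<^sub>R (z - ?w))"
      by (rule arg_cong)
    then have "norm u \<le> norm (T h (B (z - ?w)) - B (z - ?w)) + norm (T h (B ?w) - B ?w - h *\<^sub>R ?w) + norm (h *\<^sub>R (z - ?w))"
      using norm_triangle_ineq4[of "(T h (B (z - ?w)) - B (z - ?w)) + (T h (B ?w) - B ?w - h *\<^sub>R ?w)" "h *\<^sub>R (z - ?w)"]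
        norm_triangle_ineq[of "T h (B (z - ?w)) - B (z - ?w)" "T h (B ?w) - B ?w - h *\<^sub>R ?w"] by linarith
    also have "\<dots> \<le> h * norm (z - ?w) + 3 / 2 * h\<^sup>2 * norm w + h * norm (z - ?w)"
      using T_B_minus_bound[OF h0 H_diff[OF z wH]] T_B2_expansion[OF h0 w(1)] h by (intro add_mono) auto
    also have "\<dots> < h * (e / 4) + 3/2 * h\<^sup>2 * norm w + h * (e/4)"
      using w(2) h by (intro add_less_le_mono add_less_le_mono mult_strict_left_mono mult_left_mono) auto
    also have "3/2 * h\<^sup>2 * norm w = h * (3/2 * (h * norm w))" by (simp add: power2_eq_square)
    also have "\<dots> \<le> h * (3/2 * (e / 4))"
    proof -
      have "h * norm w \<le> d * (norm w + 1)" using h by (intro mult_mono) auto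
      also have "\<dots> = e / 4"
      proof -
        have "norm w + 1 \<noteq> 0" using norm_ge_zero[of w] by linarith
        then show ?thesis by (simp add: d_def field_simps)
      qed
      finally show ?thesis using h by (intro mult_left_mono) auto
    qed
    finally have "norm u < h * (e / 4) + h * (3/2 * (e / 4)) + h * (e / 4)" by simp
    also have "\<dots> = h * e * (7 / 8)" by (simp add: algebra_simps)
    also have "\<dots> \<le> h * e" using h e by (intro mult_left_le) auto
    finally have "norm u < h * e" .
    moreover have "(1 / h) *\<^sub>R (T h (B z) - B z) - z = (1 / h) *\<^sub>R u"
      using h by (simp add: u_def scaleR_diff_right)
    ultimately show ?thesis using h by (simp add: dist_norm field_simps)
  qed
  then show "\<forall>\<^sub>F h in at_right 0. dist ((1 / h) *\<^sub>R (T h (B z) - B z)) z < e"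
    unfolding eventually_at_right_field using d by (intro exI[of _ d]) auto
qed

lemma T_strongly_continuous:
  assumes x: "x \<in> H"
  shows "((\<lambda>h. T h x) \<longlongrightarrow> x) (at_right 0)"
proof (rule tendstoI)
  fix e :: real assume e: "e > 0"
  obtain w where w: "w \<in> H" "norm (x - B w) < e / 4" using dense_range_B[OF x, of "e/4"] e by auto
  define d where "d = e / (4 * (norm w + 1))"
  have d: "d > 0" using e by (simp add: d_def add_nonneg_pos)
  have "dist (T h x) x < e" if h: "0 < h" "h < d" for h
  proof -
    have h0: "h \<ge> 0" and wH: "B w \<in> H" using h w by (auto simp: H_intros)
    have "norm (T h x - T h (B w)) \<le> norm (x - B w)"
      using T_contraction[OF h0 H_diff[OF x wH]] T_diff[OF h0 x wH] by simp
    moreover have "norm (T h (B w) - B w) \<le> e / 4"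
    proof -
      have "norm (T h (B w) - B w) \<le> h * norm w" using T_B_minus_bound[OF h0 w(1)] .
      also have "\<dots> \<le> d * (norm w + 1)" using h by (intro mult_mono) auto
      also have "\<dots> = e / 4"
      proof -
        have "norm w + 1 \<noteq> 0" using norm_ge_zero[of w] by linarith
        then show ?thesis by (simp add: d_def field_simps)
      qed
      finally show ?thesis .
    qed
    moreover have "norm (T h x - x) \<le> norm (T h x - T h (B w)) + norm (T h (B w) - B w) + norm (x - B w)" by norm
    ultimately show ?thesis using w(2) e by (simp add: dist_norm)
  qed
  then show "\<forall>\<^sub>F h in at_right 0. dist (T h x) x < e"
    unfolding eventually_at_right_field using d by (intro exI[of _ d]) auto
qed

text \<open>The generator of a contraction semigroup is dissipative, so it cannot properly extend
  the operator \<open>A\<close>, for which \<open>1 - A\<close> is already onto.\<close>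

lemma generator_domain:
  assumes y: "y \<in> H" and z: "z \<in> H" and lim: "((\<lambda>h. (1 / h) *\<^sub>R (T h y - y)) \<longlongrightarrow> z) (at_right 0)"
  shows "\<exists>w\<in>H. y = B w"
proof -
  \<comment> \<open>\<open>g\<close> solves \<open>(1 - A) (B g) = y - z\<close>, and
    \<open>z\<close> is the derivative of the orbit at \<open>y\<close>. The discrepancy
    \<open>e = B g - y\<close> therefore has the derivative \<open>e\<close> at time
    \<open>0\<close>, which a contraction semigroup forbids unless \<open>e = 0\<close>.\<close>
  define g where "g = AR 1 (y - z)"
  have g: "g \<in> H" "B g - g = y - z" using AR[of 1 "y - z"] y z by (auto simp: g_def H_intros)
  define e where "e = B g - y"
  have e: "e \<in> H" "e = g - z" using g y by (auto simp: e_def H_intros algebra_simps)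
  have "((\<lambda>h. (1 / h) *\<^sub>R (T h (B g) - B g) - (1 / h) *\<^sub>R (T h y - y)) \<longlongrightarrow> g - z) (at_right 0)"
    by (intro tendsto_diff T_generator g lim)
  moreover have "\<forall>\<^sub>F h in at_right 0. (1 / h) *\<^sub>R (T h (B g) - B g) - (1 / h) *\<^sub>R (T h y - y) = (1 / h) *\<^sub>R (T h e - e)"
    using eventually_at_right_less[of "0::real"]
  proof eventually_elim
    case (elim h)
    then have "T h e = T h (B g) - T h y" using g y by (simp add: e_def T_diff H_intros)
    then show ?case unfolding e_def by (simp add: scaleR_diff_right)
  qed
  ultimately have "((\<lambda>h. (1 / h) *\<^sub>R (T h e - e)) \<longlongrightarrow> e) (at_right 0)"
    unfolding e(2)[symmetric] by (rule Lim_transform_eventually)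
  then have "((\<lambda>h. (1 / h) *\<^sub>R (T h e - e) \<bullet> e) \<longlongrightarrow> e \<bullet> e) (at_right 0)"
    by (intro tendsto_intros)
  moreover have "\<forall>\<^sub>F h in at_right 0. (1 / h) *\<^sub>R (T h e - e) \<bullet> e \<le> 0"
    using eventually_at_right_less[of "0::real"]
  proof eventually_elim
    case (elim h)
    have "T h e \<bullet> e \<le> norm (T h e) * norm e" by (rule norm_cauchy_schwarz)
    also have "\<dots> \<le> norm e * norm e" using T_contraction[of h e] elim e by (intro mult_right_mono) auto
    also have "\<dots> = e \<bullet> e" by (simp add: norm_eq_sqrt_inner)
    finally show ?case using elim by (simp add: inner_diff_left mult_le_0_iff divide_le_0_iff)
  qed
  ultimately have "e \<bullet> e \<le> 0"
    using tendsto_upperbound trivial_limit_at_right_real by blast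
  then have "e = 0" by (metis antisym inner_eq_zero_iff inner_ge_zero)
  then have "y = B g" by (simp add: e_def)
  then show ?thesis using g by blast
qed

section \<open>The limit seminorm along orbits and strong stability\<close>

lemma T_antimono:
  assumes "x \<in> H" "0 \<le> s" "s \<le> t"
  shows "norm (T t x) \<le> norm (T s x)"
  using T_semigroup[of "t - s" s x] T_contraction[of "t - s" "T s x"] T_in[of s x] assms by simp

text \<open>On \<open>H\<close> the norms decrease along orbits, so the infimum is their limit as
  time tends to infinity. In the infimum form the bound \<open>p x \<le> norm (T t x)\<close> is
  immediate.\<close>

definition p :: "'a \<Rightarrow> real" where
  "p x = (INF t\<in>{0..}. norm (T t x))"

lemma p_le: "t \<ge> 0 \<Longrightarrow> p x \<le> norm (T t x)"
  unfolding p_def by (intro cINF_lower bdd_belowI[of _ 0]) auto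

lemma p_tendsto:
  assumes x: "x \<in> H"
  shows "((\<lambda>t. norm (T t x)) \<longlongrightarrow> p x) at_top"
proof (rule decreasing_tendsto)
  show "\<forall>\<^sub>F t in at_top. p x \<le> norm (T t x)"
    using eventually_ge_at_top[of "0::real"] by eventually_elim (rule p_le)
  fix c assume c: "p x < c"
  have ne: "{0::real..} \<noteq> {}" by auto
  have bdd: "bdd_below ((\<lambda>t. norm (T t x)) ` {0..})" by (rule bdd_belowI[of _ 0]) auto
  obtain s where s: "s \<ge> 0" "norm (T s x) < c"
    using c cINF_less_iff[OF ne bdd] unfolding p_def by auto
  show "\<forall>\<^sub>F t in at_top. norm (T t x) < c"
    using eventually_ge_at_top[of s]
  proof eventually_elim
    case (elim t)
    then show ?case using T_antimono[OF x s(1) elim] s(2) by linarith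
  qed
qed

lemma p_nonneg: "p x \<ge> 0"
  unfolding p_def by (rule cINF_greatest) auto

lemma p_le_norm: "p x \<le> norm x"
  using p_le[of 0 x] by (simp add: T_zero)

lemma p_T:
  assumes x: "x \<in> H" and h: "h \<ge> 0"
  shows "p (T h x) = p x"
proof (rule tendsto_unique[OF _ p_tendsto[OF T_in[OF h x]]])
  have "((\<lambda>t. norm (T (t + h) x)) \<longlongrightarrow> p x) at_top"
    using filterlim_compose[OF p_tendsto[OF x] filterlim_tendsto_add_at_top[OF tendsto_const[of h] filterlim_ident]]
    by (simp add: add.commute)
  then show "((\<lambda>t. norm (T t (T h x))) \<longlongrightarrow> p x) at_top"
  proof (rule Lim_transform_eventually)
    show "\<forall>\<^sub>F t in at_top. norm (T (t + h) x) = norm (T t (T h x))"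
      using eventually_ge_at_top[of "0::real"] by eventually_elim (simp add: T_semigroup h x)
  qed
qed simp

lemma p_scale:
  assumes x: "x \<in> H"
  shows "p (c *\<^sub>R x) = \<bar>c\<bar> * p x"
proof (rule tendsto_unique[OF _ p_tendsto[OF H_scale[OF x]]])
  have "((\<lambda>t. \<bar>c\<bar> * norm (T t x)) \<longlongrightarrow> \<bar>c\<bar> * p x) at_top"
    by (intro tendsto_intros p_tendsto x)
  then show "((\<lambda>t. norm (T t (c *\<^sub>R x))) \<longlongrightarrow> \<bar>c\<bar> * p x) at_top"
  proof (rule Lim_transform_eventually)
    show "\<forall>\<^sub>F t in at_top. \<bar>c\<bar> * norm (T t x) = norm (T t (c *\<^sub>R x))"
      using eventually_ge_at_top[of "0::real"] by eventually_elim (simp add: T_scale x)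
  qed
qed simp

lemma p_B:
  assumes x: "x \<in> H"
  shows "p (B x) \<le> \<bar>C\<bar> * p x"
proof (rule tendsto_le[OF _ _ p_tendsto[OF B_in[OF x]]])
  show "((\<lambda>t. \<bar>C\<bar> * norm (T t x)) \<longlongrightarrow> \<bar>C\<bar> * p x) at_top"
    by (intro tendsto_intros p_tendsto x)
  show "\<forall>\<^sub>F t in at_top. norm (T t (B x)) \<le> \<bar>C\<bar> * norm (T t x)"
    using eventually_ge_at_top[of "0::real"]
    by eventually_elim (simp add: T_B x C_nonneg_bound T_in)
qed simp

text \<open>The semi-inner product \<open>br x y = lim (T t x \<bullet> T t y)\<close>, whose seminorm is \<open>p\<close>.\<close>

definition br :: "'a \<Rightarrow> 'a \<Rightarrow> real" where
  "br x y = ((p (x + y))\<^sup>2 - (p (x - y))\<^sup>2) / 4"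

lemma br_tendsto:
  assumes x: "x \<in> H" and y: "y \<in> H"
  shows "((\<lambda>t. T t x \<bullet> T t y) \<longlongrightarrow> br x y) at_top"
proof -
  have "((\<lambda>t. ((norm (T t (x + y)))\<^sup>2 - (norm (T t (x - y)))\<^sup>2) / 4) \<longlongrightarrow> br x y) at_top"
    unfolding br_def by (intro tendsto_intros p_tendsto H_intros x y) auto
  then show ?thesis
  proof (rule Lim_transform_eventually)
    show "\<forall>\<^sub>F t in at_top. ((norm (T t (x + y)))\<^sup>2 - (norm (T t (x - y)))\<^sup>2) / 4 = T t x \<bullet> T t y"
      using eventually_ge_at_top[of "0::real"]
    proof eventually_elim
      case (elim t)
      then show ?case
        by (simp add: T_add T_diff x y power2_norm_eq_inner inner_add_left inner_add_right
            inner_diff_left inner_diff_right inner_commute)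
    qed
  qed
qed

text \<open>Algebraic laws of \<open>br\<close> are inherited from the inner product by uniqueness
  of limits instead of being derived from the polarization formula.\<close>

lemma br_unique:
  assumes "x \<in> H" "y \<in> H" "\<And>t. t \<ge> 0 \<Longrightarrow> T t x \<bullet> T t y = f t" "(f \<longlongrightarrow> c) at_top"
  shows "br x y = c"
proof (rule tendsto_unique[OF _ br_tendsto[OF assms(1,2)]])
  show "((\<lambda>t. T t x \<bullet> T t y) \<longlongrightarrow> c) at_top"
    using assms(4)
  proof (rule Lim_transform_eventually)
    show "\<forall>\<^sub>F t in at_top. f t = T t x \<bullet> T t y"
      using eventually_ge_at_top[of "0::real"] by eventually_elim (simp add: assms(3))
  qed
qed simp

lemma br_self: "x \<in> H \<Longrightarrow> br x x = (p x)\<^sup>2"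
  by (rule br_unique[where f = "\<lambda>t. (norm (T t x))\<^sup>2"])
     (auto simp: power2_norm_eq_inner[symmetric] intro!: tendsto_power p_tendsto)

lemma br_commute: "x \<in> H \<Longrightarrow> y \<in> H \<Longrightarrow> br x y = br y x"
  by (rule br_unique[OF _ _ inner_commute br_tendsto])

lemma br_diff_left: "x \<in> H \<Longrightarrow> y \<in> H \<Longrightarrow> z \<in> H \<Longrightarrow> br (x - y) z = br x z - br y z"
  by (rule br_unique[where f = "\<lambda>t. T t x \<bullet> T t z - T t y \<bullet> T t z"])
     (auto simp: T_diff inner_diff_left H_intros intro!: br_tendsto tendsto_intros)

lemma br_scale_left: "x \<in> H \<Longrightarrow> z \<in> H \<Longrightarrow> br (c *\<^sub>R x) z = c * br x z"
  by (rule br_unique[where f = "\<lambda>t. c * (T t x \<bullet> T t z)"])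
     (auto simp: T_scale H_intros intro!: br_tendsto tendsto_intros)

lemma br_bound:
  assumes "x \<in> H" "y \<in> H"
  shows "\<bar>br x y\<bar> \<le> norm x * norm y"
proof (rule tendsto_upperbound[OF tendsto_rabs[OF br_tendsto[OF assms]]])
  show "\<forall>\<^sub>F t in at_top. \<bar>T t x \<bullet> T t y\<bar> \<le> norm x * norm y"
    using eventually_ge_at_top[of "0::real"]
  proof eventually_elim
    case (elim t)
    have "\<bar>T t x \<bullet> T t y\<bar> \<le> norm (T t x) * norm (T t y)" by (rule Cauchy_Schwarz_ineq2)
    also have "\<dots> \<le> norm x * norm y" using elim assms by (intro mult_mono T_contraction) auto
    finally show ?case .
  qed
qed simp

lemma br_tendsto_args:
  assumes "(f \<longlongrightarrow> x) F" "(g \<longlongrightarrow> y) F" "\<forall>\<^sub>F i in F. f i \<in> H \<and> g i \<in> H" "x \<in> H" "y \<in> H"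
  shows "((\<lambda>i. br (f i) (g i)) \<longlongrightarrow> br x y) F"
proof (rule LIM_zero_cancel, rule Lim_null_comparison)
  show "\<forall>\<^sub>F i in F. norm (br (f i) (g i) - br x y) \<le> norm (f i - x) * norm (g i) + norm x * norm (g i - y)"
    using assms(3)
  proof eventually_elim
    case (elim i)
    have "br (f i) (g i) - br x y = br (f i - x) (g i) + br (g i - y) x"
      using elim assms(4,5) br_commute[of "g i" x] br_commute[of y x] by (simp add: br_diff_left)
    then show ?case
      using br_bound[of "f i - x" "g i"] br_bound[of "g i - y" x] elim assms(4,5)
      by (simp add: H_intros mult.commute)
  qed
  have "((\<lambda>i. norm (f i - x) * norm (g i) + norm x * norm (g i - y)) \<longlongrightarrow> norm (x - x) * norm y + norm x * norm (y - y)) F"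
    by (intro tendsto_intros assms)
  then show "((\<lambda>i. norm (f i - x) * norm (g i) + norm x * norm (g i - y)) \<longlongrightarrow> 0) F" by simp
qed

lemma br_T:
  assumes "x \<in> H" "y \<in> H" "h \<ge> 0"
  shows "br (T h x) (T h y) = br x y"
  using p_T[of "x + y" h] p_T[of "x - y" h] assms by (simp add: br_def T_add[symmetric] T_diff[symmetric] H_intros)

text \<open>The isometry \<open>br (T h (B x)) (T h (B y)) = br (B x) (B y)\<close> is
  differentiated at \<open>h = 0\<close>, where the orbits through \<open>B x\<close> and
  \<open>B y\<close> have the derivatives \<open>x\<close> and \<open>y\<close>. The two difference
  quotients are paired with \<open>T h (B y)\<close> and \<open>B x\<close> so that their sum
  vanishes exactly for each \<open>h > 0\<close>.\<close>

lemma br_B_skew: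
  assumes x: "x \<in> H" and y: "y \<in> H"
  shows "br x (B y) = - br (B x) y"
proof -
  let ?d = "\<lambda>h x. (1 / h) *\<^sub>R (T h (B x) - B x)"
  have pos: "\<forall>\<^sub>F h in at_right 0. (0::real) < h" by (rule eventually_at_right_less)
  have 1: "((\<lambda>h. br (?d h x) (T h (B y))) \<longlongrightarrow> br x (B y)) (at_right 0)"
    using pos x y by (intro br_tendsto_args T_generator T_strongly_continuous H_intros)
      (auto elim!: eventually_mono intro!: H_intros T_in)
  have 2: "((\<lambda>h. br (?d h y) (B x)) \<longlongrightarrow> br y (B x)) (at_right 0)"
    using pos x y by (intro br_tendsto_args T_generator tendsto_const H_intros)
      (auto elim!: eventually_mono intro!: H_intros T_in)
  have "\<forall>\<^sub>F h in at_right 0. br (?d h x) (T h (B y)) + br (?d h y) (B x) = 0"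
    using pos
  proof eventually_elim
    case (elim h)
    note m = H_intros T_in x y
    have "br (T h (B y) - B y) (B x) = br (B x) (T h (B y)) - br (B x) (B y)"
      using elim m br_commute[of "T h (B y)" "B x"] br_commute[of "B y" "B x"] by (simp add: br_diff_left)
    moreover have "br (T h (B x) - B x) (T h (B y)) = br (B x) (B y) - br (B x) (T h (B y))"
      using elim m br_T[of "B x" "B y" h] by (simp add: br_diff_left)
    ultimately show ?case using elim m by (simp add: br_scale_left diff_divide_distrib)
  qed
  from Lim_transform_eventually[OF tendsto_add[OF 1 2] this]
  have "br x (B y) + br y (B x) = 0"
    using tendsto_unique[OF trivial_limit_at_right_real _ tendsto_const] by blast
  then show ?thesis using br_commute[of y "B x"] x y by (simp add: H_intros)
qed

text \<open>Skewness gives \<open>br (B (B x)) x = - (p (B x))\<^sup>2\<close>, so expanding the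
  square leaves \<open>(p (B (B x)))\<^sup>2 - 2 M\<^sup>2 (p (B x))\<^sup>2 + M^4 (p
  x)\<^sup>2\<close>. A near maximizer of \<open>p (B x)\<close> over the unit ball of
  \<open>p\<close> is thus nearly an eigenvector of \<open>B\<^sup>2\<close>.\<close>

lemma p_defect:
  assumes x: "x \<in> H" and M: "M \<ge> 0" "\<And>y. y \<in> H \<Longrightarrow> p (B y) \<le> M * p y"
  shows "(p (B (B x) + M\<^sup>2 *\<^sub>R x))\<^sup>2 \<le> M\<^sup>2 * (M\<^sup>2 * (p x)\<^sup>2 - (p (B x))\<^sup>2)"
proof -
  let ?a = "B (B x)" and ?b = "(- (M\<^sup>2)) *\<^sub>R x"
  have m: "?a \<in> H" "?b \<in> H" using x B_in H_scale by blast+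
  have ax: "br ?a x = - (p (B x))\<^sup>2"
    using br_B_skew[OF B_in[OF x] x] br_self[OF B_in[OF x]] by simp
  have bx: "br ?b x = - (M\<^sup>2) * (p x)\<^sup>2"
    using br_scale_left[OF x x, of "- (M\<^sup>2)"] br_self[OF x] by simp
  have "(p (?a - ?b))\<^sup>2 = br ?a (?a - ?b) - br ?b (?a - ?b)"
    using m br_self[of "?a - ?b"] by (simp only: br_diff_left H_diff)
  also have "br ?a (?a - ?b) = br ?a ?a - br ?b ?a"
    using m br_commute[of ?a "?a - ?b"] by (simp only: br_diff_left H_diff)
  also have "br ?b (?a - ?b) = br ?b ?a - br ?b ?b"
    using m br_commute[of ?b "?a - ?b"] br_commute[of ?a ?b] by (simp only: br_diff_left H_diff)
  also have "br ?b ?a = M\<^sup>2 * (p (B x))\<^sup>2"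
    by (simp only: br_scale_left[OF x m(1)] br_commute[OF x m(1)] ax minus_mult_minus)
  also have "br ?b ?b = M\<^sup>2 * M\<^sup>2 * (p x)\<^sup>2"
    using br_scale_left[OF x m(2), of "- (M\<^sup>2)"] unfolding br_commute[OF x m(2)] bx by simp
  also have "br ?a ?a = (p ?a)\<^sup>2" using br_self m by blast
  finally have "(p (?a - ?b))\<^sup>2 = (p ?a)\<^sup>2 - 2 * M\<^sup>2 * (p (B x))\<^sup>2 + M\<^sup>2 * M\<^sup>2 * (p x)\<^sup>2"
    by simp
  moreover have "(p ?a)\<^sup>2 \<le> (M * p (B x))\<^sup>2"
    using M(2)[OF B_in[OF x]] p_nonneg by (intro power_mono) auto
  ultimately show ?thesis by (simp add: power_mult_distrib algebra_simps)
qed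

text \<open>If some orbit does not decay, then \<open>B\<close> is a nonzero skew operator for the semi-inner product
  \<open>br\<close>, and compactness turns a maximizing sequence of its \<open>p\<close>-norm into an eigenvector of \<open>B\<^sup>2\<close>;
  passing to late times along the orbits makes \<open>p\<close> and the norm comparable.\<close>

theorem T_strongly_stable:
  assumes compact: "\<And>x :: nat \<Rightarrow> 'a. range x \<subseteq> H \<Longrightarrow> bounded (range x) \<Longrightarrow>
      \<exists>r l. strict_mono (r :: nat \<Rightarrow> nat) \<and> (\<lambda>n. B (x (r n))) \<longlonglongrightarrow> l"
    and no_imaginary: "\<And>w M. w \<in> H \<Longrightarrow> M > 0 \<Longrightarrow> B (B w) = - M *\<^sub>R w \<Longrightarrow> w = 0"
    and x: "x \<in> H"
  shows "((\<lambda>t. norm (T t x)) \<longlongrightarrow> 0) at_top"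
proof (rule ccontr)
  assume "\<not> ?thesis"
  then have px: "p x > 0" using p_tendsto[OF x] p_nonneg[of x] by (metis less_eq_real_def)
  define U where "U = {y \<in> H. p y \<le> 1}"
  define M where "M = (SUP y\<in>U. p (B y))"
  have bdd: "bdd_above ((\<lambda>y. p (B y)) ` U)"
  proof (rule bdd_aboveI2[where M = "\<bar>C\<bar>"])
    fix y assume "y \<in> U"
    then have "p (B y) \<le> \<bar>C\<bar> * p y" "\<bar>C\<bar> * p y \<le> \<bar>C\<bar> * 1" using p_B[of y] by (auto simp: U_def mult_left_le)
    then show "p (B y) \<le> \<bar>C\<bar>" by simp
  qed
  have "0 \<in> U" using p_le_norm[of 0] p_nonneg[of 0] H_zero by (simp add: U_def)
  then have Une: "U \<noteq> {}" by auto
  have upper: "p (B y) \<le> M" if "y \<in> U" for y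
    unfolding M_def using that bdd by (intro cSUP_upper)
  have M0: "M \<ge> 0" using upper[OF \<open>0 \<in> U\<close>] p_nonneg[of "B 0"] by linarith
  have le: "p (B y) \<le> M * p y" if y: "y \<in> H" for y
  proof (cases "p y = 0")
    case True
    then show ?thesis using p_B[OF y] p_nonneg[of "B y"] by simp
  next
    case False
    then have py: "p y > 0" using p_nonneg[of y] by simp
    have "(1 / p y) *\<^sub>R y \<in> U" using y py by (simp add: U_def p_scale H_scale)
    from upper[OF this] show ?thesis using y py by (simp add: B_scale p_scale H_intros field_simps)
  qed
  \<comment> \<open>If \<open>M\<close> were \<open>0\<close>, \<open>p\<close> would vanish on the
    range of \<open>B\<close>, which is dense, while \<open>p\<close> is subadditive and bounded by
    the norm; this contradicts \<open>p x > 0\<close>.\<close>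
  have "M > 0"
  proof (rule ccontr)
    assume "\<not> M > 0"
    then have z: "p (B y) = 0" if "y \<in> H" for y using le[OF that] M0 p_nonneg[of "B y"] by simp
    obtain y where y: "y \<in> H" "norm (x - B y) < p x" using dense_range_B[OF x px] by auto
    have "((\<lambda>t. norm (T t (x - B y)) + norm (T t (B y))) \<longlongrightarrow> p (x - B y) + p (B y)) at_top"
      using x y by (intro tendsto_intros p_tendsto H_intros)
    then have "p x \<le> p (x - B y) + p (B y)"
    proof (rule tendsto_le[OF _ _ p_tendsto[OF x], rotated])
      show "\<forall>\<^sub>F t in at_top. norm (T t x) \<le> norm (T t (x - B y)) + norm (T t (B y))"
        using eventually_ge_at_top[of "0::real"]
      proof eventually_elim
        case (elim t)
        then have "T t x = T t (x - B y) + T t (B y)" using x y by (simp add: T_diff H_intros)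
        then show ?case by (metis norm_triangle_ineq)
      qed
    qed simp
    then show False using z[OF y(1)] p_le_norm[of "x - B y"] y(2) by linarith
  qed
  \<comment> \<open>The small defect is first known in \<open>p\<close>. Moving \<open>y\<close> to
    a late time brings the norms close to \<open>p\<close>, and \<open>T\<close> commutes with
    \<open>B\<close>; the lower bound survives because \<open>p\<close> never exceeds the norm along
    the orbit. Any number above \<open>1\<close> could replace \<open>2\<close>, as
    \<open>p y \<le> 1\<close>.\<close>
  have "\<exists>y. y \<in> H \<and> norm y \<le> 2 \<and> norm (B (B y) + M\<^sup>2 *\<^sub>R y) \<le> sqrt (2 * M ^ 3 * e) + e
      \<and> norm (B y) \<ge> M - e" if e: "e > 0" for e :: real
  proof -
    obtain y where y: "y \<in> U" "p (B y) > M - e"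
      using less_cSUP_iff[OF Une bdd, of "M - e"] e unfolding M_def by auto
    have yH: "y \<in> H" and py: "p y \<le> 1" using y by (auto simp: U_def)
    let ?d = "B (B y) + M\<^sup>2 *\<^sub>R y"
    have dH: "?d \<in> H" using yH by (intro H_intros)
    have "(p ?d)\<^sup>2 \<le> M\<^sup>2 * (M\<^sup>2 * (p y)\<^sup>2 - (p (B y))\<^sup>2)" using p_defect[OF yH M0 le] .
    also have "\<dots> \<le> M\<^sup>2 * (2 * M * e)"
    proof (intro mult_left_mono)
      have "(p y)\<^sup>2 \<le> 1" using py p_nonneg[of y] by (simp add: power_le_one)
      then have "M\<^sup>2 * (p y)\<^sup>2 \<le> M\<^sup>2" by (simp add: mult_left_le)
      moreover have "M\<^sup>2 - (p (B y))\<^sup>2 \<le> 2 * M * e"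
      proof -
        have "M\<^sup>2 - (p (B y))\<^sup>2 = (M - p (B y)) * (M + p (B y))" by (simp add: power2_eq_square algebra_simps)
        also have "\<dots> \<le> e * (2 * M)"
          using y upper[OF y(1)] M0 p_nonneg[of "B y"] e by (intro mult_mono) auto
        finally show ?thesis by (simp add: mult_ac)
      qed
      ultimately show "M\<^sup>2 * (p y)\<^sup>2 - (p (B y))\<^sup>2 \<le> 2 * M * e" by linarith
    qed simp
    also have "\<dots> = 2 * M ^ 3 * e" by (simp add: power2_eq_square power3_eq_cube)
    finally have pd: "p ?d \<le> sqrt (2 * M ^ 3 * e)" by (simp add: real_le_rsqrt)
    have "\<forall>\<^sub>F t in at_top. norm (T t y) < 2 \<and> norm (T t ?d) < sqrt (2 * M ^ 3 * e) + e \<and> 0 \<le> t"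
      using order_tendstoD(2)[OF p_tendsto[OF yH], of 2] py pd e
        order_tendstoD(2)[OF p_tendsto[OF dH], of "sqrt (2 * M ^ 3 * e) + e"]
      by (intro eventually_conj eventually_ge_at_top) auto
    then obtain t where t: "norm (T t y) < 2" "norm (T t ?d) < sqrt (2 * M ^ 3 * e) + e" "0 \<le> t"
      using eventually_happens'[OF trivial_limit_at_top_linorder] by blast
    have "T t ?d = B (B (T t y)) + M\<^sup>2 *\<^sub>R T t y"
      using t yH by (simp add: T_add T_scale T_B H_intros)
    moreover have "norm (B (T t y)) \<ge> M - e"
      using p_le[OF t(3), of "B y"] y(2) t yH by (simp add: T_B)
    ultimately show ?thesis using t T_in[OF t(3) yH] by (intro exI[of _ "T t y"]) auto
  qed
  then have "\<forall>n. \<exists>y. y \<in> H \<and> norm y \<le> 2 \<and>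
      norm (B (B y) + M\<^sup>2 *\<^sub>R y) \<le> sqrt (2 * M ^ 3 * inverse (real (Suc n))) + inverse (real (Suc n))
      \<and> norm (B y) \<ge> M - inverse (real (Suc n))"
    by simp
  then obtain y where y: "\<And>n. y n \<in> H" "\<And>n. norm (y n) \<le> 2"
      "\<And>n. norm (B (B (y n)) + M\<^sup>2 *\<^sub>R y n) \<le> sqrt (2 * M ^ 3 * inverse (real (Suc n))) + inverse (real (Suc n))"
      "\<And>n. norm (B (y n)) \<ge> M - inverse (real (Suc n))"
    by metis
  have "range y \<subseteq> H" "bounded (range y)" using y(1,2) by (auto simp: bounded_iff)
  from compact[OF this] obtain r w where r: "strict_mono (r :: nat \<Rightarrow> nat)" and w: "(\<lambda>n. B (y (r n))) \<longlonglongrightarrow> w"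
    by blast
  have inv: "(\<lambda>n. inverse (real (Suc (r n)))) \<longlonglongrightarrow> 0"
    using LIMSEQ_subseq_LIMSEQ[OF LIMSEQ_inverse_real_of_nat r] by (simp add: o_def)
  have wH: "w \<in> H" using closed_sequentially[OF closed_H B_in[OF y(1)] w] .
  have "(\<lambda>n. B (B (y (r n))) + M\<^sup>2 *\<^sub>R y (r n)) \<longlonglongrightarrow> 0"
  proof (rule Lim_null_comparison)
    show "\<forall>\<^sub>F n in sequentially. norm (B (B (y (r n))) + M\<^sup>2 *\<^sub>R y (r n)) \<le> sqrt (2 * M ^ 3 * inverse (real (Suc (r n)))) + inverse (real (Suc (r n)))"
      using y(3) by simp
    have "(\<lambda>n. sqrt (2 * M ^ 3 * inverse (real (Suc (r n)))) + inverse (real (Suc (r n)))) \<longlonglongrightarrow> sqrt (2 * M ^ 3 * 0) + 0"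
      by (intro tendsto_intros inv)
    then show "(\<lambda>n. sqrt (2 * M ^ 3 * inverse (real (Suc (r n)))) + inverse (real (Suc (r n)))) \<longlonglongrightarrow> 0" by simp
  qed
  \<comment> \<open>Compactness yields convergence of \<open>B (y (r n))\<close>, not of
    \<open>y (r n)\<close>. One more application of \<open>B\<close> expresses the defect through
    the convergent sequence.\<close>
  then have "(\<lambda>n. B (B (B (y (r n))) + M\<^sup>2 *\<^sub>R y (r n))) \<longlonglongrightarrow> B 0"
    using y(1) by (intro B_tendsto H_intros) auto
  moreover have "B (B (B (y (r n))) + M\<^sup>2 *\<^sub>R y (r n)) = B (B (B (y (r n)))) + M\<^sup>2 *\<^sub>R B (y (r n))" for n
    using y(1) by (simp add: B_add B_scale H_intros)
  moreover have "(\<lambda>n. B (B (B (y (r n)))) + M\<^sup>2 *\<^sub>R B (y (r n))) \<longlonglongrightarrow> B (B w) + M\<^sup>2 *\<^sub>R w"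
    using w y(1) wH by (intro tendsto_intros B_tendsto H_intros) auto
  ultimately have "B (B w) + M\<^sup>2 *\<^sub>R w = 0" using LIMSEQ_unique B_zero by simp
  then have "B (B w) = - (M\<^sup>2) *\<^sub>R w" by (simp add: eq_neg_iff_add_eq_0)
  then have "w = 0" using no_imaginary[OF wH, of "M\<^sup>2"] \<open>M > 0\<close> by simp
  \<comment> \<open>The lower bound for \<open>norm (B (y n))\<close> passes to the limit and
    excludes the zero vector.\<close>
  moreover have "M - 0 \<le> norm w"
    using y(4) by (intro LIMSEQ_le[OF tendsto_diff[OF tendsto_const inv] tendsto_norm[OF w]]) auto
  ultimately show False using \<open>M > 0\<close> by simp
qed

end

subsection \<open>Square integrable functions on the line\<close>

text \<open>Functions live on the whole line, so that components on \<open>(0, l1)\<close> and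
  \<open>(0, l2)\<close> share one Hilbert space type; functions on an interval will be cut off by
  its indicator.\<close>

definition sqint :: "(real \<Rightarrow> complex) \<Rightarrow> bool" where
  "sqint f \<longleftrightarrow> f \<in> borel_measurable lebesgue \<and> integrable lebesgue (\<lambda>x. (cmod (f x))\<^sup>2)"

lemma borel_measurable_lebesgue_cong_AE:
  fixes f g :: "'a::euclidean_space \<Rightarrow> 'b::topological_space"
  assumes f: "f \<in> borel_measurable lebesgue" and AE: "AE x in lebesgue. f x = g x"
  shows "g \<in> borel_measurable lebesgue"
proof (rule measurableI)
  fix S :: "'b set" assume S: "S \<in> sets borel"
  have "AE x in lebesgue. (x \<in> f -` S \<inter> space lebesgue) \<longleftrightarrow> (x \<in> g -` S \<inter> space lebesgue)"
    using AE by eventually_elim simp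
  moreover have "f -` S \<inter> space lebesgue \<in> sets lebesgue" by (rule measurable_sets[OF f S])
  ultimately show "g -` S \<inter> space lebesgue \<in> sets lebesgue"
    using completion.in_sets_AE by blast
qed simp

lemma sqint_zero: "sqint (\<lambda>x. 0)"
  by (simp add: sqint_def)

text \<open>Two majorants cover sums directly; with \<open>0\<close> as the second one, the same
  estimate covers cut-offs and modifications on null sets.\<close>

lemma sqint_dominated:
  assumes "f \<in> borel_measurable lebesgue" "sqint g" "sqint h"
    "AE x in lebesgue. cmod (f x) \<le> cmod (g x) + cmod (h x)"
  shows "sqint f"
  unfolding sqint_def
proof
  show "integrable lebesgue (\<lambda>x. (cmod (f x))\<^sup>2)"
  proof (rule Bochner_Integration.integrable_bound)
    show "integrable lebesgue (\<lambda>x. 2 * (cmod (g x))\<^sup>2 + 2 * (cmod (h x))\<^sup>2)"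
      using assms by (auto simp: sqint_def)
    show "AE x in lebesgue. norm ((cmod (f x))\<^sup>2) \<le> norm (2 * (cmod (g x))\<^sup>2 + 2 * (cmod (h x))\<^sup>2)"
      using assms(4)
    proof eventually_elim
      case (elim x)
      have "(cmod (f x))\<^sup>2 \<le> (cmod (g x) + cmod (h x))\<^sup>2" using elim by (intro power_mono) auto
      also have "\<dots> \<le> 2 * (cmod (g x))\<^sup>2 + 2 * (cmod (h x))\<^sup>2"
        using sum_squares_bound[of "cmod (g x)" "cmod (h x)"] by (simp add: power2_sum)
      finally show ?case by simp
    qed
  qed (use assms in auto)
qed (fact assms)

lemma sqint_add: "sqint f \<Longrightarrow> sqint g \<Longrightarrow> sqint (\<lambda>x. f x + g x)"
  by (rule sqint_dominated[of _ f g]) (auto simp: sqint_def norm_triangle_ineq)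

lemma sqint_cmul: "sqint f \<Longrightarrow> sqint (\<lambda>x. c * f x)"
  by (auto simp: sqint_def norm_mult power_mult_distrib)

lemma sqint_diff: "sqint f \<Longrightarrow> sqint g \<Longrightarrow> sqint (\<lambda>x. f x - g x)"
  using sqint_add[of f "\<lambda>x. - 1 * g x"] sqint_cmul[of g "-1"] by simp

lemma sqint_mult_integrable:
  assumes "sqint f" "sqint g"
  shows "integrable lebesgue (\<lambda>x. f x * cnj (g x))"
proof (rule Bochner_Integration.integrable_bound)
  show "integrable lebesgue (\<lambda>x. (cmod (f x))\<^sup>2 + (cmod (g x))\<^sup>2)"
    using assms by (auto simp: sqint_def)
  have "cmod (f x) * cmod (g x) \<le> (cmod (f x))\<^sup>2 + (cmod (g x))\<^sup>2" for x
    using sum_squares_bound[of "cmod (f x)" "cmod (g x)"]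
      mult_nonneg_nonneg[OF norm_ge_zero norm_ge_zero, of "f x" "g x"] by linarith
  then show "AE x in lebesgue. norm (f x * cnj (g x)) \<le> norm ((cmod (f x))\<^sup>2 + (cmod (g x))\<^sup>2)"
    by (simp add: norm_mult)
  show "(\<lambda>x. f x * cnj (g x)) \<in> borel_measurable lebesgue"
    using assms unfolding sqint_def
    by (intro borel_measurable_times measurable_compose[OF _ borel_measurable_continuous_onI, of _ _ cnj])
      (auto intro: continuous_on_cnj)
qed

lemma sqint_cong_AE:
  assumes "sqint f" "AE x in lebesgue. f x = g x"
  shows "sqint g"
proof (rule sqint_dominated[OF _ assms(1) sqint_zero])
  show "g \<in> borel_measurable lebesgue"
    using assms by (auto simp: sqint_def intro: borel_measurable_lebesgue_cong_AE)
qed (use assms(2) in auto)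

lemma AE_lebesgue_eq_trans:
  "AE x in lebesgue. f x = (g x::complex) \<Longrightarrow> AE x in lebesgue. g x = h x \<Longrightarrow> AE x in lebesgue. f x = h x"
  by (auto elim: AE_mp)

\<comment> \<open>The Hilbert space of square integrable classes\<close>
\<comment> \<open>The relation is partial because only square integrable functions have a class.
  Identification almost everywhere makes the norm definite.\<close>
quotient_type lsq = "real \<Rightarrow> complex" / partial: "\<lambda>f g. sqint f \<and> sqint g \<and> (AE x in lebesgue. f x = g x)"
proof (rule part_equivpI)
  show "\<exists>f. sqint f \<and> sqint f \<and> (AE x in lebesgue. f x = f x)" using sqint_zero by auto
  show "symp (\<lambda>f g. sqint f \<and> sqint g \<and> (AE x in lebesgue. f x = g x))"
    by (auto intro!: sympI elim: AE_mp)
  show "transp (\<lambda>f g. sqint f \<and> sqint g \<and> (AE x in lebesgue. f x = g x))"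
    by (auto intro!: transpI elim: AE_lebesgue_eq_trans)
qed

text \<open>The class \<open>real_inner\<close> carries real scalars and a real inner product, so
  the complex structure is kept as separate operations; the real inner product will be the real part
  of \<open>cinner\<close>.\<close>

lift_definition cmul :: "complex \<Rightarrow> lsq \<Rightarrow> lsq" is "\<lambda>c f x. c * f x"
  by (auto intro: sqint_cmul)

lift_definition cinner :: "lsq \<Rightarrow> lsq \<Rightarrow> complex" is "\<lambda>f g. LINT x|lebesgue. f x * cnj (g x)"
proof -
  fix f f' g g' :: "real \<Rightarrow> complex"
  assume f: "sqint f \<and> sqint f' \<and> (AE x in lebesgue. f x = f' x)"
    and g: "sqint g \<and> sqint g' \<and> (AE x in lebesgue. g x = g' x)"
  then have "AE x in lebesgue. f x * cnj (g x) = f' x * cnj (g' x)"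
    by (auto elim: AE_mp)
  then show "(LINT x|lebesgue. f x * cnj (g x)) = (LINT x|lebesgue. f' x * cnj (g' x))"
    using f g sqint_mult_integrable by (intro integral_cong_AE) (auto simp: integrable_iff_bounded)
qed

instantiation lsq :: real_inner
begin

lift_definition zero_lsq :: lsq is "\<lambda>x. 0" by (simp add: sqint_zero)

lift_definition plus_lsq :: "lsq \<Rightarrow> lsq \<Rightarrow> lsq" is "\<lambda>f g x. f x + g x"
  by (auto intro: sqint_add elim: AE_mp)

lift_definition minus_lsq :: "lsq \<Rightarrow> lsq \<Rightarrow> lsq" is "\<lambda>f g x. f x - g x"
  by (auto intro: sqint_diff elim: AE_mp)

lift_definition uminus_lsq :: "lsq \<Rightarrow> lsq" is "\<lambda>f x. - f x"
  using sqint_cmul[of _ "-1"] by auto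

definition "scaleR_lsq r (f::lsq) = cmul (of_real r) f"
definition "inner_lsq (f::lsq) g = Re (cinner f g)"
definition "norm_lsq (f::lsq) = sqrt (inner f f)"
definition "dist_lsq (f::lsq) g = norm (f - g)"
definition "sgn_lsq (f::lsq) = inverse (norm f) *\<^sub>R f"
definition "uniformity_lsq = (INF e\<in>{0 <..}. principal {(x::lsq, y). dist x y < e})"
definition "open_lsq (U::lsq set) \<longleftrightarrow> (\<forall>x\<in>U. \<forall>\<^sub>F (x', y) in uniformity. x' = x \<longrightarrow> y \<in> U)"

lemma cinner_self: "cinner f f = of_real (Re (cinner f f))" "Re (cinner f f) \<ge> 0"
proof -
  have 1: "cinner f f = of_real (Re (cinner f f)) \<and> Re (cinner f f) \<ge> 0"
  proof transfer
    fix f :: "real \<Rightarrow> complex"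
    have "(LINT x|lebesgue. f x * cnj (f x)) = (LINT x|lebesgue. of_real ((cmod (f x))\<^sup>2))"
      by (simp only: complex_norm_square)
    also have "\<dots> = of_real (LINT x|lebesgue. (cmod (f x))\<^sup>2)" by (rule integral_complex_of_real)
    finally show "(LINT x|lebesgue. f x * cnj (f x)) = of_real (Re (LINT x|lebesgue. f x * cnj (f x))) \<and> 0 \<le> Re (LINT x|lebesgue. f x * cnj (f x))"
      by simp
  qed
  then show "cinner f f = of_real (Re (cinner f f))" "Re (cinner f f) \<ge> 0" by blast+
qed

lemma cinner_add_left: "cinner (f + g) h = cinner f h + cinner g h"
  by transfer (simp add: ring_distribs sqint_mult_integrable)

lemma cinner_cmul_left: "cinner (cmul c f) h = c * cinner f h"
  by transfer (simp add: mult.assoc)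

lemma cinner_commute: "cinner f g = cnj (cinner g f)"
  by transfer (simp add: mult.commute del: integral_cnj flip: Bochner_Integration.integral_cnj)

lemma cmul_add_right: "cmul c (f + g) = cmul c f + cmul c g"
  by transfer (simp add: sqint_add sqint_cmul ring_distribs)

lemma cmul_add_left: "cmul (c + d) f = cmul c f + cmul d f"
  by transfer (simp add: sqint_add sqint_cmul ring_distribs)

lemma cmul_cmul: "cmul c (cmul d f) = cmul (c * d) f"
  by transfer (simp add: sqint_cmul mult.assoc[symmetric])

lemma cmul_one: "cmul 1 f = f"
  by transfer simp

lemma cinner_zero_iff: "Re (cinner f f) = 0 \<longleftrightarrow> f = 0"
proof transfer
  fix f assume f: "sqint f \<and> sqint f \<and> (AE x in lebesgue. f x = f x)"
  have "(LINT x|lebesgue. f x * cnj (f x)) = (LINT x|lebesgue. of_real ((cmod (f x))\<^sup>2))"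
    by (simp only: complex_norm_square)
  also have "\<dots> = of_real (LINT x|lebesgue. (cmod (f x))\<^sup>2)" by (rule integral_complex_of_real)
  finally have "Re (LINT x|lebesgue. f x * cnj (f x)) = (LINT x|lebesgue. (cmod (f x))\<^sup>2)" by simp
  moreover have "(LINT x|lebesgue. (cmod (f x))\<^sup>2) = 0 \<longleftrightarrow> (AE x in lebesgue. (cmod (f x))\<^sup>2 = 0)"
    using f by (intro integral_nonneg_eq_0_iff_AE) (auto simp: sqint_def)
  ultimately show "(Re (LINT x|lebesgue. f x * cnj (f x)) = 0) = (sqint f \<and> sqint (\<lambda>x. 0) \<and> (AE x in lebesgue. f x = 0))"
    using f by (simp add: sqint_zero)
qed

instance
proof
  fix x y z :: lsq and a b :: real
  show "x + y + z = x + (y + z)" "x + y = y + x" "0 + x = x" "- x + x = 0" "x - y = x + - y"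
    by (transfer; auto intro: sqint_add sqint_diff sqint_cmul[of _ "-1", simplified] sqint_zero simp: algebra_simps)+
  show "a *\<^sub>R (x + y) = a *\<^sub>R x + a *\<^sub>R y" "(a + b) *\<^sub>R x = a *\<^sub>R x + b *\<^sub>R x"
    "a *\<^sub>R b *\<^sub>R x = (a * b) *\<^sub>R x" "1 *\<^sub>R x = x"
    by (simp_all add: scaleR_lsq_def cmul_add_right cmul_add_left cmul_cmul cmul_one)
  show "dist x y = norm (x - y)" "sgn x = inverse (norm x) *\<^sub>R x" "norm x = sqrt (inner x x)"
    by (simp_all add: dist_lsq_def sgn_lsq_def norm_lsq_def)
  show "uniformity = (INF e\<in>{0 <..}. principal {(x::lsq, y). dist x y < e})"
    by (rule uniformity_lsq_def)
  show "open U = (\<forall>x\<in>U. \<forall>\<^sub>F (x', y) in uniformity. x' = x \<longrightarrow> y \<in> U)" for U :: "lsq set"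
    by (rule open_lsq_def)
  show "inner x y = inner y x"
    using cinner_commute[of x y] by (simp add: inner_lsq_def)
  show "inner (x + y) z = inner x z + inner y z"
    by (simp add: inner_lsq_def cinner_add_left)
  show "inner (a *\<^sub>R x) y = a * inner x y"
    by (simp add: inner_lsq_def scaleR_lsq_def cinner_cmul_left)
  show "0 \<le> inner x x" "(inner x x = 0) = (x = 0)"
    using cinner_self[of x] cinner_zero_iff[of x] by (auto simp: inner_lsq_def)
qed

end

lemma power2_norm_lsq_abs:
  assumes "sqint f"
  shows "(norm (abs_lsq f))\<^sup>2 = (LINT x|lebesgue. (cmod (f x))\<^sup>2)"
proof -
  have "(norm (abs_lsq f))\<^sup>2 = Re (LINT x|lebesgue. f x * cnj (f x))"
    unfolding power2_norm_eq_inner inner_lsq_def using assms by (subst cinner.abs_eq) auto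
  also have "(LINT x|lebesgue. f x * cnj (f x)) = (LINT x|lebesgue. of_real ((cmod (f x))\<^sup>2))"
    by (simp only: complex_norm_square)
  also have "\<dots> = of_real (LINT x|lebesgue. (cmod (f x))\<^sup>2)" by (rule integral_complex_of_real)
  finally show ?thesis by simp
qed

lemma sqint_rep: "sqint (rep_lsq x)" and abs_rep_lsq: "abs_lsq (rep_lsq x) = x"
  using Quotient_lsq Quotient_rep_reflp[OF Quotient_lsq, of x] Quotient_abs_rep[OF Quotient_lsq, of x] by auto

lemma minus_lsq_abs: "sqint f \<Longrightarrow> sqint g \<Longrightarrow> abs_lsq f - abs_lsq g = abs_lsq (\<lambda>x. f x - g x)"
  by (rule minus_lsq.abs_eq) auto

lemma abs_lsq_eq_iff: "sqint f \<Longrightarrow> sqint g \<Longrightarrow> abs_lsq f = abs_lsq g \<longleftrightarrow> (AE x in lebesgue. f x = g x)"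
  using Quotient_rel[OF Quotient_lsq, of f g] by auto

text \<open>A summable sequence of increments has an a.e. absolutely convergent series, by monotone convergence
  for the partial sums of the moduli; Fatou's lemma then controls the remainder.\<close>

lemma lsq_fast_Cauchy_convergent:
  fixes X :: "nat \<Rightarrow> lsq"
  assumes X: "\<And>n. norm (X (Suc n) - X n) \<le> (1/2) ^ n"
  shows "convergent X"
proof -
  define f where "f n = rep_lsq (X n)" for n
  have f: "sqint (f n)" "X n = abs_lsq (f n)" for n by (auto simp: f_def sqint_rep abs_rep_lsq)
  have meas[measurable]: "f n \<in> borel_measurable lebesgue" for n using f by (auto simp: sqint_def)
  have nn: "(\<integral>\<^sup>+x. ennreal ((cmod (f m x - f n x))\<^sup>2) \<partial>lebesgue) = ennreal ((norm (X m - X n))\<^sup>2)" for m n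
  proof -
    have s: "sqint (\<lambda>x. f m x - f n x)" using f sqint_diff by blast
    have "(norm (X m - X n))\<^sup>2 = (LINT x|lebesgue. (cmod (f m x - f n x))\<^sup>2)"
      unfolding f(2) minus_lsq_abs[OF f(1) f(1)] by (rule power2_norm_lsq_abs[OF s])
    then show ?thesis using s by (subst nn_integral_eq_integral) (auto simp: sqint_def)
  qed
  have far: "norm (X n - X m) \<le> 2 * (1/2) ^ m" if "m \<le> n" for m n
  proof -
    have "norm (X n - X m) \<le> 2 * ((1/2) ^ m - (1/2) ^ n)"
      using that
    proof (induction n rule: dec_induct)
      case (step n)
      have "norm (X (Suc n) - X m) \<le> norm (X (Suc n) - X n) + norm (X n - X m)"
        using norm_triangle_ineq[of "X (Suc n) - X n" "X n - X m"] by simp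
      also have "\<dots> \<le> (1/2) ^ n + 2 * ((1/2) ^ m - (1/2) ^ n)" using step.IH X[of n] by linarith
      finally show ?case by (simp add: algebra_simps)
    qed simp
    moreover have "(0::real) \<le> (1/2) ^ n" by simp
    ultimately show ?thesis by argo
  qed
  \<comment> \<open>With this weight both \<open>w k * ((1/2) ^ k)\<^sup>2 = (3/8) ^ k\<close> and
    \<open>1 / w k = (2/3) ^ k\<close> are summable. Summability of the weighted squares then
    implies absolute summability of the increments through
    \<open>a * b \<le> a\<^sup>2 + b\<^sup>2\<close>.\<close>
  define w :: "nat \<Rightarrow> real" where "w k = (3/2) ^ k" for k
  have "AE x in lebesgue. (\<Sum>k. ennreal (w k * (cmod (f (Suc k) x - f k x))\<^sup>2)) \<noteq> \<infinity>"
  proof (rule nn_integral_noteq_infinite)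
    have "(\<integral>\<^sup>+x. (\<Sum>k. ennreal (w k * (cmod (f (Suc k) x - f k x))\<^sup>2)) \<partial>lebesgue)
        = (\<Sum>k. \<integral>\<^sup>+x. ennreal (w k * (cmod (f (Suc k) x - f k x))\<^sup>2) \<partial>lebesgue)"
      by (rule nn_integral_suminf) simp
    also have "\<dots> = (\<Sum>k. ennreal (w k * (norm (X (Suc k) - X k))\<^sup>2))"
      by (intro suminf_cong, simp add: ennreal_mult nn_integral_cmult w_def nn)
    also have "\<dots> \<le> (\<Sum>k. ennreal ((3/8) ^ k))"
    proof (intro suminf_le ennreal_leI)
      fix k
      have "w k * (norm (X (Suc k) - X k))\<^sup>2 \<le> w k * ((1/2) ^ k)\<^sup>2"
        using X[of k] by (intro mult_left_mono power_mono) (auto simp: w_def)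
      also have "\<dots> = (3/8) ^ k" by (simp add: w_def power_mult_distrib[symmetric] power_even_eq[symmetric] power_mult[symmetric] mult.commute[of k 2]) (simp add: power_mult power_mult_distrib[symmetric] power2_eq_square)
      finally show "w k * (norm (X (Suc k) - X k))\<^sup>2 \<le> (3/8) ^ k" .
    qed auto
    also have "\<dots> < \<infinity>" by (subst suminf_ennreal2) (auto intro: summable_geometric)
    finally show "(\<integral>\<^sup>+x. (\<Sum>k. ennreal (w k * (cmod (f (Suc k) x - f k x))\<^sup>2)) \<partial>lebesgue) \<noteq> \<infinity>" by simp
  qed simp
  then have conv: "AE x in lebesgue. convergent (\<lambda>n. f n x)"
  proof eventually_elim
    case (elim x)
    then have "summable (\<lambda>k. w k * (cmod (f (Suc k) x - f k x))\<^sup>2)"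
      by (intro summable_suminf_not_top) (auto simp: w_def)
    moreover have "summable (\<lambda>k. (2/3::real) ^ k)" by (rule summable_geometric) simp
    ultimately have s: "summable (\<lambda>k. w k * (cmod (f (Suc k) x - f k x))\<^sup>2 + (2/3) ^ k)" by (rule summable_add)
    have "summable (\<lambda>k. cmod (f (Suc k) x - f k x))"
    proof (rule summable_comparison_test'[OF s])
      fix k
      define a where "a = sqrt (w k) * cmod (f (Suc k) x - f k x)"
      define b where "b = sqrt ((2/3::real) ^ k)"
      have "sqrt (w k) * b = 1"
        by (simp add: w_def b_def real_sqrt_mult[symmetric] power_mult_distrib[symmetric])
      then have "cmod (f (Suc k) x - f k x) = a * b" by (simp add: a_def mult.commute mult.left_commute)
      also have "\<dots> \<le> a\<^sup>2 + b\<^sup>2"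
      proof -
        have "a * b \<ge> 0" by (simp add: a_def b_def w_def)
        then show ?thesis using sum_squares_bound[of a b] by linarith
      qed
      also have "\<dots> = w k * (cmod (f (Suc k) x - f k x))\<^sup>2 + (2/3) ^ k"
        by (simp add: a_def b_def power_mult_distrib w_def)
      finally show "norm (cmod (f (Suc k) x - f k x)) \<le> w k * (cmod (f (Suc k) x - f k x))\<^sup>2 + (2/3) ^ k" by simp
    qed
    then have "summable (\<lambda>k. f (Suc k) x - f k x)" by (rule summable_norm_cancel)
    then have "convergent (\<lambda>n. \<Sum>k<n. f (Suc k) x - f k x)" by (simp add: summable_iff_convergent)
    then have "convergent (\<lambda>n. f n x - f 0 x)" by (simp add: sum_lessThan_telescope[of "\<lambda>n. f n x"])
    then show ?case using convergent_diff_const_right_iff[of "\<lambda>n. f n x" "f 0 x"] by simp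
  qed
  define g where "g x = lim (\<lambda>n. f n x)" for x
  have g[measurable]: "g \<in> borel_measurable lebesgue" unfolding g_def by measurable
  have lim: "AE x in lebesgue. (\<lambda>n. f n x) \<longlonglongrightarrow> g x"
    using conv by eventually_elim (simp add: g_def convergent_LIMSEQ_iff)
  have fatou: "(\<integral>\<^sup>+x. ennreal ((cmod (g x - f m x))\<^sup>2) \<partial>lebesgue) \<le> ennreal ((2 * (1/2) ^ m)\<^sup>2)" for m
  proof -
    have "(\<integral>\<^sup>+x. ennreal ((cmod (g x - f m x))\<^sup>2) \<partial>lebesgue)
        = (\<integral>\<^sup>+x. liminf (\<lambda>n. ennreal ((cmod (f n x - f m x))\<^sup>2)) \<partial>lebesgue)"
    proof (rule nn_integral_cong_AE)
      show "AE x in lebesgue. ennreal ((cmod (g x - f m x))\<^sup>2) = liminf (\<lambda>n. ennreal ((cmod (f n x - f m x))\<^sup>2))"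
        using lim
      proof eventually_elim
        case (elim x)
        then have "(\<lambda>n. ennreal ((cmod (f n x - f m x))\<^sup>2)) \<longlonglongrightarrow> ennreal ((cmod (g x - f m x))\<^sup>2)"
          by (intro tendsto_ennrealI tendsto_intros)
        from lim_imp_Liminf[OF sequentially_bot this] show ?case by (rule sym)
      qed
    qed
    also have "\<dots> \<le> liminf (\<lambda>n. \<integral>\<^sup>+x. ennreal ((cmod (f n x - f m x))\<^sup>2) \<partial>lebesgue)"
      by (rule nn_integral_liminf) simp
    also have "\<dots> = liminf (\<lambda>n. ennreal ((norm (X n - X m))\<^sup>2))" by (simp add: nn)
    also have "\<dots> \<le> ennreal ((2 * (1/2) ^ m)\<^sup>2)"
    proof (rule Liminf_le[OF sequentially_bot])
      show "\<forall>\<^sub>F n in sequentially. ennreal ((norm (X n - X m))\<^sup>2) \<le> ennreal ((2 * (1/2) ^ m)\<^sup>2)"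
        using eventually_ge_at_top[of m] by eventually_elim (intro ennreal_leI power_mono far, auto)
    qed
    finally show ?thesis .
  qed
  have d: "sqint (\<lambda>x. g x - f m x)" for m
    unfolding sqint_def
  proof
    show "integrable lebesgue (\<lambda>x. (cmod (g x - f m x))\<^sup>2)"
      using fatou[of m] by (intro integrableI_bounded) (auto intro: le_less_trans)
  qed simp
  have g2: "sqint g" using sqint_add[OF d[of 0] f(1)[of 0]] by simp
  have "norm (X m - abs_lsq g) \<le> 2 * (1/2) ^ m" for m
  proof -
    have "abs_lsq g - X m = abs_lsq (\<lambda>x. g x - f m x)" unfolding f(2) by (rule minus_lsq_abs[OF g2 f(1)])
    then have "(norm (abs_lsq g - X m))\<^sup>2 = (LINT x|lebesgue. (cmod (g x - f m x))\<^sup>2)"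
      using power2_norm_lsq_abs[OF d] by simp
    moreover have "ennreal (LINT x|lebesgue. (cmod (g x - f m x))\<^sup>2) \<le> ennreal ((2 * (1/2) ^ m)\<^sup>2)"
      using fatou[of m] d[of m] by (subst nn_integral_eq_integral[symmetric]) (auto simp: sqint_def)
    ultimately have "(norm (abs_lsq g - X m))\<^sup>2 \<le> (2 * (1/2) ^ m)\<^sup>2"
      by (simp add: ennreal_le_iff)
    then show ?thesis by (subst norm_minus_commute) (rule power2_le_imp_le, auto)
  qed
  moreover have "(\<lambda>m. 2 * (1/2::real) ^ m) \<longlonglongrightarrow> 0"
    by (intro tendsto_mult_right_zero LIMSEQ_realpow_zero) auto
  ultimately have "(\<lambda>m. X m - abs_lsq g) \<longlonglongrightarrow> 0"
    using Lim_null_comparison[of "\<lambda>m. X m - abs_lsq g" "\<lambda>m. 2 * (1/2) ^ m" sequentially]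
    by (simp add: always_eventually)
  then show ?thesis using LIM_zero_cancel convergentI by blast
qed

instance lsq :: complete_space
proof
  fix X :: "nat \<Rightarrow> lsq" assume X: "Cauchy X"
  have "\<exists>N. \<forall>m\<ge>N. \<forall>n\<ge>N. norm (X m - X n) < (1/2) ^ k" for k :: nat
    using X by (simp add: Cauchy_iff)
  then obtain N where N: "\<And>k m n. m \<ge> N k \<Longrightarrow> n \<ge> N k \<Longrightarrow> norm (X m - X n) < (1/2) ^ k" by metis
  \<comment> \<open>Partial sums of \<open>Suc (N j)\<close> give indices that increase strictly and
    dominate \<open>N k\<close>, although \<open>N\<close> may fail to be monotone.\<close>
  define r where "r k = (\<Sum>j\<le>k. Suc (N j))" for k
  have r: "strict_mono r" by (rule strict_monoI_Suc) (simp add: r_def)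
  have rN: "N k \<le> r k" for k
    using member_le_sum[of k "{..k}" "\<lambda>j. Suc (N j)"] by (simp add: r_def)
  have "convergent (X \<circ> r)"
  proof (rule lsq_fast_Cauchy_convergent)
    fix k
    have "N k \<le> r (Suc k)" using rN[of k] strict_monoD[OF r, of k "Suc k"] by simp
    then show "norm ((X \<circ> r) (Suc k) - (X \<circ> r) k) \<le> (1/2) ^ k"
      using N[of k "r (Suc k)" "r k"] rN[of k] by (simp add: less_imp_le)
  qed
  then obtain l where "(X \<circ> r) \<longlonglongrightarrow> l" by (auto simp: convergent_def)
  then have "X \<longlonglongrightarrow> l" using Cauchy_converges_subseq[OF X r] by blast
  then show "convergent X" by (rule convergentI)
qed

subsection \<open>Almost everywhere differentiation of indefinite integrals\<close>

text \<open>Vitali's covering theorem applied to the intervals on which the difference quotient is off by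
  more than \<open>1 / (n + 1)\<close>; the Saks--Henstock lemma bounds their total length.\<close>

lemma negligible_not_derivative_integral:
  fixes f :: "real \<Rightarrow> 'n::euclidean_space"
  assumes f: "f integrable_on {a..b}"
  shows "negligible {x\<in>{a..b}. \<not> ((\<lambda>x. integral {a..x} f) has_vector_derivative f x) (at x within {a..b})}"
proof -
  define F where "F x = integral {a..x} f" for x
  define err where "err x y = norm (F y - F x - (y - x) *\<^sub>R f x)" for x y
  \<comment> \<open>If the derivative fails at \<open>x\<close>, then for some \<open>n\<close> the
    error exceeds \<open>1 / (n + 1)\<close> times the distance at arbitrarily small scales, so
    countably many negligible sets suffice.\<close>
  define Bad where "Bad n = {x\<in>{a..b}. \<forall>d>0. \<exists>y\<in>{a..b}. \<bar>y - x\<bar> < d \<and> err x y > \<bar>y - x\<bar> / real (Suc n)}" for n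
  have "{x\<in>{a..b}. \<not> (F has_vector_derivative f x) (at x within {a..b})} \<subseteq> (\<Union>n. Bad n)"
  proof
    fix x assume x: "x \<in> {x\<in>{a..b}. \<not> (F has_vector_derivative f x) (at x within {a..b})}"
    then obtain e where e: "e > 0" "\<forall>d>0. \<exists>y\<in>{a..b}. \<bar>y - x\<bar> < d \<and> err x y > e * \<bar>y - x\<bar>"
      unfolding has_vector_derivative_def has_derivative_within_alt err_def
      by (auto simp: bounded_linear_scaleR_left not_le)
    obtain n where n: "inverse (real (Suc n)) < e" using reals_Archimedean e(1) by blast
    have "x \<in> Bad n"
      unfolding Bad_def
    proof (intro CollectI conjI allI impI)
      fix d :: real assume "d > 0"
      then obtain y where y: "y \<in> {a..b}" "\<bar>y - x\<bar> < d" "err x y > e * \<bar>y - x\<bar>" using e(2) by blast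
      have "\<bar>y - x\<bar> / real (Suc n) \<le> e * \<bar>y - x\<bar>"
        using mult_right_mono[OF less_imp_le[OF n], of "\<bar>y - x\<bar>"] by (simp add: divide_inverse mult.commute)
      then show "\<exists>y\<in>{a..b}. \<bar>y - x\<bar> < d \<and> err x y > \<bar>y - x\<bar> / real (Suc n)"
        using y by (intro bexI[of _ y]) auto
    qed (use x in auto)
    then show "x \<in> (\<Union>n. Bad n)" by blast
  qed
  moreover have "negligible (Bad n)" for n
    unfolding negligible_outer_le
  proof (intro allI impI)
    fix \<eta> :: real assume \<eta>: "\<eta> > 0"
    \<comment> \<open>The Saks--Henstock lemma contributes the factor \<open>2 * DIM('n)\<close> and
      the threshold the factor \<open>n + 1\<close>; \<open>e\<close> is scaled so that the product
      is \<open>\<eta>\<close>.\<close>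
    define e where "e = \<eta> / (2 * real DIM('n) * real (Suc n))"
    have e: "e > 0" using \<eta> by (simp add: e_def)
    obtain \<gamma> where \<gamma>: "gauge \<gamma>" and fine: "\<And>\<D>. \<D> tagged_division_of (cbox a b) \<Longrightarrow> \<gamma> fine \<D> \<Longrightarrow>
        norm ((\<Sum>(x,k)\<in>\<D>. measure lborel k *\<^sub>R f x) - integral (cbox a b) f) < e"
      using integrable_integral[OF f] e unfolding box_real(2)[symmetric] has_integral by (metis e)
    define seg where "seg = (\<lambda>(x, y). {min x y..max x y :: real})"
    \<comment> \<open>A member is a tag \<open>x\<close> together with the other endpoint
      \<open>y\<close>: the tag is an endpoint of its segment, and the integral over the segment is
      \<open>F y - F x\<close> up to sign.\<close>
    define K where "K = {(x, y). x \<in> Bad n \<and> y \<in> {a..b} \<and> y \<noteq> x \<and> seg (x, y) \<subseteq> \<gamma> x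
        \<and> err x y > \<bar>y - x\<bar> / real (Suc n)}"
    define ctr where "ctr = (\<lambda>(x, y). (x + y) / 2 :: real)"
    define rad where "rad = (\<lambda>(x, y). \<bar>y - x\<bar> / 2 :: real)"
    have cball: "cball (ctr i) (rad i) = seg i" for i
      by (cases i) (auto simp: ctr_def rad_def seg_def cball_eq_atLeastAtMost min_def max_def field_simps)
    have rad: "rad i > 0" if "i \<in> K" for i using that by (auto simp: K_def rad_def)
    have cov: "\<exists>i. i \<in> K \<and> x \<in> cball (ctr i) (rad i) \<and> rad i < d" if x: "x \<in> Bad n" and d: "d > 0" for x d
    proof -
      have "x \<in> \<gamma> x" "open (\<gamma> x)" using \<gamma> by (auto simp: gauge_def)
      then obtain r where r: "r > 0" "ball x r \<subseteq> \<gamma> x" by (meson open_contains_ball)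
      obtain y where y: "y \<in> {a..b}" "\<bar>y - x\<bar> < min d r" "err x y > \<bar>y - x\<bar> / real (Suc n)"
        using x d r unfolding Bad_def by (smt (verit, best) mem_Collect_eq)
      have "y \<noteq> x" using y(3) by (auto simp: err_def)
      moreover have "seg (x, y) \<subseteq> \<gamma> x"
        using y(2) r(2) by (force simp: seg_def dist_real_def subset_iff)
      ultimately have "(x, y) \<in> K" using x y by (auto simp: K_def)
      moreover have "x \<in> cball (ctr (x, y)) (rad (x, y))" unfolding cball by (auto simp: seg_def)
      moreover have "rad (x, y) < d" using y(2) d unfolding rad_def by simp
      ultimately show ?thesis by blast
    qed
    obtain C where C: "countable C" "C \<subseteq> K"
        "pairwise (\<lambda>i j. disjnt (cball (ctr i) (rad i)) (cball (ctr j) (rad j))) C"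
        "negligible (Bad n - (\<Union>i\<in>C. cball (ctr i) (rad i)))"
      using Vitali_covering_theorem_cballs[of K rad "Bad n" ctr] rad cov by blast
    have disj: "disjnt (seg i) (seg j)" if "i \<in> C" "j \<in> C" "i \<noteq> j" for i j
      using pairwiseD[OF C(3) that] by (simp add: cball)
    have sub: "seg i \<subseteq> {a..b}" if "i \<in> K" for i
      using that by (auto simp: K_def seg_def Bad_def min_def max_def split: if_splits)
    \<comment> \<open>Finite subfamilies suffice: each segment is charged with a Henstock error of
      at least its length over \<open>n + 1\<close>, and the countable union inherits the
      bound.\<close>
    have bound: "measure lebesgue (\<Union>i\<in>I. seg i) \<le> \<eta>" if I: "I \<subseteq> C" "finite I" for I
    proof -
      define h where "h i = (fst i, seg i)" for i
      have fst_in: "fst i \<in> seg i" for i by (cases i) (auto simp: seg_def)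
      have inj: "inj_on h I"
      proof (rule inj_onI)
        fix i j assume "i \<in> I" "j \<in> I" "h i = h j"
        then show "i = j" using disj[of i j] I fst_in[of i] by (auto simp: h_def disjnt_iff)
      qed
      have part: "(h ` I) tagged_partial_division_of (cbox a b)"
        unfolding tagged_partial_division_of_def
      proof (intro conjI allI impI)
        show "finite (h ` I)" using I by simp
        fix x k assume "(x, k) \<in> h ` I"
        then obtain i where i: "i \<in> I" "x = fst i" "k = seg i" by (auto simp: h_def)
        then show "x \<in> k" using fst_in by simp
        have "i \<in> K" using i I C by blast
        then show "k \<subseteq> cbox a b" using sub i by simp
        show "\<exists>a b. k = cbox a b" using i by (cases i) (auto simp: seg_def)
      next
        fix x k x' k' assume as: "(x, k) \<in> h ` I \<and> (x', k') \<in> h ` I \<and> (x, k) \<noteq> (x', k')"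
        then obtain i j where "i \<in> I" "j \<in> I" "k = seg i" "k' = seg j" "i \<noteq> j" by (auto simp: h_def)
        then have "k \<inter> k' = {}" using disj[of i j] I by (auto simp: disjnt_def)
        then show "interior k \<inter> interior k' = {}" using interior_subset by blast
      qed
      have "k \<subseteq> \<gamma> x" if "(x, k) \<in> h ` I" for x k
      proof -
        from that obtain i where i: "i \<in> I" "x = fst i" "k = seg i" by (auto simp: h_def)
        then have "i \<in> K" using I C by blast
        then show "k \<subseteq> \<gamma> x" using i by (auto simp: K_def split: prod.splits)
      qed
      then have fine': "\<gamma> fine (h ` I)" unfolding fine_def by blast
      have "(\<Sum>(x,k)\<in>h ` I. norm (measure lborel k *\<^sub>R f x - integral k f)) \<le> 2 * real DIM('n) * e"
        using Henstock_lemma_part2[OF _ e \<gamma> fine part fine'] f by simp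
      moreover have "(\<Sum>(x,k)\<in>h ` I. norm (measure lborel k *\<^sub>R f x - integral k f))
          = (\<Sum>i\<in>I. norm (measure lborel (seg i) *\<^sub>R f (fst i) - integral (seg i) f))"
        by (subst sum.reindex[OF inj]) (simp add: h_def)
      ultimately have H: "(\<Sum>i\<in>I. norm (measure lborel (seg i) *\<^sub>R f (fst i) - integral (seg i) f)) \<le> 2 * real DIM('n) * e"
        by simp
      have low: "measure lborel (seg i) / real (Suc n) \<le> norm (measure lborel (seg i) *\<^sub>R f (fst i) - integral (seg i) f)"
        if i: "i \<in> I" for i
      proof -
        obtain x y where xy: "i = (x, y)" by (cases i)
        have iK: "x \<in> {a..b}" "y \<in> {a..b}" "err x y > \<bar>y - x\<bar> / real (Suc n)"
          using i I C xy by (auto simp: K_def Bad_def)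
        have comb: "F v - F u = integral {u..v} f" if "a \<le> u" "u \<le> v" "v \<le> b" for u v
        proof -
          have "f integrable_on {a..v}" using integrable_subinterval_real[OF f, of a v] that by auto
          then show ?thesis using Henstock_Kurzweil_Integration.integral_combine[of a u v f] that
            by (simp add: F_def algebra_simps)
        qed
        have "measure lborel (seg i) = \<bar>y - x\<bar>" by (auto simp: xy seg_def min_def max_def)
        moreover have "norm (measure lborel (seg i) *\<^sub>R f (fst i) - integral (seg i) f) = err x y"
        proof (cases "x \<le> y")
          case True
          then show ?thesis using comb[of x y] iK
            by (simp add: xy seg_def err_def norm_minus_commute)
        next
          case False
          then have "norm (measure lborel (seg i) *\<^sub>R f (fst i) - integral (seg i) f) = norm ((x - y) *\<^sub>R f x - (F x - F y))"
            using comb[of y x] iK by (simp add: xy seg_def)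
          also have "(x - y) *\<^sub>R f x - (F x - F y) = F y - F x - (y - x) *\<^sub>R f x"
            by (simp add: algebra_simps)
          finally show ?thesis by (simp add: err_def)
        qed
        ultimately show ?thesis using iK(3) by simp
      qed
      have "measure lebesgue (\<Union>i\<in>I. seg i) \<le> (\<Sum>i\<in>I. measure lebesgue (seg i))"
        using I by (intro measure_UNION_le) (auto simp: seg_def)
      also have "\<dots> = (\<Sum>i\<in>I. measure lborel (seg i))"
        by (intro sum.cong refl) (auto simp: seg_def split: prod.split)
      also have "\<dots> = real (Suc n) * (\<Sum>i\<in>I. measure lborel (seg i) / real (Suc n))"
        by (simp add: sum_divide_distrib[symmetric] del: of_nat_Suc)
      also have "\<dots> \<le> real (Suc n) * (2 * real DIM('n) * e)"
        using order_trans[OF sum_mono[OF low] H] by (intro mult_left_mono) auto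
      also have "\<dots> = \<eta>" by (simp add: e_def del: of_nat_Suc)
      finally show ?thesis .
    qed
    have meas: "(\<Union>i\<in>C. seg i) \<in> lmeasurable" "measure lebesgue (\<Union>i\<in>C. seg i) \<le> \<eta>"
      using fmeasurable_UN_bound[OF C(1), of seg lebesgue \<eta>] measure_UN_bound[OF C(1), of seg lebesgue \<eta>] bound
      by (auto simp: seg_def split: prod.splits)
    have N: "negligible (Bad n - (\<Union>i\<in>C. seg i))" using C(4) by (simp add: cball)
    show "\<exists>T. Bad n \<subseteq> T \<and> T \<in> lmeasurable \<and> measure lebesgue T \<le> \<eta>"
    proof (intro exI conjI)
      let ?T = "(\<Union>i\<in>C. seg i) \<union> (Bad n - (\<Union>i\<in>C. seg i))"
      show "Bad n \<subseteq> ?T" by blast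
      show "?T \<in> lmeasurable" using meas(1) negligible_imp_measurable[OF N] by (rule fmeasurable.Un)
      have "measure lebesgue ?T \<le> measure lebesgue (\<Union>i\<in>C. seg i) + measure lebesgue (Bad n - (\<Union>i\<in>C. seg i))"
        using meas(1) negligible_imp_measurable[OF N] by (intro measure_Un_le) (auto simp: fmeasurableD)
      then show "measure lebesgue ?T \<le> \<eta>" using meas negligible_imp_measure0[OF N] by simp
    qed
  qed
  ultimately show ?thesis
    unfolding F_def[symmetric] by (meson negligible_subset negligible_Union_nat)
qed

subsection \<open>Primitives of square integrable functions\<close>

lemma L2_iff_sqint: "L2 l f \<longleftrightarrow> sqint (\<lambda>x. indicator {0..l} x *\<^sub>R f x)"
proof -
  have "(cmod (indicator {0..l} x *\<^sub>R f x))\<^sup>2 = indicator {0..l} x *\<^sub>R (cmod (f x))\<^sup>2" for x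
    by (simp add: indicator_def)
  then show ?thesis by (simp add: L2_def sqint_def set_borel_measurable_def set_integrable_def)
qed

definition aeq :: "real \<Rightarrow> (real \<Rightarrow> complex) \<Rightarrow> (real \<Rightarrow> complex) \<Rightarrow> bool" where
  "aeq l f g \<longleftrightarrow> (AE x in lebesgue. x \<in> {0..l} \<longrightarrow> f x = g x)"

lemma aeq_refl: "aeq l f f" and aeq_sym: "aeq l f g \<Longrightarrow> aeq l g f"
  by (auto simp: aeq_def elim: AE_mp)

lemma aeq_pointwise: "(\<And>x. x \<in> {0..l} \<Longrightarrow> f x = g x) \<Longrightarrow> aeq l f g"
  by (auto simp: aeq_def)

definition cls :: "real \<Rightarrow> (real \<Rightarrow> complex) \<Rightarrow> lsq" where
  "cls l f = abs_lsq (\<lambda>x. indicator {0..l} x *\<^sub>R f x)"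

lemma cut_aeq: "aeq l f g \<longleftrightarrow> (AE x in lebesgue. indicator {0..l} x *\<^sub>R f x = indicator {0..l} x *\<^sub>R g x)"
  unfolding aeq_def by (intro AE_cong) (auto simp: indicator_def)

lemma cls_eq_iff: "L2 l f \<Longrightarrow> L2 l g \<Longrightarrow> cls l f = cls l g \<longleftrightarrow> aeq l f g"
  unfolding cls_def cut_aeq L2_iff_sqint by (rule abs_lsq_eq_iff)

lemma L2_aeq: "L2 l f \<Longrightarrow> aeq l f g \<Longrightarrow> L2 l g"
  unfolding cut_aeq L2_iff_sqint by (rule sqint_cong_AE)

lemma L2_add: "L2 l f \<Longrightarrow> L2 l g \<Longrightarrow> L2 l (\<lambda>x. f x + g x)"
  unfolding L2_iff_sqint by (drule (1) sqint_add) (simp add: scaleR_add_right)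

lemma L2_cmul: "L2 l f \<Longrightarrow> L2 l (\<lambda>x. c * f x)"
  unfolding L2_iff_sqint by (drule sqint_cmul[of _ c]) (simp add: mult_scaleR_right)

lemma L2_lin: "L2 l f \<Longrightarrow> L2 l g \<Longrightarrow> L2 l (\<lambda>x. a * f x + b * g x)"
  by (intro L2_add L2_cmul)

lemma L2_diff: "L2 l f \<Longrightarrow> L2 l g \<Longrightarrow> L2 l (\<lambda>x. f x - g x)"
  using L2_lin[of l f g 1 "-1"] by simp

lemma L2_zero: "L2 l (\<lambda>x. 0)"
  unfolding L2_iff_sqint by (simp add: sqint_zero)

lemma L2_continuous:
  assumes "continuous_on {0..l} f"
  shows "L2 l f"
  unfolding L2_def
proof
  have "set_integrable lebesgue {0..l} f"
    using absolutely_integrable_continuous_real[OF assms] .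
  then show "set_borel_measurable lebesgue {0..l} f"
    unfolding set_integrable_def set_borel_measurable_def by (rule borel_measurable_integrable)
  have "continuous_on {0..l} (\<lambda>x. (cmod (f x))\<^sup>2)" by (intro continuous_intros assms)
  then show "set_integrable lebesgue {0..l} (\<lambda>x. (cmod (f x))\<^sup>2)"
    by (rule absolutely_integrable_continuous_real)
qed

lemma L2_const: "L2 l (\<lambda>x. c)"
  by (rule L2_continuous) (rule continuous_on_const)

lemma L2_cnj: "L2 l f \<Longrightarrow> L2 l (\<lambda>x. cnj (f x))"
proof -
  assume f: "L2 l f"
  have "(\<lambda>x. cnj (indicator {0..l} x *\<^sub>R f x)) \<in> borel_measurable lebesgue"
    using f unfolding L2_iff_sqint sqint_def
    by (intro measurable_compose[OF _ borel_measurable_continuous_onI, of _ _ cnj]) (auto intro: continuous_on_cnj)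
  moreover have "cnj (indicator {0..l} x *\<^sub>R f x) = indicator {0..l} x *\<^sub>R cnj (f x)" for x
    by (simp add: indicator_def)
  ultimately have "(\<lambda>x. indicator {0..l} x *\<^sub>R cnj (f x)) \<in> borel_measurable lebesgue" by simp
  then show ?thesis
    using f by (auto simp: L2_def set_borel_measurable_def)
qed

lemma cmul_abs: "sqint f \<Longrightarrow> cmul c (abs_lsq f) = abs_lsq (\<lambda>x. c * f x)"
  by (rule cmul.abs_eq) auto

lemma cls_lin:
  assumes "L2 l f" "L2 l g"
  shows "cls l (\<lambda>x. a * f x + b * g x) = cmul a (cls l f) + cmul b (cls l g)"
proof -
  let ?f = "\<lambda>x. indicator {0..l} x *\<^sub>R f x" and ?g = "\<lambda>x. indicator {0..l} x *\<^sub>R g x"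
  have s: "sqint ?f" "sqint ?g" using assms by (auto simp: L2_iff_sqint)
  have "cmul a (cls l f) = abs_lsq (\<lambda>x. a * ?f x)" "cmul b (cls l g) = abs_lsq (\<lambda>x. b * ?g x)"
    unfolding cls_def by (rule cmul_abs[OF s(1)], rule cmul_abs[OF s(2)])
  moreover have "abs_lsq (\<lambda>x. a * ?f x) + abs_lsq (\<lambda>x. b * ?g x) = abs_lsq (\<lambda>x. a * ?f x + b * ?g x)"
    using sqint_cmul[OF s(1), of a] sqint_cmul[OF s(2), of b] by (intro plus_lsq.abs_eq) auto
  moreover have "(\<lambda>x. a * ?f x + b * ?g x) = (\<lambda>x. indicator {0..l} x *\<^sub>R (a * f x + b * g x))"
    by (auto simp: indicator_def)
  ultimately show ?thesis by (simp add: cls_def)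
qed

lemma cls_cmul: "L2 l f \<Longrightarrow> cls l (\<lambda>x. a * f x) = cmul a (cls l f)"
proof -
  assume f: "L2 l f"
  then have "sqint (\<lambda>x. indicator {0..l} x *\<^sub>R f x)" by (simp add: L2_iff_sqint)
  then have "cmul a (cls l f) = abs_lsq (\<lambda>x. a * (indicator {0..l} x *\<^sub>R f x))"
    unfolding cls_def by (rule cmul_abs)
  then show ?thesis by (simp add: cls_def mult_scaleR_right)
qed

lemma cls_diff: "L2 l f \<Longrightarrow> L2 l g \<Longrightarrow> cls l (\<lambda>x. f x - g x) = cls l f - cls l g"
proof -
  assume "L2 l f" "L2 l g"
  then have s: "sqint (\<lambda>x. indicator {0..l} x *\<^sub>R f x)" "sqint (\<lambda>x. indicator {0..l} x *\<^sub>R g x)"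
    by (auto simp: L2_iff_sqint)
  show ?thesis unfolding cls_def minus_lsq_abs[OF s] by (simp add: scaleR_diff_right)
qed

lemma cinner_cls:
  assumes "L2 l f" "L2 l g"
  shows "cinner (cls l f) (cls l g) = ip l f g"
proof -
  have "cinner (cls l f) (cls l g)
      = (LINT x|lebesgue. indicator {0..l} x *\<^sub>R f x * cnj (indicator {0..l} x *\<^sub>R g x))"
    using assms unfolding cls_def L2_iff_sqint by (intro cinner.abs_eq) auto
  also have "\<dots> = ip l f g"
    unfolding ip_def set_lebesgue_integral_def
    by (intro Bochner_Integration.integral_cong) (auto simp: indicator_def)
  finally show ?thesis .
qed

lemma inner_cls: "L2 l f \<Longrightarrow> L2 l g \<Longrightarrow> inner (cls l f) (cls l g) = Re (ip l f g)"
  by (simp add: inner_lsq_def cinner_cls)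

lemma norm_cls:
  assumes "L2 l f"
  shows "(norm (cls l f))\<^sup>2 = nrm2 l f"
proof -
  have "(norm (cls l f))\<^sup>2 = (LINT x|lebesgue. (cmod (indicator {0..l} x *\<^sub>R f x))\<^sup>2)"
    using assms unfolding cls_def L2_iff_sqint by (rule power2_norm_lsq_abs)
  also have "\<dots> = nrm2 l f"
    unfolding nrm2_def set_lebesgue_integral_def
    by (intro Bochner_Integration.integral_cong) (auto simp: indicator_def)
  finally show ?thesis .
qed

lemma norm_cmul: "norm (cmul c f) = cmod c * norm f"
proof -
  have "cinner (cmul c f) (cmul c f) = c * cnj c * cinner f f"
    by (simp add: cinner_cmul_left) (metis cinner_cmul_left cinner_commute complex_cnj_mult mult.assoc mult.commute)
  then have "Re (cinner (cmul c f) (cmul c f)) = (cmod c)\<^sup>2 * Re (cinner f f)"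
    by (simp add: complex_norm_square[symmetric])
  then show ?thesis by (simp add: norm_eq_sqrt_inner inner_lsq_def real_sqrt_mult)
qed

text \<open>Multiplication by a suitable unimodular \<open>c\<close> rotates
  \<open>cinner f g\<close> onto the nonnegative reals, where the real Cauchy--Schwarz inequality
  applies.\<close>

lemma norm_cinner_le: "cmod (cinner f g) \<le> norm f * norm g"
proof (cases "cinner f g = 0")
  case False
  define c where "c = cnj (cinner f g) / of_real (cmod (cinner f g))"
  have "cmod c = 1" using False by (simp add: c_def norm_divide)
  have "c * cinner f g = of_real (cmod (cinner f g))"
    using False by (simp add: c_def complex_norm_square[symmetric] mult.commute power2_eq_square)
  then have "cmod (cinner f g) = inner (cmul c f) g"
    by (simp add: inner_lsq_def cinner_cmul_left)
  also have "\<dots> \<le> norm (cmul c f) * norm g" by (rule norm_cauchy_schwarz)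
  finally show ?thesis by (simp add: norm_cmul \<open>cmod c = 1\<close>)
qed simp

lemma L2_integrable:
  assumes "L2 l f" "{a..b} \<subseteq> {0..l}"
  shows "set_integrable lebesgue {a..b} f"
proof -
  have one: "L2 l (\<lambda>x. 1)" by (rule L2_continuous) (rule continuous_on_const)
  have "integrable lebesgue (\<lambda>x. indicator {0..l} x *\<^sub>R f x * cnj (indicator {0..l} x *\<^sub>R 1))"
    using assms(1) one unfolding L2_iff_sqint by (rule sqint_mult_integrable)
  moreover have "indicator {0..l} x *\<^sub>R f x * cnj (indicator {0..l} x *\<^sub>R 1) = indicator {0..l} x *\<^sub>R f x" for x
    by (simp add: indicator_def)
  ultimately have "set_integrable lebesgue {0..l} f" by (simp only: set_integrable_def)
  then show ?thesis by (rule set_integrable_subset) (use assms in auto)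
qed

lemma L2_integrable_on: "L2 l f \<Longrightarrow> {a..b} \<subseteq> {0..l} \<Longrightarrow> f integrable_on {a..b}"
  and L2_integral: "L2 l f \<Longrightarrow> {a..b} \<subseteq> {0..l} \<Longrightarrow> (LINT x:{a..b}|lebesgue. f x) = integral {a..b} f"
  using set_lebesgue_integral_eq_integral[OF L2_integrable] by auto

lemma L2_mult_integrable:
  assumes "L2 l f" "L2 l g"
  shows "set_integrable lebesgue {0..l} (\<lambda>x. f x * g x)"
proof -
  have "integrable lebesgue (\<lambda>x. indicator {0..l} x *\<^sub>R f x * cnj (indicator {0..l} x *\<^sub>R cnj (g x)))"
    using assms(1) L2_cnj[OF assms(2)] unfolding L2_iff_sqint by (rule sqint_mult_integrable)
  moreover have "indicator {0..l} x *\<^sub>R f x * cnj (indicator {0..l} x *\<^sub>R cnj (g x)) = indicator {0..l} x *\<^sub>R (f x * g x)" for x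
    by (simp add: indicator_def)
  ultimately show ?thesis by (simp only: set_integrable_def)
qed

lemma integral_aeq:
  assumes "aeq l f g" "{a..b} \<subseteq> {0..l}"
  shows "integral {a..b} f = integral {a..b} g"
proof -
  obtain N where N: "N \<in> null_sets lebesgue" "{x. \<not> (x \<in> {0..l} \<longrightarrow> f x = g x)} \<subseteq> N"
    using assms(1) unfolding aeq_def eventually_ae_filter by auto
  then have "negligible N" by (simp add: negligible_iff_null_sets)
  moreover have "g x = f x" if "x \<in> {a..b} - N" for x
    using N(2) that assms(2) by (metis (mono_tags, lifting) DiffD1 DiffD2 mem_Collect_eq subset_iff)
  ultimately show ?thesis by (rule integral_spike)
qed

text \<open>Cauchy--Schwarz against the indicator of \<open>{a..b}\<close>. For primitives this is
  Hoelder continuity with exponent \<open>1/2\<close>, the source of compactness later on.\<close>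

lemma norm_integral_L2_le:
  assumes f: "L2 l f" and ab: "0 \<le> a" "a \<le> b" "b \<le> l"
  shows "cmod (integral {a..b} f) \<le> sqrt (b - a) * norm (cls l f)"
proof -
  define e :: "real \<Rightarrow> complex" where "e = indicator {a..b}"
  have e: "(cmod (e x))\<^sup>2 = indicator {a..b} x" for x by (simp add: e_def indicator_def)
  have "(\<lambda>x. indicator {0..l} x *\<^sub>R e x) = indicator {a..b}"
    "(\<lambda>x. indicator {0..l} x *\<^sub>R (cmod (e x))\<^sup>2) = indicator {a..b}"
    using ab by (auto simp: e_def indicator_def)
  then have L2e: "L2 l e"
    unfolding L2_def set_borel_measurable_def set_integrable_def
    using lmeasurable_interval(1)[of a b] by (auto simp: fmeasurable_def intro!: borel_measurable_indicator)
  have "nrm2 l e = (LINT x|lebesgue. indicator {a..b} x)"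
    unfolding nrm2_def set_lebesgue_integral_def e
    using ab by (intro Bochner_Integration.integral_cong) (auto simp: indicator_def)
  also have "\<dots> = b - a" using ab by simp
  finally have "norm (cls l e) = sqrt (b - a)"
    using norm_cls[OF L2e] by (metis norm_ge_zero real_sqrt_unique)
  moreover have "cinner (cls l f) (cls l e) = integral {a..b} f"
  proof -
    have "cinner (cls l f) (cls l e) = ip l f e" by (rule cinner_cls[OF f L2e])
    also have "\<dots> = (LINT x:{a..b}|lebesgue. f x)"
      unfolding ip_def set_lebesgue_integral_def e_def
      using ab by (intro Bochner_Integration.integral_cong) (auto simp: indicator_def)
    finally show ?thesis using L2_integral[OF f] ab by simp
  qed
  ultimately show ?thesis using norm_cinner_le[of "cls l f" "cls l e"] by (simp add: mult.commute)
qed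

lemma sup_bound_cls:
  assumes f: "continuous_on {0..l} f" and l: "l > 0" and b: "\<And>x. x \<in> {0..l} \<Longrightarrow> cmod (f x) \<le> M" and M: "M \<ge> 0"
  shows "norm (cls l f) \<le> sqrt l * M"
proof -
  have L: "L2 l f" by (rule L2_continuous[OF f])
  have "nrm2 l f \<le> (LINT x:{0..l}|lebesgue. M\<^sup>2)"
    unfolding nrm2_def using L
    by (intro set_integral_mono absolutely_integrable_continuous_real[of _ _ "\<lambda>x. M\<^sup>2"] continuous_on_const)
      (auto simp: L2_def intro!: power_mono b)
  also have "\<dots> = l * M\<^sup>2" using l by (simp add: set_lebesgue_integral_def)
  finally have "(norm (cls l f))\<^sup>2 \<le> (sqrt l * M)\<^sup>2"
    using l by (simp add: norm_cls[OF L] power_mult_distrib)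
  then show ?thesis by (rule power2_le_imp_le) (use l M in auto)
qed

lemma Dw_cong:
  assumes "\<And>x. x \<in> {0..l} \<Longrightarrow> f x = g x" "x \<in> {0..l}"
  shows "Dw l f x = Dw l g x"
proof -
  have "(f has_vector_derivative d) (at x within {0..l}) \<longleftrightarrow> (g has_vector_derivative d) (at x within {0..l})" for d
    using has_vector_derivative_transform[OF assms(2), of f g d]
      has_vector_derivative_transform[OF assms(2), of g f d] assms(1) by metis
  then show ?thesis by (simp add: Dw_def vector_derivative_def)
qed

lemma Dw_eqI:
  assumes "l > 0" "x \<in> {0..l}" "(f has_vector_derivative d) (at x within {0..l})"
  shows "Dw l f x = d"
  using vector_derivative_within_cbox[of 0 l x f d] assms by (simp add: Dw_def)

section \<open>Absolutely continuous functions with square integrable derivative\<close>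

text \<open>Derivatives are known only almost everywhere, so a relation that accepts any
  representative \<open>g\<close> is easier to establish than a statement about \<open>Dw\<close>.
  For square integrable \<open>g\<close> the integral agrees with the Lebesgue integral in
  \<open>H1\<close>.\<close>

definition prim :: "real \<Rightarrow> (real \<Rightarrow> complex) \<Rightarrow> (real \<Rightarrow> complex) \<Rightarrow> bool" where
  "prim l f g \<longleftrightarrow> L2 l g \<and> (\<forall>x\<in>{0..l}. f x = f 0 + integral {0..x} g)"

lemma H1_iff_prim: "H1 l f \<longleftrightarrow> (\<exists>g. prim l f g)"
  unfolding H1_def prim_def by (auto simp: L2_integral cong: conj_cong)

lemma primD: "prim l f g \<Longrightarrow> x \<in> {0..l} \<Longrightarrow> f x = f 0 + integral {0..x} g"
  and prim_L2: "prim l f g \<Longrightarrow> L2 l g"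
  unfolding prim_def by blast+

lemma prim_continuous: "prim l f g \<Longrightarrow> continuous_on {0..l} f"
proof -
  assume p: "prim l f g"
  then have "continuous_on {0..l} (\<lambda>x. f 0 + integral {0..x} g)"
    by (intro continuous_intros indefinite_integral_continuous_1) (auto simp: prim_def intro: L2_integrable_on)
  then show ?thesis by (rule continuous_on_eq) (rule primD[OF p, symmetric])
qed

text \<open>Lebesgue's differentiation theorem: the primitive has derivative \<open>g\<close>
  outside a null set, and the value of \<open>Dw\<close> on that set does not matter.\<close>

lemma prim_Dw:
  assumes l: "l > 0" and p: "prim l f g"
  shows "aeq l (Dw l f) g"
proof -
  have g: "g integrable_on {0..l}" using p L2_integrable_on by (auto simp: prim_def)
  let ?N = "{x\<in>{0..l}. \<not> ((\<lambda>x. integral {0..x} g) has_vector_derivative g x) (at x within {0..l})}"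
  have "Dw l f x = g x" if "x \<in> {0..l}" "x \<notin> ?N" for x
  proof (rule Dw_eqI[OF l that(1)])
    have "((\<lambda>x. f 0 + integral {0..x} g) has_vector_derivative 0 + g x) (at x within {0..l})"
      using that by (intro derivative_intros) auto
    then show "(f has_vector_derivative g x) (at x within {0..l})"
      using has_vector_derivative_transform[OF that(1) primD[OF p]] by simp
  qed
  moreover have "?N \<in> null_sets lebesgue"
    using negligible_not_derivative_integral[OF g] by (simp add: negligible_iff_null_sets)
  ultimately show ?thesis unfolding aeq_def by (intro AE_I'[of ?N]) auto
qed

text \<open>Continuity of \<open>g\<close> gives the derivative at every point, endpoints included;
  boundary values of \<open>Dw\<close> rest on this.\<close>

lemma prim_Dw_continuous:
  assumes l: "l > 0" and p: "prim l f g" and g: "continuous_on {0..l} g" and x: "x \<in> {0..l}"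
  shows "Dw l f x = g x"
proof (rule Dw_eqI[OF l x])
  have "((\<lambda>x. f 0 + integral {0..x} g) has_vector_derivative 0 + g x) (at x within {0..l})"
    using g x by (intro derivative_intros integral_has_vector_derivative) auto
  then show "(f has_vector_derivative g x) (at x within {0..l})"
    using has_vector_derivative_transform[OF x primD[OF p]] by simp
qed

lemma prim_aeq: "prim l f g \<Longrightarrow> aeq l g h \<Longrightarrow> prim l f h"
  unfolding prim_def using L2_aeq[of l g h] integral_aeq[of l g h 0]
  by (metis atLeastAtMost_iff atLeastatMost_subset_iff order_refl)

lemma prim_cong: "prim l f g \<Longrightarrow> (\<And>x. x \<in> {0..l} \<Longrightarrow> f x = f' x) \<Longrightarrow> prim l f' g"
  unfolding prim_def by (metis atLeastAtMost_iff order.trans order_refl)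

lemma H1_prim: "l > 0 \<Longrightarrow> H1 l f \<Longrightarrow> prim l f (Dw l f)"
  using prim_aeq prim_Dw aeq_sym H1_iff_prim by metis

lemma prim_H1: "prim l f g \<Longrightarrow> H1 l f"
  using H1_iff_prim by blast

lemma prim_lin:
  assumes "prim l f f'" "prim l g g'"
  shows "prim l (\<lambda>x. a * f x + b * g x) (\<lambda>x. a * f' x + b * g' x)"
  unfolding prim_def
proof (intro conjI ballI)
  have L: "L2 l f'" "L2 l g'" using assms by (auto simp: prim_def)
  show "L2 l (\<lambda>x. a * f' x + b * g' x)" using L by (rule L2_lin)
  fix x assume x: "x \<in> {0..l}"
  have i: "f' integrable_on {0..x}" "g' integrable_on {0..x}" using L x by (auto intro: L2_integrable_on)
  have "integral {0..x} (\<lambda>x. a * f' x + b * g' x) = a * integral {0..x} f' + b * integral {0..x} g'"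
    using i by (subst integral_add) (auto intro: integrable_on_mult_right)
  moreover have "f x = f 0 + integral {0..x} f'" "g x = g 0 + integral {0..x} g'"
    using assms x unfolding prim_def by blast+
  ultimately show "a * f x + b * g x = a * f 0 + b * g 0 + integral {0..x} (\<lambda>x. a * f' x + b * g' x)"
    by (simp add: algebra_simps)
qed

lemma prim_cnj:
  assumes "prim l f g"
  shows "prim l (\<lambda>x. cnj (f x)) (\<lambda>x. cnj (g x))"
  unfolding prim_def
proof (intro conjI ballI)
  show "L2 l (\<lambda>x. cnj (g x))" using assms by (auto simp: prim_def intro: L2_cnj)
  fix x assume "x \<in> {0..l}"
  then have "cnj (f x) = cnj (f 0 + integral {0..x} g)" by (intro arg_cong[of _ _ cnj] primD[OF assms])
  then show "cnj (f x) = cnj (f 0) + integral {0..x} (\<lambda>x. cnj (g x))"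
    by (simp add: Henstock_Kurzweil_Integration.integral_cnj)
qed

lemma prim_integral: "L2 l g \<Longrightarrow> prim l (\<lambda>x. c + integral {0..x} g) g"
  by (simp add: prim_def)

lemma prim_diff_eq:
  assumes "prim l f g" "0 \<le> x" "x \<le> y" "y \<le> l"
  shows "f y - f x = integral {x..y} g"
proof -
  have "g integrable_on {0..y}" using assms by (auto simp: prim_def intro: L2_integrable_on)
  then have "integral {0..x} g + integral {x..y} g = integral {0..y} g"
    using assms by (intro Henstock_Kurzweil_Integration.integral_combine) auto
  moreover have "f x = f 0 + integral {0..x} g" "f y = f 0 + integral {0..y} g"
    using assms by (auto intro: primD[OF assms(1)])
  ultimately show ?thesis by (simp add: algebra_simps)
qed

lemma prim_mult_L2: "prim l f g \<Longrightarrow> L2 l f"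
  by (intro L2_continuous prim_continuous)

section \<open>Integration by parts\<close>

lemma sigma_finite_lebesgue: "sigma_finite_measure (lebesgue :: real measure)"
proof
  show "\<exists>A. countable A \<and> A \<subseteq> sets (lebesgue :: real measure) \<and> \<Union> A = space lebesgue \<and> (\<forall>a\<in>A. emeasure lebesgue a \<noteq> \<infinity>)"
  proof (intro exI[of _ "range (\<lambda>n::nat. {- real n..real n})"] conjI)
    show "\<Union> (range (\<lambda>n::nat. {- real n..real n})) = space (lebesgue :: real measure)"
    proof -
      have "\<exists>n::nat. - real n \<le> x \<and> x \<le> real n" for x :: real
        using real_arch_simple[of "\<bar>x\<bar>"] by (metis abs_le_iff minus_le_iff)
      then show ?thesis by auto
    qed
  qed auto
qed

text \<open>Fubini on the two triangles below and above the diagonal.\<close>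

lemma integral_mult_triangles:
  fixes f g :: "real \<Rightarrow> complex"
  assumes f: "integrable lebesgue f" and g: "integrable lebesgue g"
  shows "(LINT t|lebesgue. f t) * (LINT x|lebesgue. g x)
      = (LINT x|lebesgue. (LINT t|lebesgue. indicator {..x} t *\<^sub>R f t) * g x)
      + (LINT t|lebesgue. f t * (LINT x|lebesgue. indicator {..t} x *\<^sub>R g x))"
proof -
  interpret L: sigma_finite_measure "lebesgue :: real measure" by (rule sigma_finite_lebesgue)
  interpret P: pair_sigma_finite "lebesgue :: real measure" "lebesgue :: real measure" ..
  have [measurable]: "f \<in> borel_measurable lebesgue" "g \<in> borel_measurable lebesgue" using f g by auto
  have id[measurable]: "(\<lambda>x. x) \<in> lebesgue \<rightarrow>\<^sub>M (borel :: real measure)"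
    by (intro measurable_completion) simp
  define h where "h = (\<lambda>(t, x). f t * g x)"
  have h: "integrable (lebesgue \<Otimes>\<^sub>M lebesgue) h"
  proof (rule P.Fubini_integrable)
    show "h \<in> borel_measurable (lebesgue \<Otimes>\<^sub>M lebesgue)" unfolding h_def by measurable
    show "integrable lebesgue (\<lambda>x. LINT y|lebesgue. norm (h (x, y)))"
      using f g by (simp add: h_def norm_mult)
    show "AE x in lebesgue. integrable lebesgue (\<lambda>y. h (x, y))" using g by (simp add: h_def)
  qed
  define D where "D = {z :: real \<times> real. fst z \<le> snd z}"
  have D: "D \<in> sets (lebesgue \<Otimes>\<^sub>M lebesgue)"
  proof -
    have "D = {z \<in> space (lebesgue \<Otimes>\<^sub>M lebesgue). fst z \<le> snd z}" by (auto simp: D_def space_pair_measure)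
    also have "\<dots> \<in> sets (lebesgue \<Otimes>\<^sub>M lebesgue)"
      by (intro borel_measurable_le measurable_compose[OF measurable_fst id] measurable_compose[OF measurable_snd id])
    finally show ?thesis .
  qed
  have h1: "integrable (lebesgue \<Otimes>\<^sub>M lebesgue) (\<lambda>z. indicator D z *\<^sub>R h z)"
    using integrable_mult_indicator[OF D h] .
  have h2: "integrable (lebesgue \<Otimes>\<^sub>M lebesgue) (\<lambda>z. indicator (- D) z *\<^sub>R h z)"
    using integrable_mult_indicator[OF _ h, of "- D"] sets.compl_sets[OF D] by (simp add: space_pair_measure Compl_eq_Diff_UNIV)
  have "(LINT t|lebesgue. f t) * (LINT x|lebesgue. g x) = (LINT t|lebesgue. LINT x|lebesgue. h (t, x))"
    by (simp add: h_def)
  also have "\<dots> = (LINT z|(lebesgue \<Otimes>\<^sub>M lebesgue). h z)" by (rule P.integral_fst'[OF h])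
  also have "\<dots> = (LINT z|(lebesgue \<Otimes>\<^sub>M lebesgue). indicator D z *\<^sub>R h z + indicator (- D) z *\<^sub>R h z)"
    by (intro Bochner_Integration.integral_cong) (auto simp: indicator_def)
  also have "\<dots> = (LINT z|(lebesgue \<Otimes>\<^sub>M lebesgue). indicator D z *\<^sub>R h z) + (LINT z|(lebesgue \<Otimes>\<^sub>M lebesgue). indicator (- D) z *\<^sub>R h z)"
    by (rule Bochner_Integration.integral_add[OF h1 h2])
  also have "(LINT z|(lebesgue \<Otimes>\<^sub>M lebesgue). indicator D z *\<^sub>R h z)
      = (LINT x|lebesgue. LINT t|lebesgue. indicator D (t, x) *\<^sub>R h (t, x))"
    using P.integral_snd[of "\<lambda>t x. indicator D (t, x) *\<^sub>R h (t, x)"] h1 by (simp add: case_prod_unfold)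
  also have "\<dots> = (LINT x|lebesgue. (LINT t|lebesgue. indicator {..x} t *\<^sub>R f t) * g x)"
  proof (intro Bochner_Integration.integral_cong refl)
    fix x
    have "(LINT t|lebesgue. indicator D (t, x) *\<^sub>R h (t, x)) = (LINT t|lebesgue. indicator {..x} t *\<^sub>R f t * g x)"
      by (intro Bochner_Integration.integral_cong) (auto simp: h_def D_def indicator_def)
    then show "(LINT t|lebesgue. indicator D (t, x) *\<^sub>R h (t, x)) = (LINT t|lebesgue. indicator {..x} t *\<^sub>R f t) * g x"
      by (simp only: integral_mult_left_zero)
  qed
  also have "(LINT z|(lebesgue \<Otimes>\<^sub>M lebesgue). indicator (- D) z *\<^sub>R h z)
      = (LINT t|lebesgue. LINT x|lebesgue. indicator (- D) (t, x) *\<^sub>R h (t, x))"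
    using P.integral_fst'[OF h2] by simp
  also have "\<dots> = (LINT t|lebesgue. f t * (LINT x|lebesgue. indicator {..t} x *\<^sub>R g x))"
  proof (intro Bochner_Integration.integral_cong refl)
    fix t
    have "(LINT x|lebesgue. indicator (- D) (t, x) *\<^sub>R h (t, x)) = (LINT x|lebesgue. f t * (indicator {..t} x *\<^sub>R g x))"
    proof (rule integral_cong_AE)
      \<comment> \<open>The complement of \<open>D\<close> is the strict triangle, whereas the claim
        uses the closed one; each slice differs in the single point \<open>x = t\<close>.\<close>
      have "AE x in lebesgue. x \<noteq> t" by (rule AE_completion) (rule AE_lborel_singleton)
      then show "AE x in lebesgue. indicator (- D) (t, x) *\<^sub>R h (t, x) = f t * (indicator {..t} x *\<^sub>R g x)"
        by eventually_elim (auto simp: h_def D_def indicator_def)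
      show "(\<lambda>x. indicator (- D) (t, x) *\<^sub>R h (t, x)) \<in> borel_measurable lebesgue"
      proof -
        have "(\<lambda>x. indicator (- D) (t, x) *\<^sub>R h (t, x)) = (\<lambda>x. indicator {..<t} x *\<^sub>R (f t * g x))"
          by (auto simp: h_def D_def indicator_def)
        then show ?thesis by (auto intro!: borel_measurable_scaleR borel_measurable_indicator)
      qed
      show "(\<lambda>x. f t * (indicator {..t} x *\<^sub>R g x)) \<in> borel_measurable lebesgue"
        by (auto intro!: borel_measurable_times borel_measurable_scaleR borel_measurable_indicator)
    qed
    then show "(LINT x|lebesgue. indicator (- D) (t, x) *\<^sub>R h (t, x)) = f t * (LINT x|lebesgue. indicator {..t} x *\<^sub>R g x)"
      by (simp only: integral_mult_right_zero)
  qed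
  finally show ?thesis .
qed

text \<open>The product of the integrals of \<open>f\<close> and \<open>g\<close> over
  \<open>{0..l}\<close> is split along the diagonal, and the inner integrals are
  \<open>F x - F 0\<close> and \<open>G x - G 0\<close>. This avoids a product rule, as
  \<open>F\<close> and \<open>G\<close> are differentiable only almost everywhere.\<close>

lemma prim_integration_by_parts:
  assumes l: "l > 0" and F: "prim l F f" and G: "prim l G g"
  shows "(LINT x:{0..l}|lebesgue. f x * G x) + (LINT x:{0..l}|lebesgue. F x * g x) = F l * G l - F 0 * G 0"
proof -
  have L: "L2 l f" "L2 l g" using F G by (auto simp: prim_def)
  have pF: "F x - F 0 = integral {0..x} f" and pG: "G x - G 0 = integral {0..x} g" if "x \<in> {0..l}" for x
  proof -
    have "F x = F 0 + integral {0..x} f" "G x = G 0 + integral {0..x} g" using F G that unfolding prim_def by blast+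
    then show "F x - F 0 = integral {0..x} f" "G x - G 0 = integral {0..x} g" by simp_all
  qed
  let ?f = "\<lambda>x. indicator {0..l} x *\<^sub>R f x" and ?g = "\<lambda>x. indicator {0..l} x *\<^sub>R g x"
  have i: "integrable lebesgue ?f" "integrable lebesgue ?g"
    using L2_integrable[OF L(1), of 0 l] L2_integrable[OF L(2), of 0 l] by (auto simp: set_integrable_def)
  have tri: "(LINT t|lebesgue. indicator {..x} t *\<^sub>R (indicator {0..l} t *\<^sub>R h t)) = integral {0..x} h"
    if "x \<in> {0..l}" "L2 l h" for x and h :: "real \<Rightarrow> complex"
  proof -
    have "(LINT t|lebesgue. indicator {..x} t *\<^sub>R (indicator {0..l} t *\<^sub>R h t)) = (LINT t:{0..x}|lebesgue. h t)"
      unfolding set_lebesgue_integral_def using that(1)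
      by (intro Bochner_Integration.integral_cong) (auto simp: indicator_def)
    then show ?thesis using L2_integral[OF that(2), of 0 x] that(1) by simp
  qed
  have Fc: "L2 l F" "L2 l G" using F G by (auto intro: prim_mult_L2)
  have 1: "(LINT x|lebesgue. (LINT t|lebesgue. indicator {..x} t *\<^sub>R ?f t) * ?g x)
      = (LINT x:{0..l}|lebesgue. F x * g x) - F 0 * integral {0..l} g"
  proof -
    have "(LINT x|lebesgue. (LINT t|lebesgue. indicator {..x} t *\<^sub>R ?f t) * ?g x) = (LINT x:{0..l}|lebesgue. F x * g x - F 0 * g x)"
      unfolding set_lebesgue_integral_def
    proof (intro Bochner_Integration.integral_cong refl)
      fix x
      show "(LINT t|lebesgue. indicator {..x} t *\<^sub>R ?f t) * ?g x = indicator {0..l} x *\<^sub>R (F x * g x - F 0 * g x)"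
      proof (cases "x \<in> {0..l}")
        case True
        have "(LINT t|lebesgue. indicator {..x} t *\<^sub>R ?f t) = F x - F 0"
          using tri[OF True L(1)] pF[OF True] by (rule trans[OF _ sym])
        then show ?thesis using True by (simp only: indicator_simps scaleR_one) (simp add: algebra_simps)
      qed simp
    qed
    also have "\<dots> = (LINT x:{0..l}|lebesgue. F x * g x) - (LINT x:{0..l}|lebesgue. F 0 * g x)"
      using L Fc by (intro set_integral_diff L2_mult_integrable L2_const)
    finally show ?thesis using L2_integral[OF L(2), of 0 l] by simp
  qed
  have 2: "(LINT t|lebesgue. ?f t * (LINT x|lebesgue. indicator {..t} x *\<^sub>R ?g x))
      = (LINT x:{0..l}|lebesgue. f x * G x) - integral {0..l} f * G 0"
  proof -
    have "(LINT t|lebesgue. ?f t * (LINT x|lebesgue. indicator {..t} x *\<^sub>R ?g x)) = (LINT x:{0..l}|lebesgue. f x * G x - f x * G 0)"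
      unfolding set_lebesgue_integral_def
    proof (intro Bochner_Integration.integral_cong refl)
      fix x
      show "?f x * (LINT t|lebesgue. indicator {..x} t *\<^sub>R ?g t) = indicator {0..l} x *\<^sub>R (f x * G x - f x * G 0)"
      proof (cases "x \<in> {0..l}")
        case True
        have "(LINT t|lebesgue. indicator {..x} t *\<^sub>R ?g t) = G x - G 0"
          using tri[OF True L(2)] pG[OF True] by (rule trans[OF _ sym])
        then show ?thesis using True by (simp only: indicator_simps scaleR_one) (simp add: algebra_simps)
      qed simp
    qed
    also have "\<dots> = (LINT x:{0..l}|lebesgue. f x * G x) - (LINT x:{0..l}|lebesgue. f x * G 0)"
      using L Fc by (intro set_integral_diff L2_mult_integrable L2_const)
    finally show ?thesis using L2_integral[OF L(1), of 0 l] by simp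
  qed
  have 3: "(LINT t|lebesgue. ?f t) = integral {0..l} f" "(LINT t|lebesgue. ?g t) = integral {0..l} g"
    using L2_integral[OF L(1), of 0 l] L2_integral[OF L(2), of 0 l] by (auto simp: set_lebesgue_integral_def)
  have "integral {0..l} f * integral {0..l} g = (LINT x:{0..l}|lebesgue. F x * g x) - F 0 * integral {0..l} g
      + ((LINT x:{0..l}|lebesgue. f x * G x) - integral {0..l} f * G 0)"
    using integral_mult_triangles[OF i] unfolding 1 2 3 .
  moreover have "integral {0..l} f = F l - F 0" "integral {0..l} g = G l - G 0"
    using pF[of l] pG[of l] l by simp_all
  ultimately show ?thesis by (simp add: algebra_simps)
qed

lemma ip_integration_by_parts:
  assumes l: "l > 0" and F: "prim l F f" and G: "prim l G g"
  shows "ip l f G + ip l F g = F l * cnj (G l) - F 0 * cnj (G 0)"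
  using prim_integration_by_parts[OF l F prim_cnj[OF G]] by (simp add: ip_def)

section \<open>Sobolev spaces as chains of primitives\<close>

lemma Hk_1_iff: "l > 0 \<Longrightarrow> Hk 1 l f \<longleftrightarrow> prim l f (Dw l f)"
  using H1_prim[of l f] prim_H1[of l f] prim_L2 by auto

lemma Hk_2_iff: "l > 0 \<Longrightarrow> Hk 2 l f \<longleftrightarrow> prim l f (Dw l f) \<and> prim l (Dw l f) (Dw l (Dw l f))"
  using Hk_1_iff[of l "Dw l f"] H1_prim[of l f] prim_H1[of l f] by (auto simp: numeral_2_eq_2)

lemma Hk_4_iff: "l > 0 \<Longrightarrow> Hk 4 l f \<longleftrightarrow> prim l f (Dw l f) \<and> prim l (Dw l f) (Dw l (Dw l f))
    \<and> prim l (Dw l (Dw l f)) (Dw l (Dw l (Dw l f)))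
    \<and> prim l (Dw l (Dw l (Dw l f))) (Dw l (Dw l (Dw l (Dw l f))))"
proof -
  assume l: "l > 0"
  have "Hk 4 l f \<longleftrightarrow> H1 l f \<and> H1 l (Dw l f) \<and> Hk 2 l (Dw l (Dw l f))"
    by (simp add: numeral_eq_Suc)
  then show ?thesis
    using Hk_2_iff[OF l, of "Dw l (Dw l f)"] H1_prim[OF l] prim_H1 by blast
qed

lemma prim_Dw_pt:
  assumes "l > 0" "prim l f f1" "prim l f1 f2" "x \<in> {0..l}"
  shows "Dw l f x = f1 x"
  using prim_Dw_continuous[OF assms(1,2) prim_continuous[OF assms(3)] assms(4)] .

lemma prim_self: "l > 0 \<Longrightarrow> prim l f g \<Longrightarrow> prim l f (Dw l f)"
  by (rule H1_prim) (auto dest: prim_H1)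

text \<open>The lower derivative is continuous and agrees with \<open>Dw\<close> pointwise, the top
  one only almost everywhere. This translates explicit chains of primitives into statements about
  \<open>Dw\<close>.\<close>

lemma prim_chain2:
  assumes l: "l > 0" and f: "prim l f f1" "prim l f1 f2"
  shows "prim l f (Dw l f)" "\<And>x. x \<in> {0..l} \<Longrightarrow> Dw l f x = f1 x"
    "prim l (Dw l f) (Dw l (Dw l f))" "aeq l (Dw l (Dw l f)) f2"
proof -
  show "prim l f (Dw l f)" by (rule prim_self[OF l f(1)])
  show *: "Dw l f x = f1 x" if "x \<in> {0..l}" for x by (rule prim_Dw_pt[OF l f that])
  have "prim l (Dw l f) f2" by (rule prim_cong[OF f(2)]) (simp add: *)
  then show "prim l (Dw l f) (Dw l (Dw l f))" "aeq l (Dw l (Dw l f)) f2"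
    using prim_self[OF l] prim_Dw[OF l] by blast+
qed

lemma prim_chain4:
  assumes l: "l > 0" and f: "prim l f f1" "prim l f1 f2" "prim l f2 f3" "prim l f3 f4"
  shows "prim l f (Dw l f)" "\<And>x. x \<in> {0..l} \<Longrightarrow> Dw l f x = f1 x"
    "prim l (Dw l f) (Dw l (Dw l f))" "\<And>x. x \<in> {0..l} \<Longrightarrow> Dw l (Dw l f) x = f2 x"
    "prim l (Dw l (Dw l f)) (Dw l (Dw l (Dw l f)))" "\<And>x. x \<in> {0..l} \<Longrightarrow> Dw l (Dw l (Dw l f)) x = f3 x"
    "prim l (Dw l (Dw l (Dw l f))) (Dw l (Dw l (Dw l (Dw l f))))" "aeq l (Dw l (Dw l (Dw l (Dw l f)))) f4"
proof -
  note c = prim_chain2[OF l f(1,2)] prim_chain2[OF l f(2,3)] prim_chain2[OF l f(3,4)]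
  show "prim l f (Dw l f)" "\<And>x. x \<in> {0..l} \<Longrightarrow> Dw l f x = f1 x" "prim l (Dw l f) (Dw l (Dw l f))" by fact+
  show 2: "Dw l (Dw l f) x = f2 x" if "x \<in> {0..l}" for x
    using Dw_cong[of l "Dw l f" f1 x] c that by simp
  have "prim l (Dw l (Dw l f)) f3" by (rule prim_cong[OF f(3)]) (simp add: 2)
  note d = prim_chain2[OF l this f(4)]
  show "prim l (Dw l (Dw l f)) (Dw l (Dw l (Dw l f)))" "\<And>x. x \<in> {0..l} \<Longrightarrow> Dw l (Dw l (Dw l f)) x = f3 x"
    "prim l (Dw l (Dw l (Dw l f))) (Dw l (Dw l (Dw l (Dw l f))))" "aeq l (Dw l (Dw l (Dw l (Dw l f)))) f4"
    by fact+
qed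

lemma prim_FTC:
  assumes "\<And>x. x \<in> {0..l} \<Longrightarrow> (f has_vector_derivative g x) (at x within {0..l})" "continuous_on {0..l} g"
  shows "prim l f g"
  unfolding prim_def
proof (intro conjI ballI)
  show "L2 l g" using assms(2) by (rule L2_continuous)
  fix x assume x: "x \<in> {0..l}"
  have "(g has_integral f x - f 0) {0..x}"
    using x by (intro fundamental_theorem_of_calculus has_vector_derivative_within_subset[OF assms(1)]) auto
  then show "f x = f 0 + integral {0..x} g" by (simp add: integral_unique)
qed

lemma prim_has_vector_derivative:
  assumes "prim l f g" "continuous_on {0..l} g" "x \<in> {0..l}"
  shows "(f has_vector_derivative g x) (at x within {0..l})"
proof -
  have "((\<lambda>x. f 0 + integral {0..x} g) has_vector_derivative 0 + g x) (at x within {0..l})"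
    using assms by (intro derivative_intros integral_has_vector_derivative) auto
  then show ?thesis using has_vector_derivative_transform[OF assms(3) primD[OF assms(1)]] by simp
qed

lemma aeq_zero_continuous:
  assumes "aeq l f (\<lambda>x. 0)" "continuous_on {0..l} f" "l > 0" "x \<in> {0..l}"
  shows "f x = 0"
proof -
  have "(integral {0..l} (\<lambda>x. (cmod (f x))\<^sup>2)) = integral {0..l} (\<lambda>x. 0)"
  proof -
    obtain N where N: "N \<in> null_sets lebesgue" "{x. \<not> (x \<in> {0..l} \<longrightarrow> f x = 0)} \<subseteq> N"
      using assms(1) unfolding aeq_def eventually_ae_filter by auto
    then have "negligible N" by (simp add: negligible_iff_null_sets)
    moreover have "0 = (cmod (f x))\<^sup>2" if "x \<in> {0..l} - N" for x using N(2) that by auto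
    ultimately show ?thesis by (rule integral_spike)
  qed
  then have "integral {0..l} (\<lambda>x. (cmod (f x))\<^sup>2) = 0" by simp
  moreover have "continuous_on {0..l} (\<lambda>x. (cmod (f x))\<^sup>2)" by (intro continuous_intros assms)
  ultimately have "\<forall>x\<in>{0..l}. (cmod (f x))\<^sup>2 = 0"
    using assms(3) by (subst (asm) integral_eq_0_iff) auto
  then show ?thesis using assms(4) by auto
qed

lemma Dw_zero: "l > 0 \<Longrightarrow> (\<And>x. x \<in> {0..l} \<Longrightarrow> f x = 0) \<Longrightarrow> x \<in> {0..l} \<Longrightarrow> Dw l f x = 0"
  using Dw_cong[of l f "\<lambda>x. 0" x] Dw_eqI[of l x "\<lambda>x. 0" 0] by simp

lemma prim_bound_zero:
  assumes f: "prim l f g" and z: "z \<in> {0..l}" "f z = 0" and x: "x \<in> {0..l}"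
  shows "cmod (f x) \<le> sqrt l * norm (cls l g)"
proof -
  have *: "cmod (f y - f x) \<le> sqrt l * norm (cls l g)" if "0 \<le> x" "x \<le> y" "y \<le> l" for x y
  proof -
    have "cmod (f y - f x) \<le> sqrt (y - x) * norm (cls l g)"
      unfolding prim_diff_eq[OF f that] by (rule norm_integral_L2_le[OF prim_L2[OF f] that])
    also have "\<dots> \<le> sqrt l * norm (cls l g)" using that by (intro mult_right_mono) auto
    finally show ?thesis .
  qed
  show ?thesis using *[of x z] *[of z x] x z by (cases "x \<le> z") auto
qed

lemma prim_diff_bound:
  assumes f: "prim l f g" and x: "x \<in> {0..l}" and y: "y \<in> {0..l}"
  shows "cmod (f y - f x) \<le> sqrt \<bar>y - x\<bar> * norm (cls l g)"
proof -
  have *: "cmod (f y - f x) \<le> sqrt (y - x) * norm (cls l g)" if "0 \<le> x" "x \<le> y" "y \<le> l" for x y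
    unfolding prim_diff_eq[OF f that] by (rule norm_integral_L2_le[OF prim_L2[OF f] that])
  show ?thesis using *[of x y] *[of y x] x y by (cases "x \<le> y") (auto simp: norm_minus_commute)
qed

text \<open>The value at \<open>x\<close> differs from the mean by at most the oscillation; this
  serves functions with no prescribed zero, where \<open>prim_bound_zero\<close> does not
  apply.\<close>

lemma prim_mean_bound:
  assumes l: "l > 0" and f: "prim l f g" and x: "x \<in> {0..l}"
  shows "cmod (f x) \<le> cmod (integral {0..l} f) / l + sqrt l * norm (cls l g)"
proof -
  have c: "continuous_on {0..l} f" by (rule prim_continuous[OF f])
  have "integral {0..l} (\<lambda>y. f x - f y) = of_real l * f x - integral {0..l} f"
    using l by (subst integral_diff) (auto intro: integrable_continuous_interval c simp: scaleR_conv_of_real)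
  moreover have "cmod (integral {0..l} (\<lambda>y. f x - f y)) \<le> sqrt l * norm (cls l g) * (l - 0)"
  proof (rule integral_bound)
    show "cmod (f x - f y) \<le> sqrt l * norm (cls l g)" if y: "y \<in> {0..l}" for y
    proof -
      have "cmod (f x - f y) \<le> sqrt \<bar>x - y\<bar> * norm (cls l g)" by (rule prim_diff_bound[OF f y x])
      also have "\<dots> \<le> sqrt l * norm (cls l g)" using x y by (intro mult_right_mono) auto
      finally show ?thesis .
    qed
  qed (use l in \<open>auto intro!: continuous_intros c\<close>)
  ultimately have "cmod (of_real l * f x - integral {0..l} f) \<le> sqrt l * norm (cls l g) * l" by simp
  moreover have "cmod (of_real l * f x) \<le> cmod (of_real l * f x - integral {0..l} f) + cmod (integral {0..l} f)"
    using norm_triangle_ineq[of "of_real l * f x - integral {0..l} f" "integral {0..l} f"] by simp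
  moreover have "cmod (of_real l * f x) = l * cmod (f x)" using l by (simp add: norm_mult)
  ultimately have "l * cmod (f x) \<le> cmod (integral {0..l} f) + sqrt l * norm (cls l g) * l" by linarith
  then have "cmod (f x) \<le> (cmod (integral {0..l} f) + sqrt l * norm (cls l g) * l) / l"
    using l by (simp add: le_divide_eq mult.commute)
  also have "\<dots> = cmod (integral {0..l} f) / l + sqrt l * norm (cls l g)"
    using l by (simp add: add_divide_distrib)
  finally show ?thesis .
qed

lemma inner_integration_by_parts:
  assumes l: "l > 0" and F: "prim l F f" and G: "prim l G g"
  shows "inner (cls l f) (cls l G) + inner (cls l F) (cls l g) = Re (F l * cnj (G l)) - Re (F 0 * cnj (G 0))"
proof -
  have "inner (cls l f) (cls l G) + inner (cls l F) (cls l g) = Re (ip l f G + ip l F g)"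
    using prim_L2[OF F] prim_L2[OF G] prim_mult_L2[OF F] prim_mult_L2[OF G] by (simp add: inner_cls)
  then show ?thesis using ip_integration_by_parts[OF l F G] by simp
qed

lemma cls_scaleR: "L2 l f \<Longrightarrow> cls l (\<lambda>x. of_real r * f x) = r *\<^sub>R cls l f"
  by (simp add: cls_cmul scaleR_lsq_def)

lemma cls_zero: "aeq l f (\<lambda>x. 0) \<Longrightarrow> L2 l f \<Longrightarrow> cls l f = 0"
proof -
  assume f: "aeq l f (\<lambda>x. 0)" "L2 l f"
  have "cls l f = cls l (\<lambda>x. 0)" using f by (simp add: cls_eq_iff L2_zero)
  also have "\<dots> = cls l (\<lambda>x. 0 * f x)" by simp
  also have "\<dots> = 0" using f by (simp only: cls_cmul) (metis cls_scaleR cls_cmul of_real_0 scaleR_zero_left)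
  finally show ?thesis .
qed

lemma cls_zero_iff: "L2 l f \<Longrightarrow> cls l f = 0 \<longleftrightarrow> aeq l f (\<lambda>x. 0)"
  using cls_zero[of l f] cls_zero[OF aeq_refl L2_zero, of l] cls_eq_iff[of l f "\<lambda>x. 0"] L2_zero by auto

text \<open>A limit in the whole-line space might have mass outside \<open>{0..l}\<close>. Cutting
  off a representative does not increase its distance to functions supported there, so the cut-off
  is also a limit and coincides with \<open>f\<close>.\<close>

lemma range_cls_closed:
  assumes g: "\<And>n. L2 l (g n)" and lim: "(\<lambda>n. cls l (g n)) \<longlonglongrightarrow> f"
  shows "\<exists>h. L2 l h \<and> f = cls l h"
proof -
  define h where "h = rep_lsq f"
  have h: "sqint h" "f = abs_lsq h" by (auto simp: h_def sqint_rep abs_rep_lsq)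
  have cut: "sqint (\<lambda>x. indicator {0..l} x *\<^sub>R \<phi> x)" if "sqint \<phi>" for \<phi>
  proof (rule sqint_dominated[OF _ that sqint_zero])
    show "(\<lambda>x. indicator {0..l} x *\<^sub>R \<phi> x) \<in> borel_measurable lebesgue"
      using that by (auto simp: sqint_def intro!: borel_measurable_scaleR borel_measurable_indicator)
  qed (auto simp: indicator_def)
  have L: "L2 l h" unfolding L2_iff_sqint by (rule cut[OF h(1)])
  have le: "norm (cls l h - cls l (g n)) \<le> norm (f - cls l (g n))" for n
  proof -
    let ?g = "\<lambda>x. indicator {0..l} x *\<^sub>R g n x"
    have s: "sqint ?g" using g[of n] by (simp add: L2_iff_sqint)
    have d: "sqint (\<lambda>x. h x - ?g x)" by (rule sqint_diff[OF h(1) s])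
    have "cls l h - cls l (g n) = abs_lsq (\<lambda>x. indicator {0..l} x *\<^sub>R (h x - ?g x))"
      unfolding cls_def minus_lsq_abs[OF cut[OF h(1)] s]
      by (intro arg_cong[of _ _ abs_lsq]) (auto simp: indicator_def)
    then have "(norm (cls l h - cls l (g n)))\<^sup>2 = (LINT x|lebesgue. (cmod (indicator {0..l} x *\<^sub>R (h x - ?g x)))\<^sup>2)"
      using power2_norm_lsq_abs[OF cut[OF d]] by simp
    also have "\<dots> \<le> (LINT x|lebesgue. (cmod (h x - ?g x))\<^sup>2)"
      using d cut[OF d] by (intro integral_mono) (auto simp: sqint_def indicator_def)
    also have "\<dots> = (norm (f - cls l (g n)))\<^sup>2"
      unfolding h(2) cls_def minus_lsq_abs[OF h(1) s] by (rule power2_norm_lsq_abs[OF d, symmetric])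
    finally show ?thesis by (rule power2_le_imp_le) simp
  qed
  have "(\<lambda>n. cls l h - cls l (g n)) \<longlonglongrightarrow> 0"
  proof (rule Lim_null_comparison)
    show "\<forall>\<^sub>F n in sequentially. norm (cls l h - cls l (g n)) \<le> norm (f - cls l (g n))"
      using le by (intro always_eventually allI)
    show "(\<lambda>n. norm (f - cls l (g n))) \<longlonglongrightarrow> 0"
      using tendsto_norm[OF tendsto_diff[OF tendsto_const lim], of f] by simp
  qed
  from tendsto_diff[OF tendsto_const this, of "cls l h"] have "(\<lambda>n. cls l (g n)) \<longlonglongrightarrow> cls l h" by simp
  then have "f = cls l h" using lim LIMSEQ_unique by blast
  then show ?thesis using L by blast
qed

text \<open>Factor \<open>D\<^sup>4 - \<nu>\<^sup>2 = (D\<^sup>2 - \<nu>) (D\<^sup>2 + \<nu>)\<close>: the function \<open>W = f'' + \<nu> f\<close> solves a coercive problem with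
  \<open>W' 0 = W l = 0\<close>, hence vanishes, and then \<open>f'' = - \<nu> f\<close> has zero Cauchy data at \<open>0\<close>.\<close>

lemma overdetermined_beam:
  assumes l: "l > 0" and \<nu>: "\<nu> > 0"
    and f: "prim l f f1" "prim l f1 f2" "prim l f2 f3" "prim l f3 f4"
    and bc: "f 0 = 0" "f1 0 = 0" "f3 0 = 0" "f l = 0" "f2 l = 0"
    and eq: "aeq l f4 (\<lambda>x. of_real (\<nu>\<^sup>2) * f x)"
    and x: "x \<in> {0..l}"
  shows "f x = 0" "f2 x = 0"
proof -
  define W W1 where "W = (\<lambda>x. 1 * f2 x + of_real \<nu> * f x)" and "W1 = (\<lambda>x. 1 * f3 x + of_real \<nu> * f1 x)"
  have W: "prim l W W1" unfolding W_def W1_def by (rule prim_lin[OF f(3,1)])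
  have "prim l W1 (\<lambda>x. 1 * f4 x + of_real \<nu> * f2 x)" unfolding W1_def by (rule prim_lin[OF f(4,2)])
  moreover have "aeq l (\<lambda>x. 1 * f4 x + of_real \<nu> * f2 x) (\<lambda>x. of_real \<nu> * W x)"
    using eq unfolding aeq_def
  proof eventually_elim
    case (elim x)
    then show ?case by (simp add: W_def algebra_simps power2_eq_square)
  qed
  ultimately have W1: "prim l W1 (\<lambda>x. of_real \<nu> * W x)" by (rule prim_aeq)
  have LW: "L2 l W" by (rule prim_mult_L2[OF W])
  \<comment> \<open>The boundary terms vanish: \<open>W l = 0\<close> because
    \<open>f l = f2 l = 0\<close>, and \<open>W1 0 = 0\<close> because
    \<open>f1 0 = f3 0 = 0\<close>. Both terms on the left are nonnegative.\<close>
  have "inner (cls l (\<lambda>x. of_real \<nu> * W x)) (cls l W) + inner (cls l W1) (cls l W1) = 0"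
    using inner_integration_by_parts[OF l W1 W] bc by (simp add: W_def W1_def)
  then have "\<nu> * (norm (cls l W))\<^sup>2 + (norm (cls l W1))\<^sup>2 = 0"
    unfolding cls_scaleR[OF LW] by (simp add: power2_norm_eq_inner)
  then have "\<nu> * (norm (cls l W))\<^sup>2 \<le> 0" using zero_le_power2[of "norm (cls l W1)"] by linarith
  then have "cls l W = 0" using \<nu> by (simp add: mult_le_0_iff)
  then have "aeq l W (\<lambda>x. 0)" using cls_zero_iff[OF LW] by blast
  then have W0: "W x = 0" if "x \<in> {0..l}" for x
    using aeq_zero_continuous[OF _ prim_continuous[OF W] l that] by blast
  then have f2: "f2 x = - of_real \<nu> * f x" if "x \<in> {0..l}" for x
    using that by (simp add: W_def eq_neg_iff_add_eq_0)
  \<comment> \<open>The energy of the oscillator \<open>f'' = - \<nu> f\<close>: it is constant, and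
    zero at the left end by \<open>f 0 = f1 0 = 0\<close>.\<close>
  define e where "e x = inner (f1 x) (f1 x) + \<nu> * inner (f x) (f x)" for x
  have "(e has_vector_derivative 0) (at x within {0..l})" if x: "x \<in> {0..l}" for x
  proof -
    have d: "(f has_vector_derivative f1 x) (at x within {0..l})" "(f1 has_vector_derivative f2 x) (at x within {0..l})"
      using prim_has_vector_derivative[OF f(1) prim_continuous[OF f(2)] x]
        prim_has_vector_derivative[OF f(2) prim_continuous[OF f(3)] x] by blast+
    have i: "((\<lambda>x. inner (g x) (g x)) has_vector_derivative inner (g x) g' + inner g' (g x)) (at x within {0..l})"
      if "(g has_vector_derivative g') (at x within {0..l})" for g :: "real \<Rightarrow> complex" and g'
      by (rule bounded_bilinear.has_vector_derivative[OF bounded_bilinear_inner that that])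
    have "(e has_vector_derivative (inner (f1 x) (f2 x) + inner (f2 x) (f1 x)) + \<nu> * (inner (f x) (f1 x) + inner (f1 x) (f x))) (at x within {0..l})"
      unfolding e_def by (intro has_vector_derivative_add i d has_vector_derivative_mult_right)
    moreover have "(inner (f1 x) (f2 x) + inner (f2 x) (f1 x)) + \<nu> * (inner (f x) (f1 x) + inner (f1 x) (f x)) = 0"
    proof -
      have "f2 x = (- \<nu>) *\<^sub>R f x" using f2[OF x] by (simp add: scaleR_conv_of_real)
      then show ?thesis by (simp add: inner_commute[of "f x"] algebra_simps)
    qed
    ultimately show ?thesis by simp
  qed
  then obtain c where c: "\<And>x. x \<in> {0..l} \<Longrightarrow> e x = c"
    using has_vector_derivative_zero_constant[of "{0..l}" e] by (metis convex_real_interval(5))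
  have "e x = e 0" using c x l by simp
  then have "inner (f1 x) (f1 x) + \<nu> * inner (f x) (f x) = 0" by (simp add: e_def bc)
  moreover have "inner (f1 x) (f1 x) \<ge> 0" by simp
  ultimately have "\<nu> * inner (f x) (f x) \<le> 0" by linarith
  then have "(norm (f x))\<^sup>2 \<le> 0" using \<nu> by (simp add: mult_le_0_iff power2_norm_eq_inner)
  then show "f x = 0" by simp
  then show "f2 x = 0" using f2[OF x] by simp
qed

subsection \<open>The coupled system as an operator on the energy space\<close>

type_synonym hs = "lsq \<times> lsq \<times> lsq \<times> lsq \<times> lsq \<times> lsq"

text \<open>The product type has real scalars only; the componentwise complex action is kept as a
  family of bounded operators, to be commuted with the inverse and the semigroup.\<close>

definition cm :: "complex \<Rightarrow> hs \<Rightarrow> hs" where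
  "cm c = (\<lambda>(x1, x2, x3, x4, x5, x6). (cmul c x1, cmul c x2, cmul c x3, cmul c x4, cmul c x5, cmul c x6))"

lemma cm_add: "cm c (x + y) = cm c x + cm c y"
  by (cases x; cases y) (simp add: cm_def cmul_add_right)

lemma cm_of_real: "cm (of_real r) x = r *\<^sub>R x"
  by (cases x) (simp add: cm_def scaleR_lsq_def)

lemma cm_one: "cm 1 x = x"
  by (cases x) (simp add: cm_def cmul_one)

lemma cm_minus_one: "cm (-1) x = - x"
  using cm_of_real[of "-1" x] by simp

lemma cm_cm: "cm c (cm d x) = cm (c * d) x"
  by (cases x) (simp add: cm_def cmul_cmul)

lemma norm_cm: "norm (cm c x) = cmod c * norm x"
proof -
  have "(norm (cm c x))\<^sup>2 = (cmod c * norm x)\<^sup>2"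
    by (cases x) (simp add: cm_def power_mult_distrib norm_Pair norm_cmul algebra_simps)
  then show ?thesis by (simp add: power2_eq_iff_nonneg)
qed

lemma cm_diff: "cm c (x - y) = cm c x - cm c y"
  using cm_add[of c x "- y"] cm_cm[of c "-1" y] cm_cm[of "-1" c y] cm_minus_one by (simp add: mult.commute)

lemma cm_scaleR: "cm c (r *\<^sub>R x) = r *\<^sub>R cm c x"
  unfolding cm_of_real[symmetric] by (simp add: cm_cm mult.commute)

locale coupled =
  fixes l1 l2 \<alpha>1 \<beta>1 \<gamma>1 \<delta>1 \<tau>1 \<kappa>1 \<alpha>2 :: real
  assumes l1: "l1 > 0" and l2: "l2 > 0" and \<alpha>1: "\<alpha>1 > 0" and \<beta>1: "\<beta>1 > 0" and \<gamma>1: "\<gamma>1 > 0"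
    and \<delta>1: "\<delta>1 > 0" and \<tau>1: "\<tau>1 > 0" and \<kappa>1: "\<kappa>1 > 0" and \<alpha>2: "\<alpha>2 > 0"
begin

section \<open>Energy weights and the embedding of states\<close>

definition "k1 = \<delta>1 * \<alpha>1 / \<beta>1"
definition "k2 = \<delta>1 / \<beta>1"
definition "k4 = \<gamma>1 * \<tau>1 / \<kappa>1"

lemma k_pos: "k1 > 0" "k2 > 0" "k4 > 0"
  using \<alpha>1 \<beta>1 \<gamma>1 \<delta>1 \<tau>1 \<kappa>1 by (auto simp: k1_def k2_def k4_def)

text \<open>The weights of the energy are chosen for these relations: they match the coefficients of
  the elastic, thermal and flux couplings, so that mixed terms cancel in the dissipation identity,
  and the last one leaves the damping rate.\<close>

lemma k_rel: "k2 * \<alpha>1 = k1" "k2 * \<beta>1 = \<delta>1" "k4 * (\<kappa>1 / \<tau>1) = \<gamma>1" "k4 * (1 / \<tau>1) = \<gamma>1 / \<kappa>1"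
  using \<beta>1 \<tau>1 \<kappa>1 by (auto simp: k1_def k2_def k4_def)

abbreviation "H \<equiv> inH l1 l2"
abbreviation "Hsq \<equiv> Hnorm2 l1 l2 \<alpha>1 \<beta>1 \<gamma>1 \<delta>1 \<tau>1 \<kappa>1 \<alpha>2"
abbreviation "Hin \<equiv> Hinner l1 l2 \<alpha>1 \<beta>1 \<gamma>1 \<delta>1 \<tau>1 \<kappa>1 \<alpha>2"
abbreviation "D \<equiv> domA l1 l2 \<alpha>1 \<beta>1 \<delta>1 \<alpha>2"
abbreviation "A \<equiv> opA l1 l2 \<alpha>1 \<beta>1 \<gamma>1 \<delta>1 \<tau>1 \<kappa>1 \<alpha>2"

abbreviation "du1 y \<equiv> Dw l1 (su1 y)"
abbreviation "ddu1 y \<equiv> Dw l1 (du1 y)"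
abbreviation "du2 y \<equiv> Dw l2 (su2 y)"
abbreviation "ddu2 y \<equiv> Dw l2 (du2 y)"
abbreviation "d3u2 y \<equiv> Dw l2 (ddu2 y)"
abbreviation "d4u2 y \<equiv> Dw l2 (d3u2 y)"
abbreviation "dv1 y \<equiv> Dw l1 (sv1 y)"
abbreviation "dv2 y \<equiv> Dw l2 (sv2 y)"
abbreviation "ddv2 y \<equiv> Dw l2 (dv2 y)"
abbreviation "dth y \<equiv> Dw l1 (sth y)"
abbreviation "dq y \<equiv> Dw l1 (sq y)"

text \<open>The square roots make \<open>E\<close> isometric for the energy seminorm. Displacements
  enter only through \<open>u1'\<close> and \<open>u2''\<close>; the boundary conditions recover
  them by integration.\<close>

definition E :: "st \<Rightarrow> hs" where
  "E y = (sqrt k1 *\<^sub>R cls l1 (du1 y), sqrt k2 *\<^sub>R cls l1 (sv1 y), cls l1 (sth y),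
     sqrt k4 *\<^sub>R cls l1 (sq y), sqrt \<alpha>2 *\<^sub>R cls l2 (ddu2 y), cls l2 (sv2 y))"

text \<open>The coupling condition \<open>u1 0 = u2 0\<close> is left out: it is later shown to be closed with respect
  to the norm of \<open>E\<close>, which presupposes linearity of \<open>E\<close> on the larger space.\<close>

definition inW :: "st \<Rightarrow> bool" where
  "inW y \<longleftrightarrow> prim l1 (su1 y) (du1 y) \<and> prim l2 (su2 y) (du2 y)
     \<and> prim l2 (du2 y) (ddu2 y)
     \<and> su1 y l1 = 0 \<and> su2 y l2 = 0 \<and> du2 y 0 = 0
     \<and> L2 l1 (sv1 y) \<and> L2 l2 (sv2 y) \<and> L2 l1 (sth y) \<and> L2 l1 (sq y)"

lemma inV_iff: "inV l1 l2 f g \<longleftrightarrow> prim l1 f (Dw l1 f) \<and> prim l2 g (Dw l2 g) \<and> prim l2 (Dw l2 g) (Dw l2 (Dw l2 g))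
     \<and> f l1 = 0 \<and> g l2 = 0 \<and> f 0 = g 0 \<and> Dw l2 g 0 = 0"
  using Hk_1_iff[OF l1, of f] Hk_2_iff[OF l2, of g] unfolding inV_def by blast

lemma inH_iff: "H y \<longleftrightarrow> inW y \<and> su1 y 0 = su2 y 0"
  unfolding inH_def inW_def inV_iff by blast

lemma D_iff: "D y \<longleftrightarrow> inV l1 l2 (su1 y) (su2 y) \<and> inV l1 l2 (sv1 y) (sv2 y)
    \<and> prim l1 (du1 y) (ddu1 y)
    \<and> prim l2 (ddu2 y) (d3u2 y)
    \<and> prim l2 (d3u2 y) (d4u2 y)
    \<and> prim l1 (sth y) (dth y) \<and> sth y 0 = 0 \<and> sth y l1 = 0 \<and> prim l1 (sq y) (dq y)
    \<and> ddu2 y l2 = 0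
    \<and> of_real \<alpha>2 * d3u2 y 0 = of_real k1 * du1 y 0"
  using Hk_1_iff[OF l1, of "sth y"] Hk_1_iff[OF l1, of "sq y"] Hk_2_iff[OF l1, of "su1 y"] Hk_4_iff[OF l2, of "su2 y"]
  unfolding domA_def inV_iff k1_def by auto

lemma inW_L2:
  assumes "inW y"
  shows "L2 l1 (du1 y)" "L2 l1 (sv1 y)" "L2 l1 (sth y)" "L2 l1 (sq y)"
    "L2 l2 (ddu2 y)" "L2 l2 (sv2 y)"
  using assms prim_L2 unfolding inW_def by blast+

lemma E_inner: "inW y \<Longrightarrow> inW z \<Longrightarrow> inner (E y) (E z) = Re (Hin y z)"
proof -
  assume y: "inW y" and z: "inW z"
  have s: "sqrt k1 * sqrt k1 = k1" "sqrt k2 * sqrt k2 = k2" "sqrt k4 * sqrt k4 = k4" "sqrt \<alpha>2 * sqrt \<alpha>2 = \<alpha>2"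
    using k_pos \<alpha>2 by auto
  show ?thesis
    unfolding E_def Hinner_def k1_def[symmetric] k2_def[symmetric] k4_def[symmetric]
    using inW_L2[OF y] inW_L2[OF z] s by (simp add: inner_cls mult.assoc[symmetric])
qed

lemma E_norm: "inW y \<Longrightarrow> (norm (E y))\<^sup>2 = Hsq y"
proof -
  assume y: "inW y"
  have s: "sqrt k1 * sqrt k1 = k1" "sqrt k2 * sqrt k2 = k2" "sqrt k4 * sqrt k4 = k4" "sqrt \<alpha>2 * sqrt \<alpha>2 = \<alpha>2"
    using k_pos \<alpha>2 by auto
  have n: "inner (cls l f) (cls l f) = nrm2 l f" if "L2 l f" for l f
    using norm_cls[OF that] by (simp add: power2_norm_eq_inner)
  show ?thesis
    unfolding E_def Hnorm2_def k1_def[symmetric] k2_def[symmetric] k4_def[symmetric] power2_norm_eq_inner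
    using inW_L2[OF y] s by (simp add: n mult.assoc[symmetric])
qed

lemma norm_E: "inW y \<Longrightarrow> norm (E y) = sqrt (Hsq y)"
  using E_norm[of y] by (metis norm_ge_zero real_sqrt_unique)

lemma st_lin_sel [simp]:
  "su1 (st_lin a y b z) = (\<lambda>x. a * su1 y x + b * su1 z x)"
  "su2 (st_lin a y b z) = (\<lambda>x. a * su2 y x + b * su2 z x)"
  "sv1 (st_lin a y b z) = (\<lambda>x. a * sv1 y x + b * sv1 z x)"
  "sv2 (st_lin a y b z) = (\<lambda>x. a * sv2 y x + b * sv2 z x)"
  "sth (st_lin a y b z) = (\<lambda>x. a * sth y x + b * sth z x)"
  "sq (st_lin a y b z) = (\<lambda>x. a * sq y x + b * sq z x)"
  by (simp_all add: st_lin_def)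

text \<open>\<open>Dw\<close> is not linear for arbitrary functions, so the derivatives of the
  combination are identified through primitives, pointwise or almost everywhere, before passing to
  classes.\<close>

lemma E_lin:
  assumes y: "inW y" and z: "inW z"
  shows "inW (st_lin a y b z)" "E (st_lin a y b z) = cm a (E y) + cm b (E z)"
proof -
  let ?s = "st_lin a y b z"
  have 1: "prim l1 (su1 ?s) (\<lambda>x. a * du1 y x + b * du1 z x)"
    using y z unfolding inW_def by (simp add: prim_lin)
  have 2: "prim l2 (su2 ?s) (\<lambda>x. a * du2 y x + b * du2 z x)"
    using y z unfolding inW_def by (simp add: prim_lin)
  have 3: "prim l2 (\<lambda>x. a * du2 y x + b * du2 z x) (\<lambda>x. a * ddu2 y x + b * ddu2 z x)"
    using y z unfolding inW_def by (simp add: prim_lin)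
  note c = prim_chain2[OF l2 2 3]
  show W: "inW ?s"
    using prim_self[OF l1 1] c(1,3) c(2)[of 0] y z l2 unfolding inW_def by (simp add: L2_lin)
  note Ly = inW_L2[OF y] and Lz = inW_L2[OF z] and Ls = inW_L2[OF W]
  have "cls l1 (du1 ?s) = cls l1 (\<lambda>x. a * du1 y x + b * du1 z x)"
    using prim_Dw[OF l1 1] Ls(1) Ly(1) Lz(1) by (simp only: cls_eq_iff L2_lin)
  moreover have "cls l2 (ddu2 ?s) = cls l2 (\<lambda>x. a * ddu2 y x + b * ddu2 z x)"
    using c(4) Ls(5) Ly(5) Lz(5) by (simp only: cls_eq_iff L2_lin)
  moreover have "r *\<^sub>R cmul c f = cmul c (r *\<^sub>R f)" for r c f
    by (simp add: scaleR_lsq_def cmul_cmul mult.commute)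
  ultimately show "E ?s = cm a (E y) + cm b (E z)"
    using Ly Lz unfolding E_def cm_def by (simp add: cls_lin scaleR_add_right)
qed

lemma st_lin_H: "H y \<Longrightarrow> H z \<Longrightarrow> H (st_lin a y b z)"
  using E_lin(1)[of y z a b] by (simp add: inH_iff)

lemma D_H: "D y \<Longrightarrow> H y"
  unfolding D_iff inH_iff inV_iff inW_def by (auto intro: prim_mult_L2)

lemma A_sel:
  "su1 (A y) = sv1 y" "su2 (A y) = sv2 y"
  "sv1 (A y) = (\<lambda>x. of_real \<alpha>1 * ddu1 y x - of_real \<beta>1 * dth y x)"
  "sv2 (A y) = (\<lambda>x. - of_real \<alpha>2 * d4u2 y x)"
  "sth (A y) = (\<lambda>x. - of_real \<delta>1 * dv1 y x - of_real \<gamma>1 * dq y x)"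
  "sq (A y) = (\<lambda>x. - of_real (1 / \<tau>1) * sq y x - of_real (\<kappa>1 / \<tau>1) * dth y x)"
  by (simp_all add: opA_def)

lemma D_A_H: "D y \<Longrightarrow> H (A y)"
proof -
  assume D: "D y"
  then have "L2 l1 (ddu1 y)" "L2 l1 (dth y)" "L2 l2 (d4u2 y)"
    "L2 l1 (dv1 y)" "L2 l1 (dq y)" "L2 l1 (sq y)"
    unfolding D_iff inV_iff using prim_L2 prim_mult_L2 by blast+
  note L = this
  have "L2 l1 (sv1 (A y))" unfolding A_sel by (intro L2_diff L2_cmul L)
  moreover have "L2 l2 (sv2 (A y))" unfolding A_sel by (intro L2_cmul L)
  moreover have "L2 l1 (sth (A y))" unfolding A_sel by (intro L2_diff L2_cmul L)
  moreover have "L2 l1 (sq (A y))" unfolding A_sel by (intro L2_diff L2_cmul L)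
  ultimately show ?thesis
    using D unfolding inH_iff inW_def A_sel(1,2) D_iff inV_iff by blast
qed

text \<open>A state built from explicit primitives lies in the domain, and the derivatives entering
  \<open>A\<close> are the given functions almost everywhere. This is the interface for linear
  combinations and for the solution of \<open>A y = f\<close>.\<close>

lemma D_intro:
  assumes u1: "prim l1 (su1 y) a1" "prim l1 a1 a2"
    and u2: "prim l2 (su2 y) b1" "prim l2 b1 b2" "prim l2 b2 b3" "prim l2 b3 b4"
    and ubc: "su1 y l1 = 0" "su2 y l2 = 0" "su1 y 0 = su2 y 0" "b1 0 = 0" "b2 l2 = 0" "of_real \<alpha>2 * b3 0 = of_real k1 * a1 0"
    and v: "prim l1 (sv1 y) c1" "prim l2 (sv2 y) d1" "prim l2 d1 d2"
    and vbc: "sv1 y l1 = 0" "sv2 y l2 = 0" "sv1 y 0 = sv2 y 0" "d1 0 = 0"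
    and th: "prim l1 (sth y) t1" "sth y 0 = 0" "sth y l1 = 0" and q: "prim l1 (sq y) p1"
  shows "D y \<and> aeq l1 (ddu1 y) a2 \<and> aeq l2 (d4u2 y) b4
    \<and> aeq l1 (dv1 y) c1 \<and> aeq l1 (dth y) t1 \<and> aeq l1 (dq y) p1"
proof (intro conjI)
  note cu1 = prim_chain2[OF l1 u1] and cu2 = prim_chain4[OF l2 u2] and cv2 = prim_chain2[OF l2 v(2,3)]
  show "aeq l1 (ddu1 y) a2" "aeq l2 (d4u2 y) b4"
    "aeq l1 (dv1 y) c1" "aeq l1 (dth y) t1" "aeq l1 (dq y) p1"
    using cu1(4) cu2(8) prim_Dw[OF l1 v(1)] prim_Dw[OF l1 th(1)] prim_Dw[OF l1 q] by blast+
  have "0 \<in> {0..l1}" "0 \<in> {0..l2}" "l2 \<in> {0..l2}" using l1 l2 by auto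
  then show "D y"
    unfolding D_iff inV_iff
    using cu1(1,3) cu1(2)[of 0] cu2(1,3,5,7) cu2(2)[of 0] cu2(4)[of l2] cu2(6)[of 0] cv2(1,3) cv2(2)[of 0]
      prim_self[OF l1 v(1)] prim_self[OF l1 th(1)] prim_self[OF l1 q] ubc vbc th(2,3) by simp
qed

lemma E_eqI:
  assumes W: "inW y" "inW z" and eq: "su1 y = su1 z" "su2 y = su2 z"
    and ae: "aeq l1 (sv1 y) (sv1 z)" "aeq l2 (sv2 y) (sv2 z)" "aeq l1 (sth y) (sth z)" "aeq l1 (sq y) (sq z)"
  shows "E y = E z"
proof -
  note L = inW_L2[OF W(1)] inW_L2[OF W(2)]
  have "cls l1 (sv1 y) = cls l1 (sv1 z)" "cls l2 (sv2 y) = cls l2 (sv2 z)"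
    "cls l1 (sth y) = cls l1 (sth z)" "cls l1 (sq y) = cls l1 (sq z)"
    using cls_eq_iff[OF L(2,8)] cls_eq_iff[OF L(6,12)] cls_eq_iff[OF L(3,9)] cls_eq_iff[OF L(4,10)] ae by blast+
  then show ?thesis unfolding E_def eq by (simp only:)
qed

lemma D_lin:
  assumes y: "D y" and z: "D z"
  shows "D (st_lin a y b z)" "E (A (st_lin a y b z)) = cm a (E (A y)) + cm b (E (A z))"
proof -
  let ?s = "st_lin a y b z"
  have I0: "D ?s \<and> aeq l1 (ddu1 ?s) (\<lambda>x. a * ddu1 y x + b * ddu1 z x)
    \<and> aeq l2 (d4u2 ?s) (\<lambda>x. a * d4u2 y x + b * d4u2 z x)
    \<and> aeq l1 (dv1 ?s) (\<lambda>x. a * dv1 y x + b * dv1 z x)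
    \<and> aeq l1 (dth ?s) (\<lambda>x. a * dth y x + b * dth z x)
    \<and> aeq l1 (dq ?s) (\<lambda>x. a * dq y x + b * dq z x)"
  proof (rule D_intro[of ?s "\<lambda>x. a * du1 y x + b * du1 z x"
      "\<lambda>x. a * ddu1 y x + b * ddu1 z x"
      "\<lambda>x. a * du2 y x + b * du2 z x"
      "\<lambda>x. a * ddu2 y x + b * ddu2 z x"
      "\<lambda>x. a * d3u2 y x + b * d3u2 z x"
      "\<lambda>x. a * d4u2 y x + b * d4u2 z x"
      "\<lambda>x. a * dv1 y x + b * dv1 z x"
      "\<lambda>x. a * dv2 y x + b * dv2 z x"
      "\<lambda>x. a * ddv2 y x + b * ddv2 z x"
      "\<lambda>x. a * dth y x + b * dth z x" "\<lambda>x. a * dq y x + b * dq z x"]; (use y z in \<open>simp add: D_iff inV_iff prim_lin; fail\<close>)?)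
    have "of_real \<alpha>2 * d3u2 y 0 = of_real k1 * du1 y 0"
      "of_real \<alpha>2 * d3u2 z 0 = of_real k1 * du1 z 0"
      using y z by (auto simp: D_iff)
    then show "of_real \<alpha>2 * (a * d3u2 y 0 + b * d3u2 z 0)
        = of_real k1 * (a * du1 y 0 + b * du1 z 0)"
      by (simp add: distrib_left mult.left_commute)
  qed
  note I = I0[THEN conjunct1] I0[THEN conjunct2, THEN conjunct1] I0[THEN conjunct2, THEN conjunct2, THEN conjunct1]
    I0[THEN conjunct2, THEN conjunct2, THEN conjunct2, THEN conjunct1]
    I0[THEN conjunct2, THEN conjunct2, THEN conjunct2, THEN conjunct2, THEN conjunct1]
    I0[THEN conjunct2, THEN conjunct2, THEN conjunct2, THEN conjunct2, THEN conjunct2]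
  show "D ?s" by (rule I(1))
  have W: "inW (A ?s)" "inW (A y)" "inW (A z)" "inW (st_lin a (A y) b (A z))"
    using D_A_H[OF I(1)] D_A_H[OF y] D_A_H[OF z] st_lin_H[OF D_A_H[OF y] D_A_H[OF z]] by (auto simp: inH_iff)
  have "aeq l1 (sv1 (A ?s)) (sv1 (st_lin a (A y) b (A z)))"
    using I(2,5) unfolding aeq_def by eventually_elim (auto simp: A_sel algebra_simps)
  moreover have "aeq l2 (sv2 (A ?s)) (sv2 (st_lin a (A y) b (A z)))"
    using I(3) unfolding aeq_def by eventually_elim (auto simp: A_sel algebra_simps)
  moreover have "aeq l1 (sth (A ?s)) (sth (st_lin a (A y) b (A z)))"
    using I(4,6) unfolding aeq_def by eventually_elim (auto simp: A_sel algebra_simps)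
  moreover have "aeq l1 (sq (A ?s)) (sq (st_lin a (A y) b (A z)))"
    using I(5) unfolding aeq_def by eventually_elim (auto simp: A_sel algebra_simps add_divide_distrib)
  moreover have "su1 (A ?s) = su1 (st_lin a (A y) b (A z))" "su2 (A ?s) = su2 (st_lin a (A y) b (A z))"
    by (simp_all add: A_sel)
  ultimately have "E (A ?s) = E (st_lin a (A y) b (A z))"
    by (intro E_eqI W(1,4))
  also have "\<dots> = cm a (E (A y)) + cm b (E (A z))" by (rule E_lin(2)[OF W(2,3)])
  finally show "E (A ?s) = cm a (E (A y)) + cm b (E (A z))" .
qed

text \<open>Integration by parts: the boundary terms at \<open>0\<close> cancel by the transmission condition.\<close>

lemma green:
  assumes y: "D y" and w: "inV l1 l2 w1 w2"
  shows "k1 * inner (cls l1 (du1 y)) (cls l1 (Dw l1 w1))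
      + \<alpha>2 * inner (cls l2 (ddu2 y)) (cls l2 (Dw l2 (Dw l2 w2)))
    = - k1 * inner (cls l1 (ddu1 y)) (cls l1 w1)
      + \<alpha>2 * inner (cls l2 (d4u2 y)) (cls l2 w2)"
proof -
  let ?a1 = "du1 y" and ?b2 = "ddu2 y" and ?b3 = "d3u2 y"
  have y': "prim l1 ?a1 (Dw l1 ?a1)" "prim l2 ?b2 ?b3" "prim l2 ?b3 (Dw l2 ?b3)" "?b2 l2 = 0"
    "of_real \<alpha>2 * ?b3 0 = of_real k1 * ?a1 0"
    using y unfolding D_iff by blast+
  have w': "prim l1 w1 (Dw l1 w1)" "prim l2 w2 (Dw l2 w2)" "prim l2 (Dw l2 w2) (Dw l2 (Dw l2 w2))"
    "w1 l1 = 0" "w2 l2 = 0" "w1 0 = w2 0" "Dw l2 w2 0 = 0"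
    using w unfolding inV_iff by blast+
  \<comment> \<open>\<open>P\<close> and \<open>Q\<close> are the traces at the junction; the terms
    at the outer ends vanish by \<open>w1 l1 = w2 l2 = 0\<close> and \<open>u2'' l2 = 0\<close>, the
    slope term at \<open>0\<close> by \<open>w2' 0 = 0\<close>. The test pair is arbitrary in
    \<open>V\<close>, since it will be the velocities for dissipation and the displacements for the
    energy bound.\<close>
  define P Q where "P = Re (?a1 0 * cnj (w1 0))" and "Q = Re (?b3 0 * cnj (w2 0))"
  have 1: "inner (cls l1 (Dw l1 ?a1)) (cls l1 w1) + inner (cls l1 ?a1) (cls l1 (Dw l1 w1)) = - P"
    using inner_integration_by_parts[OF l1 y'(1) w'(1)] w' by (simp add: P_def)
  have 2: "inner (cls l2 (Dw l2 ?b3)) (cls l2 w2) + inner (cls l2 ?b3) (cls l2 (Dw l2 w2)) = - Q"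
    using inner_integration_by_parts[OF l2 y'(3) w'(2)] w' by (simp add: Q_def)
  have 3: "inner (cls l2 ?b3) (cls l2 (Dw l2 w2)) + inner (cls l2 ?b2) (cls l2 (Dw l2 (Dw l2 w2))) = 0"
    using inner_integration_by_parts[OF l2 y'(2) w'(3)] w' y' by simp
  have "k1 * P = Re (of_real k1 * ?a1 0 * cnj (w1 0))" by (simp add: P_def algebra_simps)
  also have "\<dots> = Re (of_real \<alpha>2 * ?b3 0 * cnj (w2 0))" using y' w' by simp
  also have "\<dots> = \<alpha>2 * Q" by (simp add: Q_def algebra_simps)
  finally have 4: "k1 * P = \<alpha>2 * Q" .
  have 5: "inner (cls l1 ?a1) (cls l1 (Dw l1 w1)) = - P - inner (cls l1 (Dw l1 ?a1)) (cls l1 w1)"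
    using 1 by linarith
  have 6: "inner (cls l2 ?b2) (cls l2 (Dw l2 (Dw l2 w2))) = Q + inner (cls l2 (Dw l2 ?b3)) (cls l2 w2)"
    using 2 3 by linarith
  show ?thesis unfolding 5 6 using 4 by (simp add: algebra_simps)
qed

lemma A_cls:
  assumes y: "D y"
  shows "cls l1 (sv1 (A y)) = \<alpha>1 *\<^sub>R cls l1 (ddu1 y) - \<beta>1 *\<^sub>R cls l1 (dth y)"
    "cls l2 (sv2 (A y)) = - \<alpha>2 *\<^sub>R cls l2 (d4u2 y)"
    "cls l1 (sth (A y)) = - \<delta>1 *\<^sub>R cls l1 (dv1 y) - \<gamma>1 *\<^sub>R cls l1 (dq y)"
    "cls l1 (sq (A y)) = - (1 / \<tau>1) *\<^sub>R cls l1 (sq y) - (\<kappa>1 / \<tau>1) *\<^sub>R cls l1 (dth y)"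
proof -
  have L: "L2 l1 (ddu1 y)" "L2 l1 (dth y)" "L2 l2 (d4u2 y)"
    "L2 l1 (dv1 y)" "L2 l1 (dq y)" "L2 l1 (sq y)"
    using y unfolding D_iff inV_iff using prim_L2 prim_mult_L2 by blast+
  show "cls l1 (sv1 (A y)) = \<alpha>1 *\<^sub>R cls l1 (ddu1 y) - \<beta>1 *\<^sub>R cls l1 (dth y)"
    unfolding A_sel using L by (simp add: cls_diff cls_scaleR L2_cmul)
  show "cls l2 (sv2 (A y)) = - \<alpha>2 *\<^sub>R cls l2 (d4u2 y)"
    using cls_scaleR[OF L(3), of "- \<alpha>2"] unfolding A_sel by simp
  show "cls l1 (sth (A y)) = - \<delta>1 *\<^sub>R cls l1 (dv1 y) - \<gamma>1 *\<^sub>R cls l1 (dq y)"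
    using cls_diff[OF L2_cmul[OF L(4), of "of_real (- \<delta>1)"] L2_cmul[OF L(5), of "of_real \<gamma>1"]]
      cls_scaleR[OF L(4), of "- \<delta>1"] cls_scaleR[OF L(5), of \<gamma>1] unfolding A_sel by simp
  show "cls l1 (sq (A y)) = - (1 / \<tau>1) *\<^sub>R cls l1 (sq y) - (\<kappa>1 / \<tau>1) *\<^sub>R cls l1 (dth y)"
    using cls_diff[OF L2_cmul[OF L(6), of "of_real (- (1 / \<tau>1))"] L2_cmul[OF L(2), of "of_real (\<kappa>1 / \<tau>1)"]]
      cls_scaleR[OF L(6), of "- (1 / \<tau>1)"] cls_scaleR[OF L(2), of "\<kappa>1 / \<tau>1"] unfolding A_sel by simp
qed

text \<open>\<open>green\<close> with the velocities as test pair removes the elastic terms. The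
  remaining mixed terms integrate the derivatives of temperature times velocity and temperature
  times flux, and these vanish because the temperature is zero at both ends.\<close>

lemma dissipation:
  assumes y: "D y"
  shows "inner (E (A y)) (E y) = - (\<gamma>1 / \<kappa>1) * (norm (cls l1 (sq y)))\<^sup>2"
proof -
  let ?u1' = "cls l1 (du1 y)" and ?u1'' = "cls l1 (ddu1 y)" and ?v1 = "cls l1 (sv1 y)" and ?v1' = "cls l1 (dv1 y)"
  let ?t = "cls l1 (sth y)" and ?t' = "cls l1 (dth y)" and ?q = "cls l1 (sq y)" and ?q' = "cls l1 (dq y)"
  let ?u2'' = "cls l2 (ddu2 y)" and ?u2'''' = "cls l2 (d4u2 y)"
    and ?v2 = "cls l2 (sv2 y)" and ?v2'' = "cls l2 (ddv2 y)"
  have p: "prim l1 (sth y) (dth y)" "sth y 0 = 0" "sth y l1 = 0" "prim l1 (sq y) (dq y)"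
    "prim l1 (sv1 y) (dv1 y)" "inV l1 l2 (sv1 y) (sv2 y)"
    using y unfolding D_iff inV_iff by blast+
  have g: "k1 * inner ?u1' ?v1' + \<alpha>2 * inner ?u2'' ?v2'' = - k1 * inner ?u1'' ?v1 + \<alpha>2 * inner ?u2'''' ?v2"
    by (rule green[OF y p(6)])
  have tv: "inner ?t' ?v1 + inner ?t ?v1' = 0" using inner_integration_by_parts[OF l1 p(1,5)] p by simp
  have tq: "inner ?t' ?q + inner ?t ?q' = 0" using inner_integration_by_parts[OF l1 p(1,4)] p by simp
  have s: "sqrt k1 * sqrt k1 = k1" "sqrt k2 * sqrt k2 = k2" "sqrt k4 * sqrt k4 = k4" "sqrt \<alpha>2 * sqrt \<alpha>2 = \<alpha>2"
    using k_pos \<alpha>2 by auto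
  have "inner (E (A y)) (E y) = k1 * inner ?v1' ?u1' + k2 * inner (\<alpha>1 *\<^sub>R ?u1'' - \<beta>1 *\<^sub>R ?t') ?v1
      + inner (- \<delta>1 *\<^sub>R ?v1' - \<gamma>1 *\<^sub>R ?q') ?t + k4 * inner (- (1 / \<tau>1) *\<^sub>R ?q - (\<kappa>1 / \<tau>1) *\<^sub>R ?t') ?q
      + \<alpha>2 * inner ?v2'' ?u2'' + inner (- \<alpha>2 *\<^sub>R ?u2'''') ?v2"
    unfolding E_def A_cls[OF y] unfolding A_sel(1,2) using s by (simp add: mult.assoc[symmetric])
  also have "\<dots> = (k1 * inner ?u1' ?v1' + \<alpha>2 * inner ?u2'' ?v2'') + (k2 * \<alpha>1) * inner ?u1'' ?v1 - \<alpha>2 * inner ?u2'''' ?v2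
      - (k2 * \<beta>1) * inner ?t' ?v1 - \<delta>1 * inner ?t ?v1' - \<gamma>1 * inner ?t ?q' - (k4 * (\<kappa>1 / \<tau>1)) * inner ?t' ?q
      - (k4 * (1 / \<tau>1)) * inner ?q ?q"
    unfolding inner_commute[of ?v1' ?u1'] inner_commute[of ?v2'' ?u2''] inner_commute[of ?t ?v1'] inner_commute[of ?t ?q']
    by (simp add: inner_diff_left right_diff_distrib)
  also have "\<dots> = - \<delta>1 * (inner ?t' ?v1 + inner ?t ?v1') - \<gamma>1 * (inner ?t' ?q + inner ?t ?q') - (\<gamma>1 / \<kappa>1) * inner ?q ?q"
    unfolding g k_rel by (simp add: algebra_simps)
  also have "\<dots> = - (\<gamma>1 / \<kappa>1) * (norm ?q)\<^sup>2" unfolding tv tq by (simp add: power2_norm_eq_inner)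
  finally show ?thesis .
qed

lemma integral_lin:
  fixes f g :: "real \<Rightarrow> complex"
  assumes "f integrable_on S" "g integrable_on S"
  shows "integral S (\<lambda>x. a * f x + b * g x) = a * integral S f + b * integral S g"
  using assms by (subst Henstock_Kurzweil_Integration.integral_add) (auto intro: integrable_on_mult_right)

text \<open>The equation \<open>A y = f\<close> is solved by successive integration. Two constants remain: \<open>c\<close>, fixed by
  \<open>sth y l1 = 0\<close>, and \<open>a = su1' y 0\<close>, fixed by \<open>su1 y 0 = su2 y 0\<close>.\<close>

lemma A_surj:
  assumes f: "H f"
  shows "\<exists>y. D y \<and> E (A y) = E f"
proof -
  have fW: "inW f" using f by (simp add: inH_iff)
  note L = inW_L2[OF fW]
  \<comment> \<open>\<open>A y = f\<close> prescribes the velocities as the displacements of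
    \<open>f\<close>, so the temperature equation determines the flux derivative
    \<open>p\<close>.\<close>
  define p where "p = (\<lambda>x. of_real (- 1 / \<gamma>1) * sth f x + of_real (- \<delta>1 / \<gamma>1) * du1 f x)"
  define Q where "Q = (\<lambda>x. integral {0..x} p)"
  \<comment> \<open>The flux is fixed up to a constant; this one gives the temperature gradient
    \<open>t\<close> mean zero, so that both end conditions for the temperature hold.\<close>
  define c where "c = - (integral {0..l1} Q + of_real \<tau>1 * integral {0..l1} (sq f)) / of_real l1"
  define q where "q = (\<lambda>x. c + integral {0..x} p)"
  define t where "t = (\<lambda>x. of_real (- 1 / \<kappa>1) * q x + of_real (- \<tau>1 / \<kappa>1) * sq f x)"
  define th where "th = (\<lambda>x. 0 + integral {0..x} t)"
  define s where "s = (\<lambda>x. of_real (1 / \<alpha>1) * sv1 f x + of_real (\<beta>1 / \<alpha>1) * t x)"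
  have Lp: "L2 l1 p" unfolding p_def by (intro L2_lin L)
  have q: "prim l1 q p" unfolding q_def by (rule prim_integral[OF Lp])
  have Lt: "L2 l1 t" unfolding t_def by (intro L2_lin L prim_mult_L2[OF q])
  have th: "prim l1 th t" unfolding th_def by (rule prim_integral[OF Lt])
  have Ls: "L2 l1 s" unfolding s_def by (intro L2_lin L Lt)
  have th0: "th 0 = 0" by (simp add: th_def)
  have thl: "th l1 = 0"
  proof -
    have Q: "prim l1 (\<lambda>x. 0 + Q x) p" unfolding Q_def by (rule prim_integral[OF Lp])
    have iQ: "Q integrable_on {0..l1}" using prim_continuous[OF Q] by (auto intro: integrable_continuous_interval)
    have iq: "q integrable_on {0..l1}" using prim_continuous[OF q] by (rule integrable_continuous_interval)
    have id: "sq f integrable_on {0..l1}" using L(4) by (rule L2_integrable_on) simp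
    have "integral {0..l1} q = integral {0..l1} (\<lambda>x. c + Q x)" by (simp add: q_def Q_def)
    also have "\<dots> = integral {0..l1} (\<lambda>x. c) + integral {0..l1} Q"
      using iQ by (intro Henstock_Kurzweil_Integration.integral_add) auto
    also have "integral {0..l1} (\<lambda>x. c) = of_real l1 * c" using l1 by (simp add: scaleR_conv_of_real)
    also have "of_real l1 * c + integral {0..l1} Q = - of_real \<tau>1 * integral {0..l1} (sq f)"
      using l1 by (simp add: c_def)
    finally have q': "integral {0..l1} q = - of_real \<tau>1 * integral {0..l1} (sq f)" .
    have "integral {0..l1} t = of_real (- 1 / \<kappa>1) * integral {0..l1} q + of_real (- \<tau>1 / \<kappa>1) * integral {0..l1} (sq f)"
      unfolding t_def by (rule integral_lin[OF iq id])
    then show ?thesis by (simp add: th_def q')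
  qed
  \<comment> \<open>Particular solutions with the outer boundary conditions and with
    \<open>a1 0 = b3 0 = 0\<close>, for which the transmission condition is trivial; only the
    coupling of the displacements at \<open>0\<close> remains open.\<close>
  define a1 where "a1 = (\<lambda>x. 0 + integral {0..x} s)"
  define u1 where "u1 = (\<lambda>x. - integral {0..l1} a1 + integral {0..x} a1)"
  define b4 where "b4 = (\<lambda>x. of_real (- 1 / \<alpha>2) * sv2 f x)"
  define b3 where "b3 = (\<lambda>x. 0 + integral {0..x} b4)"
  define b2 where "b2 = (\<lambda>x. - integral {0..l2} b3 + integral {0..x} b3)"
  define b1 where "b1 = (\<lambda>x. 0 + integral {0..x} b2)"
  define u2 where "u2 = (\<lambda>x. - integral {0..l2} b1 + integral {0..x} b1)"
  have a1: "prim l1 a1 s" unfolding a1_def by (rule prim_integral[OF Ls])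
  have u1: "prim l1 u1 a1" unfolding u1_def by (rule prim_integral[OF prim_mult_L2[OF a1]])
  have Lb4: "L2 l2 b4" unfolding b4_def by (intro L2_cmul L)
  have b3: "prim l2 b3 b4" unfolding b3_def by (rule prim_integral[OF Lb4])
  have b2: "prim l2 b2 b3" unfolding b2_def by (rule prim_integral[OF prim_mult_L2[OF b3]])
  have b1: "prim l2 b1 b2" unfolding b1_def by (rule prim_integral[OF prim_mult_L2[OF b2]])
  have u2: "prim l2 u2 b1" unfolding u2_def by (rule prim_integral[OF prim_mult_L2[OF b1]])
  have bc: "a1 0 = 0" "u1 l1 = 0" "b3 0 = 0" "b2 l2 = 0" "b1 0 = 0" "u2 l2 = 0"
    by (simp_all add: a1_def u1_def b3_def b2_def b1_def u2_def)
  \<comment> \<open>The homogeneous solution has unit strain in the string, and \<open>m\<close> is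
    the constant third derivative of its beam part for which the transmission condition
    holds.\<close>
  define m where "m = k1 / \<alpha>2"
  have m: "m > 0" using k_pos \<alpha>2 by (simp add: m_def)
  define U1 :: "real \<Rightarrow> complex" where "U1 = (\<lambda>x. of_real (x - l1))"
  define B2 B1 U2 :: "real \<Rightarrow> complex" where "B2 = (\<lambda>x. of_real (m * (x - l2)))"
    and "B1 = (\<lambda>x. of_real (m * (x\<^sup>2 / 2 - l2 * x)))"
    and "U2 = (\<lambda>x. of_real (m * (x ^ 3 / 6 - l2 * x\<^sup>2 / 2 + l2 ^ 3 / 3)))"
  have real: "prim l (\<lambda>x. complex_of_real (g x)) (\<lambda>x. of_real (g' x))"
    if "\<And>x. (g has_real_derivative g' x) (at x)" "continuous_on UNIV g'" for l g g'
  proof (rule prim_FTC)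
    show "((\<lambda>x. complex_of_real (g x)) has_vector_derivative of_real (g' x)) (at x within {0..l})" for x
      using that(1)[of x] has_vector_derivative_of_real has_real_derivative_iff_has_vector_derivative
      by (metis has_vector_derivative_at_within)
    show "continuous_on {0..l} (\<lambda>x. complex_of_real (g' x))"
      using that(2) by (intro continuous_intros) (auto intro: continuous_on_subset)
  qed
  have "prim l1 (\<lambda>x. of_real (x - l1)) (\<lambda>x. of_real 1)" "prim l1 (\<lambda>x. of_real 1) (\<lambda>x. of_real 0)"
    by (rule real; auto intro!: derivative_eq_intros continuous_intros)+
  then have U1: "prim l1 U1 (\<lambda>x. 1)" "prim l1 (\<lambda>x. 1) (\<lambda>x. 0)"
    unfolding U1_def of_real_1 of_real_0 by blast+
  have U2: "prim l2 U2 B1" unfolding U2_def B1_def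
    by (rule real) (auto intro!: derivative_eq_intros continuous_intros simp: field_simps power2_eq_square)
  have B1: "prim l2 B1 B2" unfolding B2_def B1_def
    by (rule real) (auto intro!: derivative_eq_intros continuous_intros simp: field_simps)
  have B2: "prim l2 B2 (\<lambda>x. of_real m)" unfolding B2_def
    by (rule real) (auto intro!: derivative_eq_intros continuous_intros)
  have B3: "prim l2 (\<lambda>x. of_real m) (\<lambda>x. 0)"
    using real[of "\<lambda>x. m" "\<lambda>x. 0" l2] by (auto intro!: derivative_eq_intros)
  have BC: "U1 l1 = 0" "B2 l2 = 0" "B1 0 = 0" "U2 l2 = 0"
    by (auto simp: U1_def B2_def B1_def U2_def field_simps power2_eq_square power3_eq_cube)
  \<comment> \<open>\<open>K\<close> is the gap \<open>U2 0 - U1 0\<close> of the homogeneous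
    solution. Its positivity makes the coupling solvable: the multiple \<open>a\<close> closes the
    gap of the particular solution.\<close>
  define K where "K = l1 + m * l2 ^ 3 / 3"
  have K: "K > 0" using l1 l2 m by (simp add: K_def add_pos_pos)
  define a where "a = (u1 0 - u2 0) / of_real K"
  have UU: "U2 0 - U1 0 = of_real K" by (simp add: U1_def U2_def K_def)
  have "a * (U2 0 - U1 0) = u1 0 - u2 0" unfolding UU using K by (simp add: a_def)
  then have glue: "1 * u1 0 + a * U1 0 = 1 * u2 0 + a * U2 0" by (simp add: algebra_simps)
  define y where "y = \<lparr>su1 = (\<lambda>x. 1 * u1 x + a * U1 x), su2 = (\<lambda>x. 1 * u2 x + a * U2 x),
    sv1 = su1 f, sv2 = su2 f, sth = th, sq = q\<rparr>"
  have sel: "su1 y = (\<lambda>x. 1 * u1 x + a * U1 x)" "su2 y = (\<lambda>x. 1 * u2 x + a * U2 x)"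
    "sv1 y = su1 f" "sv2 y = su2 f" "sth y = th" "sq y = q"
    by (simp_all add: y_def)
  have "of_real \<alpha>2 * (a * of_real m) = of_real k1 * a" using \<alpha>2 by (simp add: m_def)
  then have tr: "of_real \<alpha>2 * (1 * b3 0 + a * of_real m) = of_real k1 * (1 * a1 0 + a * 1)" using bc by simp
  have I: "D y \<and> aeq l1 (ddu1 y) (\<lambda>x. 1 * s x + a * 0)
    \<and> aeq l2 (d4u2 y) (\<lambda>x. 1 * b4 x + a * 0)
    \<and> aeq l1 (dv1 y) (du1 f) \<and> aeq l1 (dth y) t \<and> aeq l1 (dq y) p"
  proof (rule D_intro)
    show "prim l1 (su1 y) (\<lambda>x. 1 * a1 x + a * 1)" unfolding sel by (rule prim_lin[OF u1 U1(1)])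
    show "prim l1 (\<lambda>x. 1 * a1 x + a * 1) (\<lambda>x. 1 * s x + a * 0)" by (rule prim_lin[OF a1 U1(2)])
    show "prim l2 (su2 y) (\<lambda>x. 1 * b1 x + a * B1 x)" unfolding sel by (rule prim_lin[OF u2 U2])
    show "prim l2 (\<lambda>x. 1 * b1 x + a * B1 x) (\<lambda>x. 1 * b2 x + a * B2 x)" by (rule prim_lin[OF b1 B1])
    show "prim l2 (\<lambda>x. 1 * b2 x + a * B2 x) (\<lambda>x. 1 * b3 x + a * of_real m)" by (rule prim_lin[OF b2 B2])
    show "prim l2 (\<lambda>x. 1 * b3 x + a * of_real m) (\<lambda>x. 1 * b4 x + a * 0)" by (rule prim_lin[OF b3 B3])
    show "prim l1 (sv1 y) (du1 f)" "prim l2 (sv2 y) (du2 f)"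
      "prim l2 (du2 f) (ddu2 f)"
      "sv1 y l1 = 0" "sv2 y l2 = 0" "sv1 y 0 = sv2 y 0" "du2 f 0 = 0"
      using f unfolding sel inH_iff inW_def by blast+
    show "prim l1 (sth y) t" "prim l1 (sq y) p" "sth y 0 = 0" "sth y l1 = 0"
      unfolding sel by (rule th q th0 thl)+
    show "su1 y l1 = 0" "su2 y l2 = 0" "1 * b1 0 + a * B1 0 = 0" "1 * b2 l2 + a * B2 l2 = 0"
      unfolding sel using bc BC by simp_all
    show "su1 y 0 = su2 y 0" unfolding sel by (rule glue)
    show "of_real \<alpha>2 * (1 * b3 0 + a * of_real m) = of_real k1 * (1 * a1 0 + a * 1)" by (rule tr)
  qed
  have Dy: "D y" using I by blast
  have "E (A y) = E f"
  proof (rule E_eqI)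
    show "inW (A y)" using D_A_H[OF Dy] by (simp add: inH_iff)
    show "inW f" by fact
    show "su1 (A y) = su1 f" "su2 (A y) = su2 f" by (simp_all add: A_sel sel)
    have ae: "AE x in lebesgue. x \<in> {0..l1} \<longrightarrow> ddu1 y x = s x"
      "AE x in lebesgue. x \<in> {0..l2} \<longrightarrow> d4u2 y x = b4 x"
      "AE x in lebesgue. x \<in> {0..l1} \<longrightarrow> dth y x = t x"
      "AE x in lebesgue. x \<in> {0..l1} \<longrightarrow> dq y x = p x"
      using I unfolding aeq_def by simp_all
    show "aeq l1 (sv1 (A y)) (sv1 f)"
      using ae(1,3) unfolding aeq_def
    proof eventually_elim
      case (elim x)
      then show ?case using \<alpha>1 by (simp add: A_sel s_def algebra_simps)
    qed
    show "aeq l2 (sv2 (A y)) (sv2 f)"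
      using ae(2) unfolding aeq_def
    proof eventually_elim
      case (elim x)
      then show ?case using \<alpha>2 by (simp add: A_sel b4_def)
    qed
    show "aeq l1 (sth (A y)) (sth f)"
      using ae(4) unfolding aeq_def
    proof eventually_elim
      case (elim x)
      have "of_real \<gamma>1 * p x = - sth f x - of_real \<delta>1 * du1 f x"
        using \<gamma>1 by (simp add: p_def field_simps)
      then show ?case using elim by (auto simp: A_sel sel)
    qed
    show "aeq l1 (sq (A y)) (sq f)"
      using ae(3) unfolding aeq_def
    proof eventually_elim
      case (elim x)
      then show ?case using \<kappa>1 \<tau>1 by (simp add: A_sel sel t_def divide_simps) (simp add: algebra_simps)
    qed
  qed
  then show ?thesis using Dy by blast
qed

section \<open>A priori bounds for the inverse\<close>

text \<open>Constants of a priori estimates are hidden, so that bounds on scalar quantities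
  (\<open>bd\<close>) and uniform bounds on functions (\<open>bs\<close>) combine without tracking
  them. The norm of \<open>A y\<close> is the common reference.\<close>

definition bd :: "(st \<Rightarrow> real) \<Rightarrow> bool" where
  "bd r \<longleftrightarrow> (\<exists>K\<ge>0. \<forall>y. D y \<longrightarrow> r y \<le> K * norm (E (A y)))"

definition bs :: "real \<Rightarrow> (st \<Rightarrow> real \<Rightarrow> complex) \<Rightarrow> bool" where
  "bs l \<phi> \<longleftrightarrow> (\<exists>K\<ge>0. \<forall>y. D y \<longrightarrow> (\<forall>x\<in>{0..l}. cmod (\<phi> y x) \<le> K * norm (E (A y))))"

lemma bd_mono: "(\<And>y. D y \<Longrightarrow> r y \<le> s y) \<Longrightarrow> bd s \<Longrightarrow> bd r"
  unfolding bd_def by (meson order_trans)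

lemma bd_add: "bd r \<Longrightarrow> bd s \<Longrightarrow> bd (\<lambda>y. r y + s y)"
proof -
  assume "bd r" "bd s"
  then obtain K M where "K \<ge> 0" "M \<ge> 0" "\<forall>y. D y \<longrightarrow> r y \<le> K * norm (E (A y))" "\<forall>y. D y \<longrightarrow> s y \<le> M * norm (E (A y))"
    unfolding bd_def by blast
  then show ?thesis unfolding bd_def
    by (intro exI[of _ "K + M"]) (auto simp: distrib_right intro!: add_mono)
qed

lemma bd_cmult: "c \<ge> 0 \<Longrightarrow> bd r \<Longrightarrow> bd (\<lambda>y. c * r y)"
proof -
  assume c: "c \<ge> 0" "bd r"
  then obtain K where "K \<ge> 0" "\<forall>y. D y \<longrightarrow> r y \<le> K * norm (E (A y))"
    unfolding bd_def by blast
  then show ?thesis unfolding bd_def using c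
    by (intro exI[of _ "c * K"]) (auto simp: mult.assoc intro!: mult_left_mono)
qed

lemma bs_zero:
  assumes p: "\<And>y. D y \<Longrightarrow> prim l (\<phi> y) (\<psi> y)" "\<And>y. D y \<Longrightarrow> \<phi> y z = 0" "z \<in> {0..l}"
    and b: "bd (\<lambda>y. norm (cls l (\<psi> y)))"
  shows "bs l \<phi>"
proof -
  have l: "l \<ge> 0" using p(3) by simp
  obtain K where K: "K \<ge> 0" "\<And>y. D y \<Longrightarrow> norm (cls l (\<psi> y)) \<le> K * norm (E (A y))"
    using b unfolding bd_def by blast
  have "cmod (\<phi> y x) \<le> (sqrt l * K) * norm (E (A y))" if y: "D y" and x: "x \<in> {0..l}" for y x
  proof -
    have "cmod (\<phi> y x) \<le> sqrt l * norm (cls l (\<psi> y))" by (rule prim_bound_zero[OF p(1)[OF y] p(3) p(2)[OF y] x])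
    also have "\<dots> \<le> sqrt l * (K * norm (E (A y)))" using l by (intro mult_left_mono K y) auto
    finally show ?thesis by (simp add: mult.assoc)
  qed
  then show ?thesis unfolding bs_def using K l by (intro exI[of _ "sqrt l * K"]) auto
qed

lemma bs_point:
  assumes p: "\<And>y. D y \<Longrightarrow> prim l (\<phi> y) (\<psi> y)" "z \<in> {0..l}" and z: "bd (\<lambda>y. cmod (\<phi> y z))"
    and b: "bd (\<lambda>y. norm (cls l (\<psi> y)))"
  shows "bs l \<phi>"
proof -
  have l: "l \<ge> 0" using p(2) by simp
  have "bd (\<lambda>y. cmod (\<phi> y z) + sqrt l * norm (cls l (\<psi> y)))" using l by (intro bd_add bd_cmult z b) auto
  then obtain K where K: "K \<ge> 0" "\<And>y. D y \<Longrightarrow> cmod (\<phi> y z) + sqrt l * norm (cls l (\<psi> y)) \<le> K * norm (E (A y))"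
    unfolding bd_def by blast
  have "cmod (\<phi> y x) \<le> K * norm (E (A y))" if y: "D y" and x: "x \<in> {0..l}" for y x
  proof -
    have "cmod (\<phi> y x - \<phi> y z) \<le> sqrt \<bar>x - z\<bar> * norm (cls l (\<psi> y))" by (rule prim_diff_bound[OF p(1)[OF y] p(2) x])
    also have "\<dots> \<le> sqrt l * norm (cls l (\<psi> y))" using x p(2) by (intro mult_right_mono) auto
    finally show ?thesis using norm_triangle_ineq[of "\<phi> y z" "\<phi> y x - \<phi> y z"] K(2)[OF y] by simp
  qed
  then show ?thesis unfolding bs_def using K by (intro exI[of _ K]) auto
qed

lemma bs_at: "bs l \<phi> \<Longrightarrow> x \<in> {0..l} \<Longrightarrow> bd (\<lambda>y. cmod (\<phi> y x))"
  unfolding bs_def bd_def by blast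

lemma bd_of_bs:
  assumes l: "l > 0" and c: "\<And>y. D y \<Longrightarrow> continuous_on {0..l} (\<phi> y)" and b: "bs l \<phi>"
  shows "bd (\<lambda>y. norm (cls l (\<phi> y)))"
proof -
  obtain K where K: "K \<ge> 0" "\<And>y x. D y \<Longrightarrow> x \<in> {0..l} \<Longrightarrow> cmod (\<phi> y x) \<le> K * norm (E (A y))"
    using b unfolding bs_def by blast
  have "norm (cls l (\<phi> y)) \<le> (sqrt l * K) * norm (E (A y))" if y: "D y" for y
    using sup_bound_cls[OF c[OF y] l K(2)[OF y]] K(1) by (simp add: mult.assoc)
  then show ?thesis unfolding bd_def using K l by (intro exI[of _ "sqrt l * K"]) auto
qed

lemma bs_mean:
  assumes l: "l > 0" and p: "\<And>y. D y \<Longrightarrow> prim l (\<phi> y) (\<psi> y)" and m: "bd (\<lambda>y. cmod (integral {0..l} (\<phi> y)))"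
    and b: "bd (\<lambda>y. norm (cls l (\<psi> y)))"
  shows "bs l \<phi>"
proof (rule bs_point[OF p])
  show "0 \<in> {0..l}" using l by simp
  have "bd (\<lambda>y. 1 / l * cmod (integral {0..l} (\<phi> y)) + sqrt l * norm (cls l (\<psi> y)))"
    using l by (intro bd_add bd_cmult m b) auto
  then show "bd (\<lambda>y. cmod (\<phi> y 0))"
    by (rule bd_mono[rotated]) (use prim_mean_bound[OF l p] l in simp)
qed (use b in auto)

lemma D_prims:
  assumes "D y"
  shows "prim l1 (su1 y) (du1 y)" "prim l1 (du1 y) (ddu1 y)"
    "prim l2 (su2 y) (du2 y)" "prim l2 (du2 y) (ddu2 y)"
    "prim l2 (ddu2 y) (d3u2 y)"
    "prim l2 (d3u2 y) (d4u2 y)"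
    "prim l1 (sv1 y) (dv1 y)" "prim l2 (sv2 y) (dv2 y)" "prim l2 (dv2 y) (ddv2 y)"
    "prim l1 (sth y) (dth y)" "prim l1 (sq y) (dq y)"
  using assms unfolding D_iff inV_iff by blast+

lemma D_bcs:
  assumes "D y"
  shows "su1 y l1 = 0" "su2 y l2 = 0" "su1 y 0 = su2 y 0" "du2 y 0 = 0"
    "sv1 y l1 = 0" "sv2 y l2 = 0" "sv1 y 0 = sv2 y 0" "dv2 y 0 = 0"
    "sth y 0 = 0" "sth y l1 = 0" "ddu2 y l2 = 0"
    "of_real \<alpha>2 * d3u2 y 0 = of_real k1 * du1 y 0"
  using assms unfolding D_iff inV_iff by blast+

lemma E_components_le:
  "sqrt k1 * norm (cls l1 (du1 y)) \<le> norm (E y)" "sqrt k2 * norm (cls l1 (sv1 y)) \<le> norm (E y)"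
  "norm (cls l1 (sth y)) \<le> norm (E y)" "sqrt k4 * norm (cls l1 (sq y)) \<le> norm (E y)"
  "sqrt \<alpha>2 * norm (cls l2 (ddu2 y)) \<le> norm (E y)" "norm (cls l2 (sv2 y)) \<le> norm (E y)"
proof -
  have f: "norm a \<le> norm (a, b)" and s: "norm b \<le> norm (a, b)" for a :: "'x::real_normed_vector" and b :: "'y::real_normed_vector"
    using norm_fst_le[of a b] norm_snd_le[of b a] by auto
  let ?x1 = "sqrt k1 *\<^sub>R cls l1 (du1 y)" and ?x2 = "sqrt k2 *\<^sub>R cls l1 (sv1 y)" and ?x3 = "cls l1 (sth y)"
    and ?x4 = "sqrt k4 *\<^sub>R cls l1 (sq y)" and ?x5 = "sqrt \<alpha>2 *\<^sub>R cls l2 (ddu2 y)" and ?x6 = "cls l2 (sv2 y)"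
  have E: "E y = (?x1, ?x2, ?x3, ?x4, ?x5, ?x6)" by (simp add: E_def)
  have n1: "norm ?x1 \<le> norm (E y)" unfolding E by (rule f)
  have n2: "norm ?x2 \<le> norm (E y)" unfolding E by (rule order_trans[OF f s])
  have n3: "norm ?x3 \<le> norm (E y)" unfolding E by (rule order_trans[OF order_trans[OF f s] s])
  have n4: "norm ?x4 \<le> norm (E y)" unfolding E by (rule order_trans[OF order_trans[OF order_trans[OF f s] s] s])
  have n5: "norm ?x5 \<le> norm (E y)" unfolding E by (rule order_trans[OF order_trans[OF order_trans[OF order_trans[OF f s] s] s] s])
  have n6: "norm ?x6 \<le> norm (E y)" unfolding E by (rule order_trans[OF order_trans[OF order_trans[OF order_trans[OF s s] s] s] s])
  show "sqrt k1 * norm (cls l1 (du1 y)) \<le> norm (E y)" "sqrt k2 * norm (cls l1 (sv1 y)) \<le> norm (E y)"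
    "norm (cls l1 (sth y)) \<le> norm (E y)" "sqrt k4 * norm (cls l1 (sq y)) \<le> norm (E y)"
    "sqrt \<alpha>2 * norm (cls l2 (ddu2 y)) \<le> norm (E y)" "norm (cls l2 (sv2 y)) \<le> norm (E y)"
    using n1 n2 n3 n4 n5 n6 k_pos \<alpha>2 by simp_all
qed

lemma bd_scaled: "c > 0 \<Longrightarrow> (\<And>y. D y \<Longrightarrow> c * r y \<le> norm (E (A y))) \<Longrightarrow> bd r"
  unfolding bd_def by (intro exI[of _ "1 / c"]) (auto simp: field_simps)

text \<open>Each function comes with a bound on its derivative because compactness needs both. The
  estimates follow the coupling of the equations: velocities, flux, temperature, string, and,
  through the transmission condition, the beam.\<close>

lemma D_bounds:
  shows "bs l1 (\<lambda>y. du1 y)" "bd (\<lambda>y. norm (cls l1 (ddu1 y)))"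
    "bs l1 sv1" "bd (\<lambda>y. norm (cls l1 (dv1 y)))"
    "bs l1 sth" "bd (\<lambda>y. norm (cls l1 (dth y)))"
    "bs l1 sq" "bd (\<lambda>y. norm (cls l1 (dq y)))"
    "bs l2 (\<lambda>y. ddu2 y)" "bd (\<lambda>y. norm (cls l2 (d3u2 y)))"
    "bs l2 sv2" "bd (\<lambda>y. norm (cls l2 (dv2 y)))"
proof -
  have i0: "0 \<in> {0..l1}" "l1 \<in> {0..l1}" "0 \<in> {0..l2}" "l2 \<in> {0..l2}" using l1 l2 by auto
  note cont = prim_continuous[OF D_prims(1)] prim_continuous[OF D_prims(2)] prim_continuous[OF D_prims(11)]
    prim_continuous[OF D_prims(6)] prim_continuous[OF D_prims(9)]
  have n1: "bd (\<lambda>y. norm (cls l1 (dv1 y)))"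
    by (rule bd_scaled[of "sqrt k1"]) (use E_components_le(1)[of "A _"] k_pos in \<open>auto simp: A_sel\<close>)
  have n2: "bd (\<lambda>y. norm (cls l1 (sv1 (A y))))"
    by (rule bd_scaled[of "sqrt k2"]) (use E_components_le(2)[of "A _"] k_pos in auto)
  have n3: "bd (\<lambda>y. norm (cls l1 (sth (A y))))"
    by (rule bd_scaled[of 1]) (use E_components_le(3)[of "A _"] in auto)
  have n4: "bd (\<lambda>y. norm (cls l1 (sq (A y))))"
    by (rule bd_scaled[of "sqrt k4"]) (use E_components_le(4)[of "A _"] k_pos in auto)
  have n5: "bd (\<lambda>y. norm (cls l2 (ddv2 y)))"
    by (rule bd_scaled[of "sqrt \<alpha>2"]) (use E_components_le(5)[of "A _"] \<alpha>2 in \<open>auto simp: A_sel\<close>)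
  have n6: "bd (\<lambda>y. norm (cls l2 (sv2 (A y))))"
    by (rule bd_scaled[of 1]) (use E_components_le(6)[of "A _"] in auto)
  show "bd (\<lambda>y. norm (cls l1 (dv1 y)))" by fact
  show "bs l1 sv1" by (rule bs_zero, erule D_prims(7), erule D_bcs(5), rule i0(2), rule n1)
  have bv2: "bs l2 (\<lambda>y. dv2 y)" by (rule bs_zero, erule D_prims(9), erule D_bcs(8), rule i0(3), rule n5)
  show nv2: "bd (\<lambda>y. norm (cls l2 (dv2 y)))" by (rule bd_of_bs[OF l2], erule cont(5), rule bv2)
  show "bs l2 sv2" by (rule bs_zero, erule D_prims(8), erule D_bcs(6), rule i0(4), rule nv2)
  show nq: "bd (\<lambda>y. norm (cls l1 (dq y)))"
  proof (rule bd_mono)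
    show "bd (\<lambda>y. 1 / \<gamma>1 * (norm (cls l1 (sth (A y))) + \<delta>1 * norm (cls l1 (dv1 y))))"
      using \<gamma>1 \<delta>1 by (intro bd_cmult bd_add n1 n3) auto
    fix y assume y: "D y"
    have "cls l1 (dq y) = (- 1 / \<gamma>1) *\<^sub>R (cls l1 (sth (A y)) + \<delta>1 *\<^sub>R cls l1 (dv1 y))"
      using A_cls(3)[OF y] \<gamma>1 by simp
    then have "norm (cls l1 (dq y)) = 1 / \<gamma>1 * norm (cls l1 (sth (A y)) + \<delta>1 *\<^sub>R cls l1 (dv1 y))"
      using \<gamma>1 by simp
    also have "\<dots> \<le> 1 / \<gamma>1 * (norm (cls l1 (sth (A y))) + \<delta>1 * norm (cls l1 (dv1 y)))"
      using \<gamma>1 \<delta>1 norm_triangle_ineq[of "cls l1 (sth (A y))" "\<delta>1 *\<^sub>R cls l1 (dv1 y)"]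
      by (intro mult_left_mono) auto
    finally show "norm (cls l1 (dq y)) \<le> 1 / \<gamma>1 * (norm (cls l1 (sth (A y))) + \<delta>1 * norm (cls l1 (dv1 y)))" .
  qed
  \<comment> \<open>The flux has no boundary condition; its mean is read off the flux equation,
    where the temperature gradient integrates to \<open>0\<close>.\<close>
  have mq: "bd (\<lambda>y. cmod (integral {0..l1} (sq y)))"
  proof (rule bd_mono)
    show "bd (\<lambda>y. \<tau>1 * (sqrt l1 * norm (cls l1 (sq (A y)))))" using \<tau>1 l1 by (intro bd_cmult n4) auto
    fix y assume y: "D y"
    have L: "L2 l1 (sq (A y))" "L2 l1 (dth y)" "L2 l1 (sq y)"
      using inW_L2(4)[of "A y"] D_A_H[OF y] prim_L2[OF D_prims(10)[OF y]] prim_mult_L2[OF D_prims(11)[OF y]] by (auto simp: inH_iff)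
    have "integral {0..l1} (dth y) = 0"
      using prim_diff_eq[OF D_prims(10)[OF y], of 0 l1] D_bcs[OF y] l1 by simp
    moreover have "integral {0..l1} (sq (A y)) = - of_real (1 / \<tau>1) * integral {0..l1} (sq y) - of_real (\<kappa>1 / \<tau>1) * integral {0..l1} (dth y)"
      using integral_lin[OF L2_integrable_on[OF L(3)] L2_integrable_on[OF L(2)], of 0 l1 "- of_real (1 / \<tau>1)" "- of_real (\<kappa>1 / \<tau>1)"]
      by (simp add: A_sel)
    ultimately have "integral {0..l1} (sq y) = - of_real \<tau>1 * integral {0..l1} (sq (A y))" using \<tau>1 by simp
    then have "cmod (integral {0..l1} (sq y)) = \<tau>1 * cmod (integral {0..l1} (sq (A y)))" using \<tau>1 by (simp add: norm_mult)
    also have "\<dots> \<le> \<tau>1 * (sqrt l1 * norm (cls l1 (sq (A y))))"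
      using norm_integral_L2_le[OF L(1), of 0 l1] \<tau>1 l1 by (intro mult_left_mono) auto
    finally show "cmod (integral {0..l1} (sq y)) \<le> \<tau>1 * (sqrt l1 * norm (cls l1 (sq (A y))))" .
  qed
  show bq: "bs l1 sq" by (rule bs_mean[OF l1], erule D_prims(11), rule mq, rule nq)
  have nq0: "bd (\<lambda>y. norm (cls l1 (sq y)))" by (rule bd_of_bs[OF l1], erule cont(3), rule bq)
  show nt: "bd (\<lambda>y. norm (cls l1 (dth y)))"
  proof (rule bd_mono)
    show "bd (\<lambda>y. 1 / \<kappa>1 * (\<tau>1 * norm (cls l1 (sq (A y))) + norm (cls l1 (sq y))))"
      using \<kappa>1 \<tau>1 by (intro bd_cmult bd_add n4 nq0) auto
    fix y assume y: "D y"
    have "cls l1 (dth y) = (- 1 / \<kappa>1) *\<^sub>R (\<tau>1 *\<^sub>R cls l1 (sq (A y)) + cls l1 (sq y))"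
      using A_cls(4)[OF y] \<kappa>1 \<tau>1 by (simp add: scaleR_diff_right)
    then have "norm (cls l1 (dth y)) = 1 / \<kappa>1 * norm (\<tau>1 *\<^sub>R cls l1 (sq (A y)) + cls l1 (sq y))"
      using \<kappa>1 by simp
    also have "\<dots> \<le> 1 / \<kappa>1 * (\<tau>1 * norm (cls l1 (sq (A y))) + norm (cls l1 (sq y)))"
      using \<kappa>1 \<tau>1 norm_triangle_ineq[of "\<tau>1 *\<^sub>R cls l1 (sq (A y))" "cls l1 (sq y)"]
      by (intro mult_left_mono) auto
    finally show "norm (cls l1 (dth y)) \<le> 1 / \<kappa>1 * (\<tau>1 * norm (cls l1 (sq (A y))) + norm (cls l1 (sq y)))" .
  qed
  show "bs l1 sth" by (rule bs_zero, erule D_prims(10), erule D_bcs(9), rule i0(1), rule nt)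
  show nu: "bd (\<lambda>y. norm (cls l1 (ddu1 y)))"
  proof (rule bd_mono)
    show "bd (\<lambda>y. 1 / \<alpha>1 * (norm (cls l1 (sv1 (A y))) + \<beta>1 * norm (cls l1 (dth y))))"
      using \<alpha>1 \<beta>1 by (intro bd_cmult bd_add n2 nt) auto
    fix y assume y: "D y"
    have "cls l1 (ddu1 y) = (1 / \<alpha>1) *\<^sub>R (cls l1 (sv1 (A y)) + \<beta>1 *\<^sub>R cls l1 (dth y))"
      using A_cls(1)[OF y] \<alpha>1 by simp
    then have "norm (cls l1 (ddu1 y)) = 1 / \<alpha>1 * norm (cls l1 (sv1 (A y)) + \<beta>1 *\<^sub>R cls l1 (dth y))"
      using \<alpha>1 by simp
    also have "\<dots> \<le> 1 / \<alpha>1 * (norm (cls l1 (sv1 (A y))) + \<beta>1 * norm (cls l1 (dth y)))"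
      using \<alpha>1 \<beta>1 norm_triangle_ineq[of "cls l1 (sv1 (A y))" "\<beta>1 *\<^sub>R cls l1 (dth y)"]
      by (intro mult_left_mono) auto
    finally show "norm (cls l1 (ddu1 y)) \<le> 1 / \<alpha>1 * (norm (cls l1 (sv1 (A y))) + \<beta>1 * norm (cls l1 (dth y)))" .
  qed
  have nb: "bd (\<lambda>y. norm (cls l2 (d4u2 y)))"
  proof (rule bd_mono)
    show "bd (\<lambda>y. 1 / \<alpha>2 * norm (cls l2 (sv2 (A y))))" using \<alpha>2 by (intro bd_cmult n6) auto
  qed (use A_cls(2) \<alpha>2 in simp)
  \<comment> \<open>Neither \<open>u1'\<close> nor \<open>u2'''\<close> has a prescribed zero.
    \<open>green\<close> tested with the displacements themselves couples string and beam, and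
    Poincare inequalities allow half of the left side to be absorbed.\<close>
  have ne: "bd (\<lambda>y. norm (cls l1 (du1 y)))"
  proof (rule bd_mono)
    let ?r = "\<lambda>y. l1 * norm (cls l1 (ddu1 y)) + sqrt (\<alpha>2 / k1) * (l2\<^sup>2 * norm (cls l2 (d4u2 y)))"
    show "bd ?r" using l1 k_pos \<alpha>2 by (intro bd_add bd_cmult nu nb) auto
    fix y assume y: "D y"
    define a b P R where "a = norm (cls l1 (du1 y))" and "b = norm (cls l2 (ddu2 y))"
      and "P = norm (cls l1 (ddu1 y))" and "R = norm (cls l2 (d4u2 y))"
    have nn: "a \<ge> 0" "b \<ge> 0" "P \<ge> 0" "R \<ge> 0" by (auto simp: a_def b_def P_def R_def)
    have u1: "norm (cls l1 (su1 y)) \<le> l1 * a"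
    proof -
      have "norm (cls l1 (su1 y)) \<le> sqrt l1 * (sqrt l1 * a)"
        unfolding a_def using l1
        by (intro sup_bound_cls[OF cont(1)[OF y]] prim_bound_zero[OF D_prims(1)[OF y] i0(2) D_bcs(1)[OF y]]) auto
      then show ?thesis using l1 by (simp add: mult.assoc[symmetric])
    qed
    have u2': "norm (cls l2 (du2 y)) \<le> l2 * b"
    proof -
      have "norm (cls l2 (du2 y)) \<le> sqrt l2 * (sqrt l2 * b)"
        unfolding b_def using l2
        by (intro sup_bound_cls[OF prim_continuous[OF D_prims(4)[OF y]]] prim_bound_zero[OF D_prims(4)[OF y] i0(3) D_bcs(4)[OF y]]) auto
      then show ?thesis using l2 by (simp add: mult.assoc[symmetric])
    qed
    have u2: "norm (cls l2 (su2 y)) \<le> l2\<^sup>2 * b"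
    proof -
      have "norm (cls l2 (su2 y)) \<le> sqrt l2 * (sqrt l2 * norm (cls l2 (du2 y)))"
        using l2
        by (intro sup_bound_cls[OF prim_continuous[OF D_prims(3)[OF y]]] prim_bound_zero[OF D_prims(3)[OF y] i0(4) D_bcs(2)[OF y]]) auto
      also have "\<dots> = l2 * norm (cls l2 (du2 y))" using l2 by (simp add: mult.assoc[symmetric])
      also have "\<dots> \<le> l2 * (l2 * b)" using u2' l2 by (intro mult_left_mono) auto
      finally show ?thesis by (simp add: power2_eq_square mult.assoc)
    qed
    have V: "inV l1 l2 (su1 y) (su2 y)" using y by (simp add: D_iff)
    have "k1 * a\<^sup>2 + \<alpha>2 * b\<^sup>2 = - k1 * inner (cls l1 (ddu1 y)) (cls l1 (su1 y))
      + \<alpha>2 * inner (cls l2 (d4u2 y)) (cls l2 (su2 y))"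
      using green[OF y V] by (simp add: a_def b_def power2_norm_eq_inner)
    also have "\<dots> \<le> k1 * (P * (l1 * a)) + \<alpha>2 * (R * (l2\<^sup>2 * b))"
    proof -
      have i1: "\<bar>inner (cls l1 (ddu1 y)) (cls l1 (su1 y))\<bar> \<le> P * (l1 * a)"
        using Cauchy_Schwarz_ineq2 mult_left_mono[OF u1 nn(3)] unfolding P_def by (rule order_trans)
      have i2: "\<bar>inner (cls l2 (d4u2 y)) (cls l2 (su2 y))\<bar> \<le> R * (l2\<^sup>2 * b)"
        using Cauchy_Schwarz_ineq2 mult_left_mono[OF u2 nn(4)] unfolding R_def by (rule order_trans)
      have j1: "k1 * (- inner (cls l1 (ddu1 y)) (cls l1 (su1 y))) \<le> k1 * (P * (l1 * a))"
        using i1 k_pos by (intro mult_left_mono) auto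
      have j2: "\<alpha>2 * inner (cls l2 (d4u2 y)) (cls l2 (su2 y)) \<le> \<alpha>2 * (R * (l2\<^sup>2 * b))"
        using i2 \<alpha>2 by (intro mult_left_mono) auto
      show ?thesis using j1 j2 by simp
    qed
    finally have 0: "k1 * a\<^sup>2 + \<alpha>2 * b\<^sup>2 \<le> k1 * (P * (l1 * a)) + \<alpha>2 * (R * (l2\<^sup>2 * b))" .
    have 1: "k1 * (P * (l1 * a)) \<le> k1 * ((a\<^sup>2 + (l1 * P)\<^sup>2) / 2)"
      using k_pos sum_squares_bound[of a "l1 * P"] by (intro mult_left_mono) (auto simp: mult_ac)
    have 2: "\<alpha>2 * (R * (l2\<^sup>2 * b)) \<le> \<alpha>2 * ((b\<^sup>2 + (l2\<^sup>2 * R)\<^sup>2) / 2)"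
      using \<alpha>2 sum_squares_bound[of b "l2\<^sup>2 * R"] by (intro mult_left_mono) (auto simp: mult_ac)
    have 3: "k1 * ((a\<^sup>2 + (l1 * P)\<^sup>2) / 2) + \<alpha>2 * ((b\<^sup>2 + (l2\<^sup>2 * R)\<^sup>2) / 2)
        = (k1 * a\<^sup>2 + \<alpha>2 * b\<^sup>2) / 2 + (k1 * (l1 * P)\<^sup>2 + \<alpha>2 * (l2\<^sup>2 * R)\<^sup>2) / 2"
      by (simp only: distrib_left add_divide_distrib times_divide_eq_right add_ac)
    have "k1 * a\<^sup>2 + \<alpha>2 * b\<^sup>2 \<le> k1 * (l1 * P)\<^sup>2 + \<alpha>2 * (l2\<^sup>2 * R)\<^sup>2"
    proof -
      have "S \<le> Z" if "S \<le> X + Y" "X \<le> X'" "Y \<le> Y'" "X' + Y' = S / 2 + Z / 2" for S X Y X' Y' Z :: real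
        using that by linarith
      from this[OF 0 1 2 3] show ?thesis .
    qed
    moreover have "0 \<le> \<alpha>2 * b\<^sup>2" using \<alpha>2 by simp
    ultimately have "k1 * a\<^sup>2 \<le> k1 * (l1 * P)\<^sup>2 + \<alpha>2 * (l2\<^sup>2 * R)\<^sup>2" by linarith
    then have "a\<^sup>2 \<le> (l1 * P)\<^sup>2 + \<alpha>2 / k1 * (l2\<^sup>2 * R)\<^sup>2" using k_pos by (simp add: field_simps)
    also have "\<dots> = (l1 * P)\<^sup>2 + (sqrt (\<alpha>2 / k1) * (l2\<^sup>2 * R))\<^sup>2"
      using k_pos \<alpha>2 by (simp add: power_mult_distrib)
    also have "\<dots> \<le> (l1 * P + sqrt (\<alpha>2 / k1) * (l2\<^sup>2 * R))\<^sup>2"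
      using l1 k_pos \<alpha>2 nn by (simp add: power2_sum)
    finally have sq: "a\<^sup>2 \<le> (l1 * P + sqrt (\<alpha>2 / k1) * (l2\<^sup>2 * R))\<^sup>2" .
    have "0 \<le> l1 * P + sqrt (\<alpha>2 / k1) * (l2\<^sup>2 * R)"
      using l1 k_pos(1) \<alpha>2 nn by (intro add_nonneg_nonneg mult_nonneg_nonneg) auto
    from power2_le_imp_le[OF sq this] show "norm (cls l1 (du1 y)) \<le> ?r y"
      by (simp only: a_def P_def R_def)
  qed
  have mu: "bd (\<lambda>y. cmod (integral {0..l1} (du1 y)))"
  proof (rule bd_mono)
    show "bd (\<lambda>y. sqrt l1 * norm (cls l1 (du1 y)))" using l1 by (intro bd_cmult ne) auto
    show "cmod (integral {0..l1} (du1 y)) \<le> sqrt l1 * norm (cls l1 (du1 y))" if "D y" for y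
      using norm_integral_L2_le[OF prim_L2[OF D_prims(1)[OF that]], of 0 l1] l1 by simp
  qed
  show bu: "bs l1 (\<lambda>y. du1 y)" by (rule bs_mean[OF l1], erule D_prims(2), rule mu, rule nu)
  \<comment> \<open>The transmission condition carries the trace of \<open>u1'\<close> over to
    \<open>u2'''\<close>, which starts the bounds for the beam.\<close>
  have z3: "bd (\<lambda>y. cmod (d3u2 y 0))"
  proof (rule bd_mono)
    show "bd (\<lambda>y. k1 / \<alpha>2 * cmod (du1 y 0))" using k_pos \<alpha>2 by (intro bd_cmult bs_at[OF bu] i0) auto
    fix y assume "D y"
    have "\<alpha>2 * cmod (d3u2 y 0) = cmod (of_real \<alpha>2 * d3u2 y 0)"
      using \<alpha>2 by (simp add: norm_mult)
    also have "\<dots> = k1 * cmod (du1 y 0)" unfolding D_bcs(12)[OF \<open>D y\<close>] using k_pos by (simp add: norm_mult)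
    finally show "cmod (d3u2 y 0) \<le> k1 / \<alpha>2 * cmod (du1 y 0)"
      using \<alpha>2 by (simp add: field_simps)
  qed
  have b3: "bs l2 (\<lambda>y. d3u2 y)" by (rule bs_point, erule D_prims(6), rule i0(3), rule z3, rule nb)
  show n7: "bd (\<lambda>y. norm (cls l2 (d3u2 y)))" by (rule bd_of_bs[OF l2], erule cont(4), rule b3)
  show "bs l2 (\<lambda>y. ddu2 y)" by (rule bs_zero, erule D_prims(5), erule D_bcs(11), rule i0(4), rule n7)
qed

lemma norm_tuple_le: "norm (a, b, c, d, e, f) \<le> norm a + norm b + norm c + norm d + norm e + norm f"
proof -
  have P: "norm (x, y) \<le> norm x + norm y" for x :: "'x::real_normed_vector" and y :: "'y::real_normed_vector"
    by (simp add: norm_Pair sqrt_add_le_add_sqrt[of "(norm x)\<^sup>2" "(norm y)\<^sup>2", simplified])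
  show ?thesis using P[of a "(b, c, d, e, f)"] P[of b "(c, d, e, f)"] P[of c "(d, e, f)"] P[of d "(e, f)"] P[of e f]
    by linarith
qed

lemma bd_E: "bd (\<lambda>y. norm (E y))"
proof (rule bd_mono)
  note c = D_prims[THEN prim_continuous]
  show "norm (E y) \<le> sqrt k1 * norm (cls l1 (du1 y)) + sqrt k2 * norm (cls l1 (sv1 y)) + norm (cls l1 (sth y))
     + sqrt k4 * norm (cls l1 (sq y)) + sqrt \<alpha>2 * norm (cls l2 (ddu2 y)) + norm (cls l2 (sv2 y))" for y
    unfolding E_def by (rule order_trans[OF norm_tuple_le]) (use k_pos \<alpha>2 in simp)
  have b: "bd (\<lambda>y. norm (cls l1 (du1 y)))" "bd (\<lambda>y. norm (cls l1 (sv1 y)))" "bd (\<lambda>y. norm (cls l1 (sth y)))"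
    "bd (\<lambda>y. norm (cls l1 (sq y)))" "bd (\<lambda>y. norm (cls l2 (ddu2 y)))" "bd (\<lambda>y. norm (cls l2 (sv2 y)))"
    by (rule bd_of_bs[OF l1], erule c(2), rule D_bounds(1), rule bd_of_bs[OF l1], erule c(7), rule D_bounds(3),
      rule bd_of_bs[OF l1], erule c(10), rule D_bounds(5), rule bd_of_bs[OF l1], erule c(11), rule D_bounds(7),
      rule bd_of_bs[OF l2], erule c(5), rule D_bounds(9), rule bd_of_bs[OF l2], erule c(8), rule D_bounds(11))
  show "bd (\<lambda>y. sqrt k1 * norm (cls l1 (du1 y)) + sqrt k2 * norm (cls l1 (sv1 y)) + norm (cls l1 (sth y))
     + sqrt k4 * norm (cls l1 (sq y)) + sqrt \<alpha>2 * norm (cls l2 (ddu2 y)) + norm (cls l2 (sv2 y)))"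
    using k_pos \<alpha>2 by (intro bd_add bd_cmult b) auto
qed

section \<open>Compactness\<close>

text \<open>Sequential compactness of the map from \<open>A y\<close> to \<open>\<phi> y\<close>,
  stated on the domain before the inverse is available as an operator; the components of
  \<open>E\<close> can then be treated one at a time.\<close>

definition cpt :: "(st \<Rightarrow> 'b::real_normed_vector) \<Rightarrow> bool" where
  "cpt \<phi> \<longleftrightarrow> (\<forall>R y. (\<forall>n::nat. D (y n) \<and> norm (E (A (y n))) \<le> R) \<longrightarrow>
      (\<exists>r. strict_mono (r :: nat \<Rightarrow> nat) \<and> convergent (\<lambda>n. \<phi> (y (r n)))))"

lemma cpt_scaleR: "cpt \<phi> \<Longrightarrow> cpt (\<lambda>y. c *\<^sub>R \<phi> y)"
  unfolding cpt_def convergent_def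
proof (intro allI impI)
  fix R and y :: "nat \<Rightarrow> st"
  assume *: "\<forall>R y. (\<forall>n. D (y n) \<and> norm (E (A (y n))) \<le> R) \<longrightarrow>
      (\<exists>r. strict_mono (r :: nat \<Rightarrow> nat) \<and> (\<exists>L. (\<lambda>n. \<phi> (y (r n))) \<longlonglongrightarrow> L))"
    and "\<forall>n. D (y n) \<and> norm (E (A (y n))) \<le> R"
  then obtain r L where "strict_mono (r :: nat \<Rightarrow> nat)" "(\<lambda>n. \<phi> (y (r n))) \<longlonglongrightarrow> L" by blast
  then show "\<exists>r. strict_mono (r :: nat \<Rightarrow> nat) \<and> (\<exists>L. (\<lambda>n. c *\<^sub>R \<phi> (y (r n))) \<longlonglongrightarrow> L)"
    using tendsto_scaleR[OF tendsto_const] by blast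
qed

lemma cpt_Pair:
  assumes "cpt \<phi>" "cpt \<psi>"
  shows "cpt (\<lambda>y. (\<phi> y, \<psi> y))"
  unfolding cpt_def
proof (intro allI impI)
  fix R and y :: "nat \<Rightarrow> st" assume y: "\<forall>n. D (y n) \<and> norm (E (A (y n))) \<le> R"
  then obtain r where r: "strict_mono (r :: nat \<Rightarrow> nat)" "convergent (\<lambda>n. \<phi> (y (r n)))"
    using assms(1) unfolding cpt_def by blast
  have "\<forall>n. D (y (r n)) \<and> norm (E (A (y (r n)))) \<le> R" using y by blast
  then obtain s where s: "strict_mono (s :: nat \<Rightarrow> nat)" "convergent (\<lambda>n. \<psi> (y (r (s n))))"
    using assms(2)[unfolded cpt_def, rule_format, of "\<lambda>n. y (r n)" R] by blast
  obtain a where "(\<lambda>n. \<phi> (y (r n))) \<longlonglongrightarrow> a" using r by (auto simp: convergent_def)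
  from LIMSEQ_subseq_LIMSEQ[OF this s(1)] have "(\<lambda>n. \<phi> (y (r (s n)))) \<longlonglongrightarrow> a" by (simp add: o_def)
  moreover obtain b where "(\<lambda>n. \<psi> (y (r (s n)))) \<longlonglongrightarrow> b" using s by (auto simp: convergent_def)
  ultimately have "convergent (\<lambda>n. (\<phi> (y (r (s n))), \<psi> (y (r (s n)))))"
    using tendsto_Pair convergentI by blast
  then show "\<exists>r. strict_mono (r :: nat \<Rightarrow> nat) \<and> convergent (\<lambda>n. (\<phi> (y (r n)), \<psi> (y (r n))))"
    using strict_mono_o[OF r(1) s(1)] by (intro exI[of _ "r \<circ> s"]) simp
qed

text \<open>Uniform bounds and Hoelder continuity give a uniformly convergent subsequence by
  Arzela--Ascoli; on a bounded interval this implies convergence in mean square.\<close>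

lemma cpt_cls:
  assumes l: "l > 0" and p: "\<And>y. D y \<Longrightarrow> prim l (\<phi> y) (\<psi> y)"
    and b: "bs l \<phi>" "bd (\<lambda>y. norm (cls l (\<psi> y)))"
  shows "cpt (\<lambda>y. cls l (\<phi> y))"
  unfolding cpt_def
proof (intro allI impI)
  fix R and y :: "nat \<Rightarrow> st" assume y: "\<forall>n. D (y n) \<and> norm (E (A (y n))) \<le> R"
  have R: "R \<ge> 0" using y norm_ge_zero order_trans by blast
  obtain K where K: "K \<ge> 0" "\<And>y x. D y \<Longrightarrow> x \<in> {0..l} \<Longrightarrow> cmod (\<phi> y x) \<le> K * norm (E (A y))"
    using b(1) unfolding bs_def by blast
  obtain M where M: "M \<ge> 0" "\<And>y. D y \<Longrightarrow> norm (cls l (\<psi> y)) \<le> M * norm (E (A y))"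
    using b(2) unfolding bd_def by blast
  \<comment> \<open>The summand \<open>1\<close> keeps the Hoelder constant positive, as it becomes
    a divisor in the modulus of continuity \<open>(e / C)\<^sup>2\<close>.\<close>
  define C where "C = M * R + 1"
  have C: "C > 0" using M R by (simp add: C_def add_nonneg_pos)
  have Kb: "norm (\<phi> (y n) x) \<le> K * R" if "x \<in> {0..l}" for n x
    using K(2)[of "y n" x] that y mult_left_mono[OF _ K(1), of "norm (E (A (y n)))" R] by fastforce
  have Mb: "norm (cls l (\<psi> (y n))) \<le> C" for n
    using M(2)[of "y n"] y mult_left_mono[OF _ M(1), of "norm (E (A (y n)))" R] unfolding C_def by fastforce
  have eq: "\<exists>d. 0 < d \<and> (\<forall>n z. z \<in> {0..l} \<and> norm (x - z) < d \<longrightarrow> norm (\<phi> (y n) x - \<phi> (y n) z) < e)"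
    if x: "x \<in> {0..l}" and e: "0 < e" for x e
  proof (intro exI[of _ "(e / C)\<^sup>2"] conjI allI impI)
    show "0 < (e / C)\<^sup>2" using e C by simp
    fix n z assume z: "z \<in> {0..l} \<and> norm (x - z) < (e / C)\<^sup>2"
    have "norm (\<phi> (y n) x - \<phi> (y n) z) \<le> sqrt \<bar>x - z\<bar> * norm (cls l (\<psi> (y n)))"
      using prim_diff_bound[OF p, of "y n" z x] y z x by blast
    also have "\<dots> \<le> sqrt \<bar>x - z\<bar> * C" using Mb by (intro mult_left_mono) auto
    also have "\<dots> < (e / C) * C"
    proof (intro mult_strict_right_mono C)
      have "sqrt \<bar>x - z\<bar> < sqrt ((e / C)\<^sup>2)" using z by (intro real_sqrt_less_mono) simp
      then show "sqrt \<bar>x - z\<bar> < e / C" using e C by simp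
    qed
    finally show "norm (\<phi> (y n) x - \<phi> (y n) z) < e" using C by simp
  qed
  obtain g k where g: "continuous_on {0..l} g" "strict_mono (k :: nat \<Rightarrow> nat)"
    and u: "\<And>e. 0 < e \<Longrightarrow> \<exists>N. \<forall>n x. n \<ge> N \<and> x \<in> {0..l} \<longrightarrow> norm (\<phi> (y (k n)) x - g x) < e"
    using Arzela_Ascoli[of "{0..l}" "\<lambda>n. \<phi> (y n)" "K * R", OF compact_Icc Kb eq] by blast
  have "(\<lambda>n. cls l (\<phi> (y (k n)))) \<longlonglongrightarrow> cls l g"
    unfolding LIMSEQ_iff
  proof (intro allI impI)
    fix e :: real assume e: "e > 0"
    define e' where "e' = e / (2 * sqrt l)"
    have e': "e' > 0" using e l by (simp add: e'_def)
    obtain N where N: "\<And>n x. n \<ge> N \<Longrightarrow> x \<in> {0..l} \<Longrightarrow> norm (\<phi> (y (k n)) x - g x) < e'"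
      using u[OF e'] by blast
    have "norm (cls l (\<phi> (y (k n))) - cls l g) < e" if n: "n \<ge> N" for n
    proof -
      have c: "continuous_on {0..l} (\<phi> (y (k n)))" using prim_continuous[OF p] y by blast
      have "norm (cls l (\<phi> (y (k n))) - cls l g) = norm (cls l (\<lambda>x. \<phi> (y (k n)) x - g x))"
        using c g by (subst cls_diff) (auto intro: L2_continuous)
      also have "\<dots> \<le> sqrt l * e'"
        using N[OF n] e' c g by (intro sup_bound_cls[OF _ l] continuous_intros less_imp_le) auto
      also have "\<dots> = e / 2" using l by (simp add: e'_def)
      finally show ?thesis using e by simp
    qed
    then show "\<exists>no. \<forall>n\<ge>no. norm (cls l (\<phi> (y (k n))) - cls l g) < e" by blast
  qed
  then show "\<exists>r. strict_mono (r :: nat \<Rightarrow> nat) \<and> convergent (\<lambda>n. cls l (\<phi> (y (r n))))"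
    using g(2) convergentI by blast
qed

lemma cpt_E: "cpt E"
proof -
  have "cpt (\<lambda>y. cls l1 (du1 y))" by (rule cpt_cls[OF l1], erule D_prims(2), rule D_bounds(1), rule D_bounds(2))
  moreover have "cpt (\<lambda>y. cls l1 (sv1 y))" by (rule cpt_cls[OF l1], erule D_prims(7), rule D_bounds(3), rule D_bounds(4))
  moreover have "cpt (\<lambda>y. cls l1 (sth y))" by (rule cpt_cls[OF l1], erule D_prims(10), rule D_bounds(5), rule D_bounds(6))
  moreover have "cpt (\<lambda>y. cls l1 (sq y))" by (rule cpt_cls[OF l1], erule D_prims(11), rule D_bounds(7), rule D_bounds(8))
  moreover have "cpt (\<lambda>y. cls l2 (ddu2 y))" by (rule cpt_cls[OF l2], erule D_prims(5), rule D_bounds(9), rule D_bounds(10))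
  moreover have "cpt (\<lambda>y. cls l2 (sv2 y))" by (rule cpt_cls[OF l2], erule D_prims(8), rule D_bounds(11), rule D_bounds(12))
  ultimately show ?thesis unfolding E_def by (intro cpt_Pair cpt_scaleR)
qed

section \<open>The closed subspace of attained states and the bounded inverse\<close>

definition Hs :: "hs set" where "Hs = E ` {y. H y}"

lemma E_Hs: "H y \<Longrightarrow> E y \<in> Hs"
  by (simp add: Hs_def)

lemma H_inW: "H y \<Longrightarrow> inW y"
  by (simp add: inH_iff)

text \<open>Traces at \<open>0\<close> are controlled by the energy through the zeros of
  \<open>u1\<close> and \<open>u2\<close> at the outer ends and of \<open>u2'\<close> at
  \<open>0\<close>. Hence the coupling condition survives limits in energy.\<close>

lemma coupling_bound: "\<exists>K. \<forall>y. inW y \<longrightarrow> cmod (su1 y 0 - su2 y 0) \<le> K * norm (E y)"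
proof (intro exI allI impI)
  fix y assume y: "inW y"
  then have p: "prim l1 (su1 y) (du1 y)" "prim l2 (su2 y) (du2 y)"
    "prim l2 (du2 y) (ddu2 y)" "su1 y l1 = 0" "su2 y l2 = 0" "du2 y 0 = 0"
    unfolding inW_def by blast+
  have i0: "0 \<in> {0..l1}" "l1 \<in> {0..l1}" "0 \<in> {0..l2}" "l2 \<in> {0..l2}" using l1 l2 by auto
  have "cmod (su1 y 0) \<le> sqrt l1 * norm (cls l1 (du1 y))"
    by (rule prim_bound_zero[OF p(1) i0(2) p(4) i0(1)])
  also have "\<dots> \<le> sqrt l1 * (norm (E y) / sqrt k1)"
    using E_components_le(1)[of y] k_pos l1 by (intro mult_left_mono) (auto simp: field_simps)
  finally have 1: "cmod (su1 y 0) \<le> sqrt l1 / sqrt k1 * norm (E y)" by simp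
  have "cmod (su2 y 0) \<le> sqrt l2 * norm (cls l2 (du2 y))"
    by (rule prim_bound_zero[OF p(2) i0(4) p(5) i0(3)])
  also have "\<dots> \<le> sqrt l2 * (sqrt l2 * (sqrt l2 * norm (cls l2 (ddu2 y))))"
    using l2 by (intro mult_left_mono sup_bound_cls[OF prim_continuous[OF p(3)]] prim_bound_zero[OF p(3) i0(3) p(6)]) auto
  also have "\<dots> \<le> sqrt l2 * (sqrt l2 * (sqrt l2 * (norm (E y) / sqrt \<alpha>2)))"
    using E_components_le(5)[of y] \<alpha>2 l2 by (intro mult_left_mono) (auto simp: field_simps)
  finally have 2: "cmod (su2 y 0) \<le> sqrt l2 * sqrt l2 * sqrt l2 / sqrt \<alpha>2 * norm (E y)"
    by (simp only: times_divide_eq_right times_divide_eq_left mult.assoc)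
  have "cmod (su1 y 0 - su2 y 0) \<le> cmod (su1 y 0) + cmod (su2 y 0)" by (rule norm_triangle_ineq4)
  also have "\<dots> \<le> (sqrt l1 / sqrt k1 + sqrt l2 * sqrt l2 * sqrt l2 / sqrt \<alpha>2) * norm (E y)"
    using 1 2 by (simp only: distrib_right)
  finally show "cmod (su1 y 0 - su2 y 0) \<le> (sqrt l1 / sqrt k1 + sqrt l2 * sqrt l2 * sqrt l2 / sqrt \<alpha>2) * norm (E y)" .
qed

lemma closed_Hs: "closed Hs"
  unfolding closed_sequential_limits
proof (intro allI impI, elim conjE)
  fix X :: "nat \<Rightarrow> hs" and x assume X: "\<forall>n. X n \<in> Hs" and lim: "X \<longlonglongrightarrow> x"
  then have "\<forall>n. \<exists>y. H y \<and> X n = E y" unfolding Hs_def by blast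
  then obtain y where y: "\<And>n. H (y n)" "\<And>n. X n = E (y n)" by metis
  have W: "inW (y n)" for n using y(1) H_inW by blast
  note L = inW_L2[OF W]
  obtain x1 x2 x3 x4 x5 x6 where x: "x = (x1, x2, x3, x4, x5, x6)" by (metis prod_cases6)
  have XE: "X = (\<lambda>n. E (y n))" using y(2) by auto
  have l2': "(\<lambda>n. snd (X n)) \<longlonglongrightarrow> snd x" by (rule tendsto_snd[OF lim])
  have l3': "(\<lambda>n. snd (snd (X n))) \<longlonglongrightarrow> snd (snd x)" by (rule tendsto_snd[OF l2'])
  have l4': "(\<lambda>n. snd (snd (snd (X n)))) \<longlonglongrightarrow> snd (snd (snd x))" by (rule tendsto_snd[OF l3'])
  have l5': "(\<lambda>n. snd (snd (snd (snd (X n))))) \<longlonglongrightarrow> snd (snd (snd (snd x)))" by (rule tendsto_snd[OF l4'])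
  have lims: "(\<lambda>n. sqrt k1 *\<^sub>R cls l1 (du1 (y n))) \<longlonglongrightarrow> x1" "(\<lambda>n. sqrt k2 *\<^sub>R cls l1 (sv1 (y n))) \<longlonglongrightarrow> x2"
    "(\<lambda>n. cls l1 (sth (y n))) \<longlonglongrightarrow> x3" "(\<lambda>n. sqrt k4 *\<^sub>R cls l1 (sq (y n))) \<longlonglongrightarrow> x4"
    "(\<lambda>n. sqrt \<alpha>2 *\<^sub>R cls l2 (ddu2 (y n))) \<longlonglongrightarrow> x5" "(\<lambda>n. cls l2 (sv2 (y n))) \<longlonglongrightarrow> x6"
    using tendsto_fst[OF lim] tendsto_fst[OF l2'] tendsto_fst[OF l3'] tendsto_fst[OF l4'] tendsto_fst[OF l5'] tendsto_snd[OF l5']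
    by (simp_all add: x XE E_def)
  have unscale: "\<exists>h. L2 l h \<and> z = c *\<^sub>R cls l h" if "c > 0" "\<And>n. L2 l (g n)" "(\<lambda>n. c *\<^sub>R cls l (g n)) \<longlonglongrightarrow> z" for c l g z
  proof -
    have "(\<lambda>n. cls l (g n)) \<longlonglongrightarrow> (1 / c) *\<^sub>R z"
      using tendsto_scaleR[OF tendsto_const that(3), of "1 / c"] that(1) by simp
    from range_cls_closed[OF that(2) this] obtain h where "L2 l h" "(1 / c) *\<^sub>R z = cls l h" by blast
    then have "c *\<^sub>R ((1 / c) *\<^sub>R z) = c *\<^sub>R cls l h" by simp
    then show ?thesis using that(1) \<open>L2 l h\<close> by auto
  qed
  have sp: "sqrt k1 > 0" "sqrt k2 > 0" "sqrt k4 > 0" "sqrt \<alpha>2 > 0" using k_pos \<alpha>2 by auto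
  obtain a where a: "L2 l1 a" "x1 = sqrt k1 *\<^sub>R cls l1 a" using unscale[OF sp(1) L(1) lims(1)] by blast
  obtain v where v: "L2 l1 v" "x2 = sqrt k2 *\<^sub>R cls l1 v" using unscale[OF sp(2) L(2) lims(2)] by blast
  obtain h where h: "L2 l1 h" "x3 = cls l1 h" using range_cls_closed[OF L(3) lims(3)] by blast
  obtain q where q: "L2 l1 q" "x4 = sqrt k4 *\<^sub>R cls l1 q" using unscale[OF sp(3) L(4) lims(4)] by blast
  obtain b where b: "L2 l2 b" "x5 = sqrt \<alpha>2 *\<^sub>R cls l2 b" using unscale[OF sp(4) L(5) lims(5)] by blast
  obtain v' where v': "L2 l2 v'" "x6 = cls l2 v'" using range_cls_closed[OF L(6) lims(6)] by blast
  \<comment> \<open>The limit state is rebuilt from the limits of \<open>u1'\<close> and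
    \<open>u2''\<close> with the prescribed boundary values. The coupling at \<open>0\<close> is not
    built in; it follows from the trace bound for differences with the approximating states.\<close>
  define u1 where "u1 = (\<lambda>x. - integral {0..l1} a + integral {0..x} a)"
  define b1 where "b1 = (\<lambda>x. 0 + integral {0..x} b)"
  define u2 where "u2 = (\<lambda>x. - integral {0..l2} b1 + integral {0..x} b1)"
  have u1: "prim l1 u1 a" unfolding u1_def by (rule prim_integral[OF a(1)])
  have b1: "prim l2 b1 b" unfolding b1_def by (rule prim_integral[OF b(1)])
  have u2: "prim l2 u2 b1" unfolding u2_def by (rule prim_integral[OF prim_mult_L2[OF b1]])
  define z where "z = \<lparr>su1 = u1, su2 = u2, sv1 = v, sv2 = v', sth = h, sq = q\<rparr>"
  have sel: "su1 z = u1" "su2 z = u2" "sv1 z = v" "sv2 z = v'" "sth z = h" "sq z = q" by (simp_all add: z_def)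
  note c = prim_chain2[OF l2 u2 b1]
  have bc: "u1 l1 = 0" "u2 l2 = 0" "b1 0 = 0" by (simp_all add: u1_def u2_def b1_def)
  have zW: "inW z"
    unfolding inW_def sel using prim_self[OF l1 u1] c(1,3) c(2)[of 0] bc v v' h q l2 by simp
  have "cls l1 (Dw l1 u1) = cls l1 a"
    using cls_eq_iff[of l1 "Dw l1 u1" a] prim_Dw[OF l1 u1] inW_L2(1)[OF zW] a by (simp add: sel)
  moreover have "cls l2 (Dw l2 (Dw l2 u2)) = cls l2 b"
    using cls_eq_iff[of l2 "Dw l2 (Dw l2 u2)" b] c(4) inW_L2(5)[OF zW] b by (simp add: sel)
  ultimately have Ez: "E z = x" unfolding E_def sel x using a v h q b v' by simp
  obtain K where K: "\<And>y. inW y \<Longrightarrow> cmod (su1 y 0 - su2 y 0) \<le> K * norm (E y)" using coupling_bound by blast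
  have "(\<lambda>n. K * norm (E z - E (y n))) \<longlonglongrightarrow> 0"
    using tendsto_norm[OF tendsto_diff[OF tendsto_const lim], of x]
    by (intro tendsto_mult_right_zero) (simp add: XE Ez)
  moreover have "cmod (su1 z 0 - su2 z 0) \<le> K * norm (E z - E (y n))" for n
  proof -
    have "su1 (y n) 0 = su2 (y n) 0" using y(1)[of n] by (simp add: inH_iff)
    then have "su1 z 0 - su2 z 0 = su1 (st_lin 1 z (-1) (y n)) 0 - su2 (st_lin 1 z (-1) (y n)) 0" by simp
    then show ?thesis using K[OF E_lin(1)[OF zW W[of n]], of 1 "-1"] E_lin(2)[OF zW W[of n], of 1 "-1"]
      by (simp add: cm_one cm_minus_one)
  qed
  ultimately have "cmod (su1 z 0 - su2 z 0) \<le> 0" by (intro LIMSEQ_le_const) auto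
  then have "H z" using zW by (simp add: inH_iff)
  then show "x \<in> Hs" using Ez E_Hs by metis
qed

lemma cm_zero: "cm 0 x = 0"
  using cm_of_real[of 0 x] by simp

lemma Hs_lin: "x \<in> Hs \<Longrightarrow> y \<in> Hs \<Longrightarrow> cm a x + cm b y \<in> Hs"
  unfolding Hs_def using E_lin(2) st_lin_H H_inW by (smt (verit) image_iff mem_Collect_eq)

lemma Hs_cm: "x \<in> Hs \<Longrightarrow> cm c x \<in> Hs"
  using Hs_lin[of x x c 0] by (simp add: cm_zero)

lemma subspace_Hs: "subspace Hs"
proof -
  have p: "prim l (\<lambda>x. 0) (\<lambda>x. 0)" for l by (simp add: prim_def L2_zero)
  define z where "z = \<lparr>su1 = (\<lambda>x. 0 :: complex), su2 = (\<lambda>x. 0), sv1 = (\<lambda>x. 0), sv2 = (\<lambda>x. 0), sth = (\<lambda>x. 0), sq = (\<lambda>x. 0)\<rparr>"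
  have "H z"
    unfolding inH_iff inW_def z_def
    using prim_chain2[OF l1 p p] prim_chain2[OF l2 p p] l2 by (simp add: L2_zero)
  then have z: "E z \<in> Hs" by (rule E_Hs)
  have "0 \<in> Hs" using Hs_cm[OF z, of 0] by (simp add: cm_zero)
  moreover have "x + y \<in> Hs" if "x \<in> Hs" "y \<in> Hs" for x y
    using Hs_lin[OF that, of 1 1] by (simp add: cm_one)
  moreover have "r *\<^sub>R x \<in> Hs" if "x \<in> Hs" for x r
    using Hs_cm[OF that, of "of_real r"] by (simp add: cm_of_real)
  ultimately show ?thesis by (simp add: subspace_def)
qed

text \<open>The a priori bound for the difference, available by linearity of the domain and of
  \<open>A\<close>, shows that \<open>E y\<close> depends on \<open>E (A y)\<close> alone; this
  makes the choice in \<open>B\<close> immaterial.\<close>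

lemma E_inj_A:
  assumes y: "D y" and z: "D z" and eq: "E (A y) = E (A z)"
  shows "E y = E z"
proof -
  obtain K where K: "\<And>y. D y \<Longrightarrow> norm (E y) \<le> K * norm (E (A y))" using bd_E unfolding bd_def by blast
  have "E (A (st_lin 1 y (-1) z)) = 0" using D_lin(2)[OF y z, of 1 "-1"] eq by (simp add: cm_one cm_minus_one)
  then have "E (st_lin 1 y (-1) z) = 0" using K[OF D_lin(1)[OF y z, of 1 "-1"]] by simp
  then show ?thesis using E_lin(2)[OF H_inW[OF D_H[OF y]] H_inW[OF D_H[OF z]], of 1 "-1"] by (simp add: cm_one cm_minus_one)
qed

definition B :: "hs \<Rightarrow> hs" where
  "B f = E (SOME y. D y \<and> E (A y) = f)"

lemma B_E:
  assumes "D y"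
  shows "B (E (A y)) = E y"
proof -
  have "D y \<and> E (A y) = E (A y)" using assms by simp
  from someI[of "\<lambda>z. D z \<and> E (A z) = E (A y)", OF this]
  show ?thesis unfolding B_def using E_inj_A[OF _ assms] by blast
qed

lemma Hs_cases:
  assumes "f \<in> Hs"
  obtains y where "D y" "f = E (A y)" "B f = E y"
proof -
  obtain g where g: "H g" "f = E g" using assms by (auto simp: Hs_def)
  then obtain y where y: "D y" "E (A y) = E g" using A_surj by blast
  have "f = E (A y)" using g y by simp
  then show thesis using that[OF y(1)] B_E[OF y(1)] by simp
qed

lemma B_lin:
  assumes "f \<in> Hs" "g \<in> Hs"
  shows "B (cm a f + cm b g) = cm a (B f) + cm b (B g)"
proof -
  obtain y where y: "D y" "f = E (A y)" "B f = E y" using Hs_cases[OF assms(1)] .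
  obtain z where z: "D z" "g = E (A z)" "B g = E z" using Hs_cases[OF assms(2)] .
  have "B (cm a f + cm b g) = E (st_lin a y b z)"
    using B_E[OF D_lin(1)[OF y(1) z(1)]] D_lin(2)[OF y(1) z(1)] y(2) z(2) by simp
  then show ?thesis using E_lin(2)[OF H_inW[OF D_H[OF y(1)]] H_inW[OF D_H[OF z(1)]]] y z by simp
qed

lemma B_cm: "f \<in> Hs \<Longrightarrow> B (cm c f) = cm c (B f)"
  using B_lin[of f f c 0] by (simp add: cm_zero)

section \<open>Injectivity and absence of imaginary spectrum\<close>

lemma E_eqD:
  assumes "E y = c *\<^sub>R E z"
  shows "cls l1 (du1 y) = c *\<^sub>R cls l1 (du1 z)" "cls l1 (sv1 y) = c *\<^sub>R cls l1 (sv1 z)"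
    "cls l1 (sth y) = c *\<^sub>R cls l1 (sth z)" "cls l1 (sq y) = c *\<^sub>R cls l1 (sq z)"
    "cls l2 (ddu2 y) = c *\<^sub>R cls l2 (ddu2 z)" "cls l2 (sv2 y) = c *\<^sub>R cls l2 (sv2 z)"
proof -
  have s: "a = c *\<^sub>R b" if "r > 0" "sqrt r *\<^sub>R a = c *\<^sub>R sqrt r *\<^sub>R b" for r and a b :: lsq
  proof -
    have "sqrt r *\<^sub>R (a - c *\<^sub>R b) = 0" using that(2) by (simp add: scaleR_diff_right mult.commute)
    then show ?thesis using that(1) by simp
  qed
  have e: "sqrt k1 *\<^sub>R cls l1 (du1 y) = c *\<^sub>R sqrt k1 *\<^sub>R cls l1 (du1 z)"
    "sqrt k2 *\<^sub>R cls l1 (sv1 y) = c *\<^sub>R sqrt k2 *\<^sub>R cls l1 (sv1 z)"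
    "cls l1 (sth y) = c *\<^sub>R cls l1 (sth z)"
    "sqrt k4 *\<^sub>R cls l1 (sq y) = c *\<^sub>R sqrt k4 *\<^sub>R cls l1 (sq z)"
    "sqrt \<alpha>2 *\<^sub>R cls l2 (ddu2 y) = c *\<^sub>R sqrt \<alpha>2 *\<^sub>R cls l2 (ddu2 z)"
    "cls l2 (sv2 y) = c *\<^sub>R cls l2 (sv2 z)"
    using assms unfolding E_def by (simp_all only: scaleR_Pair prod.inject)
  show "cls l1 (du1 y) = c *\<^sub>R cls l1 (du1 z)" "cls l1 (sv1 y) = c *\<^sub>R cls l1 (sv1 z)"
    "cls l1 (sth y) = c *\<^sub>R cls l1 (sth z)" "cls l1 (sq y) = c *\<^sub>R cls l1 (sq z)"
    "cls l2 (ddu2 y) = c *\<^sub>R cls l2 (ddu2 z)" "cls l2 (sv2 y) = c *\<^sub>R cls l2 (sv2 z)"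
    by (rule s[OF k_pos(1) e(1)], rule s[OF k_pos(2) e(2)], rule e(3), rule s[OF k_pos(3) e(4)],
      rule s[OF \<alpha>2 e(5)], rule e(6))
qed

lemma cls_zero_pt: "l > 0 \<Longrightarrow> prim l f g \<Longrightarrow> cls l f = 0 \<Longrightarrow> x \<in> {0..l} \<Longrightarrow> f x = 0"
  using aeq_zero_continuous[OF _ prim_continuous, of l f g x] cls_zero_iff[OF prim_mult_L2, of l f g] by blast

lemma cls_pt_zero: "l \<ge> 0 \<Longrightarrow> (\<And>x. x \<in> {0..l} \<Longrightarrow> f x = 0) \<Longrightarrow> cls l f = 0"
proof -
  assume "l \<ge> 0" and f: "\<And>x. x \<in> {0..l} \<Longrightarrow> f x = 0"
  have a: "aeq l f (\<lambda>x. 0)" by (rule aeq_pointwise) (rule f)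
  then show ?thesis using cls_zero[OF a] L2_aeq[OF L2_zero aeq_sym[OF a]] by blast
qed

lemma cls_Dw_zero: "l > 0 \<Longrightarrow> (\<And>x. x \<in> {0..l} \<Longrightarrow> f x = 0) \<Longrightarrow> cls l (Dw l f) = 0"
  using cls_pt_zero[of l "Dw l f"] Dw_zero[of l f] by simp

lemma prim_cls_zero:
  assumes "prim l f g" "cls l g = 0" "z \<in> {0..l}" "f z = 0" "x \<in> {0..l}"
  shows "f x = 0"
  using prim_bound_zero[OF assms(1,3,4,5)] assms(2) by simp

text \<open>Continuous functions with zero class vanish pointwise, hence so do the derivatives that
  enter \<open>A y\<close>. This is the injectivity of \<open>B\<close>.\<close>

lemma A_of_zero:
  assumes y: "D y" and E: "E y = 0"
  shows "E (A y) = 0"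
proof -
  have E0: "E y = 0 *\<^sub>R E y" using E by simp
  note z = E_eqD[OF E0, unfolded scaleR_zero_left]
  have l: "l1 \<ge> 0" "l2 \<ge> 0" using l1 l2 by auto
  have i0: "0 \<in> {0..l1}" "l1 \<in> {0..l1}" "0 \<in> {0..l2}" "l2 \<in> {0..l2}" using l1 l2 by auto
  have v1: "sv1 y x = 0" if "x \<in> {0..l1}" for x by (rule cls_zero_pt[OF l1 D_prims(7)[OF y] z(2) that])
  have th: "sth y x = 0" if "x \<in> {0..l1}" for x by (rule cls_zero_pt[OF l1 D_prims(10)[OF y] z(3) that])
  have q: "sq y x = 0" if "x \<in> {0..l1}" for x by (rule cls_zero_pt[OF l1 D_prims(11)[OF y] z(4) that])
  have v2: "sv2 y x = 0" if "x \<in> {0..l2}" for x by (rule cls_zero_pt[OF l2 D_prims(8)[OF y] z(6) that])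
  have u1: "du1 y x = 0" if "x \<in> {0..l1}" for x by (rule cls_zero_pt[OF l1 D_prims(2)[OF y] z(1) that])
  have u2: "ddu2 y x = 0" if "x \<in> {0..l2}" for x by (rule cls_zero_pt[OF l2 D_prims(5)[OF y] z(5) that])
  have d: "cls l1 (dv1 y) = 0" "cls l1 (dth y) = 0" "cls l1 (dq y) = 0" "cls l1 (ddu1 y) = 0"
    by (rule cls_Dw_zero[OF l1], erule v1, rule cls_Dw_zero[OF l1], erule th, rule cls_Dw_zero[OF l1], erule q,
      rule cls_Dw_zero[OF l1], erule u1)
  have e: "cls l2 (ddv2 y) = 0" "cls l2 (d4u2 y) = 0"
    by (rule cls_Dw_zero[OF l2], rule Dw_zero[OF l2], erule v2, assumption,
      rule cls_Dw_zero[OF l2], rule Dw_zero[OF l2], erule u2, assumption)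
  show ?thesis unfolding E_def A_cls[OF y] unfolding A_sel(1,2) using d e z by (simp add: zero_prod_def)
qed

text \<open>An undamped state has \<open>q = 0\<close>; the equations then kill \<open>\<theta>\<close>, \<open>v1\<close> and \<open>u1\<close> in turn.\<close>

lemma undamped:
  assumes y: "D y" and z: "D z" and c: "c \<noteq> 0" and E: "E (A y) = c *\<^sub>R E z"
    and q: "cls l1 (sq y) = 0" "cls l1 (sq z) = 0"
  shows "cls l1 (sth y) = 0" "cls l1 (sth z) = 0 \<Longrightarrow> cls l1 (sv1 y) = 0" "cls l1 (sth z) = 0 \<Longrightarrow> cls l1 (du1 z) = 0"
proof -
  note eq = E_eqD[OF E]
  have l: "l1 \<ge> 0" "l2 \<ge> 0" using l1 l2 by auto
  have i0: "0 \<in> {0..l1}" "l1 \<in> {0..l1}" using l1 by auto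
  have "(\<kappa>1 / \<tau>1) *\<^sub>R cls l1 (dth y) = 0" using eq(4) A_cls(4)[OF y] q by simp
  then have "cls l1 (dth y) = 0" using \<kappa>1 \<tau>1 by simp
  then show "cls l1 (sth y) = 0"
    using prim_cls_zero[OF D_prims(10)[OF y] _ i0(1) D_bcs(9)[OF y]] by (intro cls_pt_zero[OF l(1)]) blast
  have "sq y x = 0" if "x \<in> {0..l1}" for x by (rule cls_zero_pt[OF l1 D_prims(11)[OF y] q(1) that])
  then have q': "cls l1 (dq y) = 0" using Dw_zero[OF l1] by (intro cls_pt_zero[OF l(1)]) blast
  {
    assume "cls l1 (sth z) = 0"
    then have "\<delta>1 *\<^sub>R cls l1 (dv1 y) = 0" using eq(3) A_cls(3)[OF y] q' by simp
    then have v: "cls l1 (dv1 y) = 0" using \<delta>1 by simp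
    then have "c *\<^sub>R cls l1 (du1 z) = 0" using eq(1) by (simp add: A_sel)
    then have "cls l1 (du1 z) = 0" using c by simp
    moreover have "cls l1 (sv1 y) = 0"
      using prim_cls_zero[OF D_prims(7)[OF y] v i0(2) D_bcs(5)[OF y]] by (intro cls_pt_zero[OF l(1)]) blast
    ultimately have "cls l1 (sv1 y) = 0 \<and> cls l1 (du1 z) = 0" by blast
  }
  then show "cls l1 (sth z) = 0 \<Longrightarrow> cls l1 (sv1 y) = 0" "cls l1 (sth z) = 0 \<Longrightarrow> cls l1 (du1 z) = 0" by blast+
qed

text \<open>The energy class records \<open>u2''\<close> and not \<open>u2\<close>, so the
  comparison starts at second derivatives: the difference \<open>f\<close> has
  \<open>f'' = 0\<close> almost everywhere, \<open>f' 0 = 0\<close> and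
  \<open>f l2 = 0\<close>.\<close>

lemma beam_velocity:
  assumes y: "D y" and z: "D z" and E: "E (A y) = c *\<^sub>R E z" and x: "x \<in> {0..l2}"
  shows "sv2 y x = of_real c * su2 z x"
proof -
  have i0: "0 \<in> {0..l2}" "l2 \<in> {0..l2}" using l2 by auto
  define f f1 f2 where "f = (\<lambda>x. 1 * sv2 y x + (- of_real c) * su2 z x)"
    and "f1 = (\<lambda>x. 1 * dv2 y x + (- of_real c) * du2 z x)"
    and "f2 = (\<lambda>x. 1 * ddv2 y x + (- of_real c) * ddu2 z x)"
  have p: "prim l2 f f1" "prim l2 f1 f2"
    unfolding f_def f1_def f2_def
    by (rule prim_lin[OF D_prims(8)[OF y] D_prims(3)[OF z]], rule prim_lin[OF D_prims(9)[OF y] D_prims(4)[OF z]])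
  have "cls l2 (ddv2 y) = c *\<^sub>R cls l2 (ddu2 z)"
    using E_eqD(5)[OF E] by (simp add: A_sel)
  then have "cls l2 f2 = 0"
    unfolding f2_def cls_lin[OF prim_L2[OF D_prims(9)[OF y]] prim_L2[OF D_prims(4)[OF z]]]
    using cmul_add_left[of "of_real c" "- of_real c" "cls l2 (ddu2 z)"]
    by (simp add: cmul_one scaleR_lsq_def) (metis add.right_inverse of_real_0 scaleR_lsq_def scaleR_zero_left)
  then have "f1 x = 0" if "x \<in> {0..l2}" for x
    by (rule prim_cls_zero[OF p(2) _ i0(1) _ that]) (use D_bcs(8)[OF y] D_bcs(4)[OF z] in \<open>simp add: f1_def\<close>)
  then have "cls l2 f1 = 0" using l2 by (intro cls_pt_zero) auto
  then have "f x = 0"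
    by (rule prim_cls_zero[OF p(1) _ i0(2) _ x]) (use D_bcs(6)[OF y] D_bcs(2)[OF z] in \<open>simp add: f_def\<close>)
  then show ?thesis by (simp add: f_def)
qed

text \<open>Eliminating the velocity from the two equations yields
  \<open>- \<alpha>2 u2'''' = a b u2\<close>. The unstrained string adds \<open>u2 0 = 0\<close>
  and, through the transmission condition, \<open>u2''' 0 = 0\<close> to the three conditions of the
  beam. Separate factors \<open>a\<close> and \<open>b\<close> allow the roles of the two states to
  be exchanged.\<close>

lemma undamped_beam:
  assumes y: "D y" and z: "D z" and u: "cls l1 (du1 y) = 0" and c: "a * b < 0"
    and Ey: "E (A y) = a *\<^sub>R E z" and Ez: "E (A z) = b *\<^sub>R E y" and x: "x \<in> {0..l2}"
  shows "su2 y x = 0" "ddu2 y x = 0"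
proof -
  have i0: "0 \<in> {0..l1}" "l1 \<in> {0..l1}" using l1 by auto
  define \<nu> where "\<nu> = sqrt (- (a * b) / \<alpha>2)"
  have "a * b / \<alpha>2 < 0" using c \<alpha>2 by (rule divide_neg_pos)
  then have \<nu>: "\<nu> > 0" "\<nu>\<^sup>2 = - (a * b) / \<alpha>2" by (auto simp: \<nu>_def)
  have "cls l2 (sv2 z) = b *\<^sub>R cls l2 (su2 y)"
  proof -
    have "aeq l2 (sv2 z) (\<lambda>x. of_real b * su2 y x)" by (rule aeq_pointwise) (rule beam_velocity[OF z y Ez])
    then show ?thesis
      using cls_eq_iff[OF prim_mult_L2[OF D_prims(8)[OF z]] L2_cmul[OF prim_mult_L2[OF D_prims(3)[OF y]]]]
        cls_scaleR[OF prim_mult_L2[OF D_prims(3)[OF y]]] by metis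
  qed
  then have "- \<alpha>2 *\<^sub>R cls l2 (d4u2 y) = (a * b) *\<^sub>R cls l2 (su2 y)"
    using E_eqD(6)[OF Ey] A_cls(2)[OF y] by simp
  then have "(- 1 / \<alpha>2) *\<^sub>R (- \<alpha>2 *\<^sub>R cls l2 (d4u2 y)) = (- 1 / \<alpha>2) *\<^sub>R ((a * b) *\<^sub>R cls l2 (su2 y))"
    by (rule arg_cong)
  then have "cls l2 (d4u2 y) = \<nu>\<^sup>2 *\<^sub>R cls l2 (su2 y)"
    using \<alpha>2 unfolding \<nu>(2) by simp
  also have "\<dots> = cls l2 (\<lambda>x. of_real (\<nu>\<^sup>2) * su2 y x)"
    by (rule cls_scaleR[OF prim_mult_L2[OF D_prims(3)[OF y]], symmetric])
  finally have ae: "aeq l2 (d4u2 y) (\<lambda>x. of_real (\<nu>\<^sup>2) * su2 y x)"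
    by (subst (asm) cls_eq_iff[OF prim_L2[OF D_prims(6)[OF y]] L2_cmul[OF prim_mult_L2[OF D_prims(3)[OF y]]]])
  have "su1 y 0 = 0" by (rule prim_cls_zero[OF D_prims(1)[OF y] u i0(2) D_bcs(1)[OF y] i0(1)])
  then have u0: "su2 y 0 = 0" using D_bcs(3)[OF y] by simp
  have "du1 y 0 = 0" by (rule cls_zero_pt[OF l1 D_prims(2)[OF y] u i0(1)])
  then have u3: "d3u2 y 0 = 0" using D_bcs(12)[OF y] \<alpha>2 by simp
  show "su2 y x = 0" "ddu2 y x = 0"
    using overdetermined_beam[OF l2 \<nu>(1) D_prims(3)[OF y] D_prims(4)[OF y] D_prims(5)[OF y] D_prims(6)[OF y]
      u0 D_bcs(4)[OF y] u3 D_bcs(2)[OF y] D_bcs(11)[OF y] ae x] by blast+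
qed

text \<open>Over the reals a purely imaginary eigenvalue is a pair of states with
  \<open>A z = y\<close> and \<open>A y = c z\<close>, \<open>c < 0\<close>. The dissipation
  identity makes both the inner product of \<open>E y\<close> with \<open>E z\<close> and its
  multiple by \<open>c\<close> nonpositive, so both are \<open>0\<close> and both fluxes
  vanish.\<close>

lemma no_imaginary_eigenvalue:
  assumes w: "w \<in> Hs" and M: "M > 0" and eq: "B (B w) = - M *\<^sub>R w"
  shows "w = 0"
proof -
  obtain y where y: "D y" "w = E (A y)" "B w = E y" using Hs_cases[OF w] .
  have "B w \<in> Hs" unfolding y(3) by (rule E_Hs[OF D_H[OF y(1)]])
  then obtain z where z: "D z" "B w = E (A z)" "B (B w) = E z" using Hs_cases by blast
  define c where "c = - 1 / M"
  have c: "c < 0" using M by (simp add: c_def)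
  have Ez: "E (A z) = 1 *\<^sub>R E y" using z y by simp
  have "E z = - M *\<^sub>R w" using eq z by simp
  then have "c *\<^sub>R E z = w" using M by (simp add: c_def)
  then have Ey: "E (A y) = c *\<^sub>R E z" using y by simp
  have 1: "inner (E y) (E z) = - (\<gamma>1 / \<kappa>1) * (norm (cls l1 (sq z)))\<^sup>2" using dissipation[OF z(1)] Ez by simp
  have 2: "c * inner (E y) (E z) = - (\<gamma>1 / \<kappa>1) * (norm (cls l1 (sq y)))\<^sup>2"
    using dissipation[OF y(1)] Ey by (simp add: inner_commute)
  have g: "\<gamma>1 / \<kappa>1 > 0" using \<gamma>1 \<kappa>1 by simp
  have 3: "c * (- (\<gamma>1 / \<kappa>1) * (norm (cls l1 (sq z)))\<^sup>2) \<ge> 0"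
    using c \<gamma>1 \<kappa>1 by (intro mult_nonpos_nonpos) auto
  have 4: "- (\<gamma>1 / \<kappa>1) * (norm (cls l1 (sq y)))\<^sup>2 \<le> 0" using g by (intro mult_nonpos_nonneg) auto
  have "- (\<gamma>1 / \<kappa>1) * (norm (cls l1 (sq y)))\<^sup>2 = 0" using 1 2 3 4 by (metis antisym)
  then have qy: "cls l1 (sq y) = 0" using \<gamma>1 \<kappa>1 by simp
  have "c * (- (\<gamma>1 / \<kappa>1) * (norm (cls l1 (sq z)))\<^sup>2) = 0" using 1 2 3 4 by (metis antisym)
  then have qz: "cls l1 (sq z) = 0" using \<gamma>1 \<kappa>1 c by simp
  have c0: "c \<noteq> 0" "(1::real) \<noteq> 0" using c by auto
  note uy = undamped[OF y(1) z(1) c0(1) Ey qy qz] and uz = undamped[OF z(1) y(1) c0(2) Ez qz qy]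
  have ty: "cls l1 (sth y) = 0" "cls l1 (sth z) = 0" using uy(1) uz(1) by blast+
  have v1: "cls l1 (sv1 z) = 0" and u1: "cls l1 (du1 y) = 0" "cls l1 (du1 z) = 0"
    using uy(3) uz(2,3) ty by blast+
  have cc: "c * 1 < 0" "1 * c < 0" using c by auto
  have "sv2 z x = 0" if "x \<in> {0..l2}" for x
    using beam_velocity[OF z(1) y(1) Ez that] undamped_beam(1)[OF y(1) z(1) u1(1) cc(1) Ey Ez that] by simp
  then have v2: "cls l2 (sv2 z) = 0" using l2 by (intro cls_pt_zero) auto
  have u2: "cls l2 (ddu2 z) = 0"
    using undamped_beam(2)[OF z(1) y(1) u1(2) cc(2) Ez Ey] l2 by (intro cls_pt_zero) auto
  have "E z = 0" unfolding E_def using u1 v1 ty qz u2 v2 by (simp add: zero_prod_def)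
  then show ?thesis using \<open>c *\<^sub>R E z = w\<close> by simp
qed

text \<open>For \<open>x = E (A y)\<close> the form \<open>B x \<bullet> x\<close> is the
  dissipation of \<open>y\<close>; the norm bound and injectivity come from \<open>bd_E\<close> and
  \<open>A_of_zero\<close>.\<close>

lemma dissipative_inverse_B: "\<exists>C. dissipative_inverse Hs B C"
proof -
  obtain K where K: "\<And>y. D y \<Longrightarrow> norm (E y) \<le> K * norm (E (A y))" using bd_E unfolding bd_def by blast
  have "dissipative_inverse Hs B K"
  proof
    show "subspace Hs" "closed Hs" by (rule subspace_Hs closed_Hs)+
    fix x assume x: "x \<in> Hs"
    obtain y where y: "D y" "x = E (A y)" "B x = E y" using Hs_cases[OF x] .
    show "B x \<in> Hs" using E_Hs[OF D_H[OF y(1)]] y by simp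
    show "B (x + z) = B x + B z" if "z \<in> Hs" for z using B_lin[OF x that, of 1 1] by (simp add: cm_one)
    show "B (c *\<^sub>R x) = c *\<^sub>R B x" for c using B_cm[OF x, of "of_real c"] by (simp add: cm_of_real)
    show "norm (B x) \<le> K * norm x" using K[OF y(1)] y by simp
    have "\<gamma>1 / \<kappa>1 \<ge> 0" using \<gamma>1 \<kappa>1 by simp
    then have "- (\<gamma>1 / \<kappa>1) * (norm (cls l1 (sq y)))\<^sup>2 \<le> 0" by (intro mult_nonpos_nonneg) auto
    then show "B x \<bullet> x \<le> 0" using dissipation[OF y(1)] y by (simp add: inner_commute)
    show "x = 0" if "B x = 0" using A_of_zero[OF y(1)] y that by simp
  qed
  then show ?thesis by blast
qed

lemma B_compact:
  assumes x: "range x \<subseteq> Hs" "bounded (range x)"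
  shows "\<exists>r l. strict_mono (r :: nat \<Rightarrow> nat) \<and> (\<lambda>n. B (x (r n))) \<longlonglongrightarrow> l"
proof -
  obtain R where R: "\<And>n. norm (x n) \<le> R" using x(2) by (auto simp: bounded_iff)
  have "\<exists>y. D y \<and> x n = E (A y) \<and> B (x n) = E y" for n
    using x(1) Hs_cases[of "x n"] by blast
  then obtain y where y: "\<And>n. D (y n)" "\<And>n. x n = E (A (y n))" "\<And>n. B (x n) = E (y n)" by metis
  have "\<forall>n. D (y n) \<and> norm (E (A (y n))) \<le> R" using R y by metis
  then obtain r where "strict_mono (r :: nat \<Rightarrow> nat)" "convergent (\<lambda>n. E (y (r n)))"
    using cpt_E unfolding cpt_def by blast
  then show ?thesis unfolding y(3) convergent_def by blast
qed

section \<open>Return from energy classes to states\<close>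

abbreviation "N \<equiv> \<lambda>y. sqrt (Hsq y)"

lemma N_lin: "inW y \<Longrightarrow> inW z \<Longrightarrow> N (st_lin a y b z) = norm (cm a (E y) + cm b (E z))"
  using norm_E[OF E_lin(1)] E_lin(2) by simp

lemma N_diff: "inW y \<Longrightarrow> inW z \<Longrightarrow> N (st_lin 1 y (-1) z) = norm (E y - E z)"
  by (simp add: N_lin cm_one cm_minus_one)

text \<open>Equivalence of states is equality in the Hilbert space, so representatives may be chosen
  freely.\<close>

lemma eqv_iff: "inW y \<Longrightarrow> inW z \<Longrightarrow> eqv N y z \<longleftrightarrow> E y = E z"
  by (simp add: eqv_def N_diff)

lemma resolvent_zero: "zero_in_resolvent H N D A"
  unfolding zero_in_resolvent_def
proof (intro conjI allI impI)
  fix f assume f: "H f"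
  then obtain y where y: "D y" "E (A y) = E f" using A_surj by blast
  then show "\<exists>y. D y \<and> eqv N (A y) f"
    using eqv_iff[OF H_inW[OF D_A_H[OF y(1)]] H_inW[OF f]] by blast
next
  fix y z assume y: "D y" and z: "D z" and e: "eqv N (A y) (A z)"
  then have "E (A y) = E (A z)" using eqv_iff[OF H_inW[OF D_A_H[OF y]] H_inW[OF D_A_H[OF z]]] by blast
  then show "eqv N y z"
    using E_inj_A[OF y z] eqv_iff[OF H_inW[OF D_H[OF y]] H_inW[OF D_H[OF z]]] by blast
next
  obtain K where K: "\<And>y. D y \<Longrightarrow> norm (E y) \<le> K * norm (E (A y))" using bd_E unfolding bd_def by blast
  have "N y \<le> K * N (A y)" if "D y" for y
    using K[OF that] norm_E[OF H_inW[OF D_H[OF that]]] norm_E[OF H_inW[OF D_A_H[OF that]]] by simp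
  then show "\<exists>C. \<forall>y. D y \<longrightarrow> N y \<le> C * N (A y)" by blast
qed

lemma semigroup_exists:
  "\<exists>S. generates_C0_contraction H N D A S \<and> (\<forall>y. H y \<longrightarrow> ((\<lambda>t. N (S t y)) \<longlongrightarrow> 0) at_top)"
proof -
  obtain C where "dissipative_inverse Hs B C" using dissipative_inverse_B by blast
  then interpret dissipative_inverse Hs B C .
  \<comment> \<open>An arbitrary representative of the evolved class; the semigroup laws are
    required only up to \<open>eqv\<close>.\<close>
  define S where "S t y = (SOME z. H z \<and> E z = T t (E y))" for t y
  have S: "H (S t y)" "E (S t y) = T t (E y)" if "t \<ge> 0" "H y" for t :: real and y
  proof -
    have "T t (E y) \<in> Hs" using T_in[OF that(1) E_Hs[OF that(2)]] .
    then have "\<exists>z. H z \<and> E z = T t (E y)" by (auto simp: Hs_def)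
    from someI_ex[OF this] show "H (S t y)" "E (S t y) = T t (E y)" by (auto simp: S_def)
  qed
  have W: "inW (S t y)" if "t \<ge> 0" "H y" for t :: real and y using S(1)[OF that] H_inW by blast
  \<comment> \<open>The abstract semigroup is real linear; commutation with \<open>cm\<close>
    supplies complex linearity.\<close>
  have T_cm: "T t (cm c x) = cm c (T t x)" if "t \<ge> 0" "x \<in> Hs" for t :: real and c x
    by (rule T_commute_linear[where K = "cmod c"]) (use that in \<open>auto simp: Hs_cm cm_diff cm_scaleR B_cm norm_cm\<close>)
  \<comment> \<open>\<open>S h y\<close> is specified only for \<open>h \<ge> 0\<close>; the limits
    at \<open>0\<close> are one-sided, so this suffices.\<close>
  have quot: "N (st_lin (of_real (1 / h)) (st_lin 1 (S h y) (-1) y) (-1) z)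
      = norm ((1 / h) *\<^sub>R (T h (E y) - E y) - E z)" if "h \<ge> 0" "H y" "inW z" for h :: real and y z
    using that E_lin[OF W[OF that(1,2)] H_inW[OF that(2)], of 1 "-1"] cm_of_real[of "1 / h" "T h (E y) - E y"]
    by (simp add: N_lin cm_one cm_minus_one S)
  have quot_ev: "\<forall>\<^sub>F h in at_right 0. norm ((1 / h) *\<^sub>R (T h (E y) - E y) - E z)
      = N (st_lin (of_real (1 / h)) (st_lin 1 (S h y) (-1) y) (-1) z)" if "H y" "inW z" for y z
    using eventually_at_right_less[of "0::real"] by eventually_elim (use quot that in simp)
  have gen: "((\<lambda>h. N (st_lin (of_real (1 / h)) (st_lin 1 (S h y) (-1) y) (-1) z)) \<longlongrightarrow> 0) (at_right 0)
      \<longleftrightarrow> ((\<lambda>h. (1 / h) *\<^sub>R (T h (E y) - E y)) \<longlongrightarrow> E z) (at_right 0)" if "H y" "inW z" for y z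
  proof -
    have "((\<lambda>h. N (st_lin (of_real (1 / h)) (st_lin 1 (S h y) (-1) y) (-1) z)) \<longlongrightarrow> 0) (at_right 0)
      \<longleftrightarrow> ((\<lambda>h. norm ((1 / h) *\<^sub>R (T h (E y) - E y) - E z)) \<longlongrightarrow> 0) (at_right 0)"
      by (rule tendsto_cong) (use quot_ev[OF that] in \<open>simp add: eq_commute\<close>)
    also have "\<dots> \<longleftrightarrow> ((\<lambda>h. (1 / h) *\<^sub>R (T h (E y) - E y)) \<longlongrightarrow> E z) (at_right 0)"
      by (simp add: tendsto_norm_zero_iff LIM_zero_iff)
    finally show ?thesis .
  qed
  have genA: "((\<lambda>h. N (st_lin (of_real (1 / h)) (st_lin 1 (S h y) (-1) y) (-1) (A y))) \<longlongrightarrow> 0) (at_right 0)"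
    if y: "D y" for y
    using T_generator[OF E_Hs[OF D_A_H[OF y]]] gen[OF D_H[OF y] H_inW[OF D_A_H[OF y]]] by (simp add: B_E[OF y])
  have "generates_C0_contraction H N D A S"
    unfolding generates_C0_contraction_def
  proof (intro conjI allI impI)
    fix t :: real and y assume "0 \<le> t" "H y"
    then show "H (S t y)" by (rule S(1))
  next
    fix t :: real and y z a b assume t: "0 \<le> t" and y: "H y" and z: "H z"
    have "E (S t (st_lin a y b z)) = E (st_lin a (S t y) b (S t z))"
      using S(2)[OF t st_lin_H[OF y z]] E_lin(2)[OF H_inW[OF y] H_inW[OF z]] E_lin(2)[OF W[OF t y] W[OF t z]]
      by (simp add: T_add T_cm Hs_cm E_Hs S t y z)
    then show "eqv N (S t (st_lin a y b z)) (st_lin a (S t y) b (S t z))"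
      using eqv_iff[OF W[OF t st_lin_H[OF y z]] E_lin(1)[OF W[OF t y] W[OF t z]]] by blast
  next
    fix t :: real and y z assume t: "0 \<le> t" and y: "H y" and z: "H z" and e: "eqv N y z"
    then have "E y = E z" using eqv_iff[OF H_inW[OF y] H_inW[OF z]] by blast
    then show "eqv N (S t y) (S t z)" using eqv_iff[OF W[OF t y] W[OF t z]] S t y z by simp
  next
    fix y assume y: "H y"
    then show "eqv N (S 0 y) y" using eqv_iff[OF W[of 0 y] H_inW[of y]] S[of 0 y] T_zero by simp
  next
    fix t s :: real and y assume t: "0 \<le> t" and s: "0 \<le> s" and y: "H y"
    have "E (S (t + s) y) = E (S t (S s y))"
      using S(2)[of "t + s" y] S(2)[OF t S(1)[OF s y]] S(2)[OF s y] T_semigroup[OF t s E_Hs[OF y]] t s y by simp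
    then show "eqv N (S (t + s) y) (S t (S s y))"
      using eqv_iff[OF W[of "t + s" y] W[OF t S(1)[OF s y]]] t s y by simp
  next
    fix y assume y: "H y"
    have "((\<lambda>t. norm (T t (E y) - E y)) \<longlongrightarrow> 0) (at_right 0)"
      using T_strongly_continuous[OF E_Hs[OF y]] by (simp add: tendsto_norm_zero_iff LIM_zero_iff)
    then show "((\<lambda>t. N (st_lin 1 (S t y) (-1) y)) \<longlongrightarrow> 0) (at_right 0)"
    proof (rule Lim_transform_eventually)
      show "\<forall>\<^sub>F t in at_right 0. norm (T t (E y) - E y) = N (st_lin 1 (S t y) (-1) y)"
        using eventually_at_right_less[of "0::real"]
        by eventually_elim (use y in \<open>simp add: N_diff[OF W[OF _ y] H_inW[OF y]] S\<close>)
    qed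
  next
    fix t :: real and y assume t: "0 \<le> t" and y: "H y"
    show "N (S t y) \<le> N y"
      using T_contraction[OF t E_Hs[OF y]] norm_E[OF W[OF t y]] norm_E[OF H_inW[OF y]] S(2)[OF t y] by simp
  next
    fix y assume y: "H y"
    show "(\<exists>z. H z \<and> ((\<lambda>h. N (st_lin (of_real (1 / h)) (st_lin 1 (S h y) (-1) y) (-1) z)) \<longlongrightarrow> 0) (at_right 0))
       \<longleftrightarrow> (\<exists>w. D w \<and> eqv N w y)"
    proof
      assume "\<exists>z. H z \<and> ((\<lambda>h. N (st_lin (of_real (1 / h)) (st_lin 1 (S h y) (-1) y) (-1) z)) \<longlongrightarrow> 0) (at_right 0)"
      then obtain z where z: "H z" "((\<lambda>h. (1 / h) *\<^sub>R (T h (E y) - E y)) \<longlongrightarrow> E z) (at_right 0)"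
        using gen[OF y H_inW] by blast
      \<comment> \<open>An orbit differentiable at time \<open>0\<close> starts in the range of
        \<open>B\<close>, which consists of the classes of domain states.\<close>
      obtain g where g: "g \<in> Hs" "E y = B g" using generator_domain[OF E_Hs[OF y] E_Hs[OF z(1)] z(2)] by blast
      obtain w where w: "D w" "B g = E w" using Hs_cases[OF g(1)] by blast
      then show "\<exists>w. D w \<and> eqv N w y" using eqv_iff[OF H_inW[OF D_H[OF w(1)]] H_inW[OF y]] g by metis
    next
      assume "\<exists>w. D w \<and> eqv N w y"
      then obtain w where w: "D w" "eqv N w y" by blast
      then have "E w = E y" using eqv_iff[OF H_inW[OF D_H[OF w(1)]] H_inW[OF y]] by blast
      then have "((\<lambda>h. (1 / h) *\<^sub>R (T h (E y) - E y)) \<longlongrightarrow> E (A w)) (at_right 0)"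
        using T_generator[OF E_Hs[OF D_A_H[OF w(1)]]] by (simp add: B_E[OF w(1)])
      then show "\<exists>z. H z \<and> ((\<lambda>h. N (st_lin (of_real (1 / h)) (st_lin 1 (S h y) (-1) y) (-1) z)) \<longlongrightarrow> 0) (at_right 0)"
        using gen[OF y H_inW[OF D_A_H[OF w(1)]]] D_A_H[OF w(1)] by blast
    qed
  next
    fix y assume "D y"
    then show "((\<lambda>h. N (st_lin (of_real (1 / h)) (st_lin 1 (S h y) (-1) y) (-1) (A y))) \<longlongrightarrow> 0) (at_right 0)"
      by (rule genA)
  qed
  moreover have "((\<lambda>t. N (S t y)) \<longlongrightarrow> 0) at_top" if y: "H y" for y
  proof (rule Lim_transform_eventually)
    show "((\<lambda>t. norm (T t (E y))) \<longlongrightarrow> 0) at_top"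
      by (rule T_strongly_stable[OF B_compact no_imaginary_eigenvalue E_Hs[OF y]])
    show "\<forall>\<^sub>F t in at_top. norm (T t (E y)) = N (S t y)"
      using eventually_ge_at_top[of "0::real"]
      by eventually_elim (use y in \<open>simp add: norm_E[OF W, symmetric] S\<close>)
  qed
  ultimately show ?thesis by blast
qed

lemma dissipative_identity:
  assumes y: "D y"
  shows "Re (Hin (A y) y) = - (\<gamma>1 / \<kappa>1) * nrm2 l1 (sq y)" "Re (Hin (A y) y) \<le> 0"
proof -
  note W = H_inW[OF D_A_H[OF y]] H_inW[OF D_H[OF y]]
  have e: "Re (Hin (A y) y) = - (\<gamma>1 / \<kappa>1) * (norm (cls l1 (sq y)))\<^sup>2"
    using dissipation[OF y] E_inner[OF W] by simp
  then show "Re (Hin (A y) y) = - (\<gamma>1 / \<kappa>1) * nrm2 l1 (sq y)"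
    using norm_cls[OF inW_L2(4)[OF W(2)]] by simp
  have "\<gamma>1 / \<kappa>1 \<ge> 0" using \<gamma>1 \<kappa>1 by simp
  then show "Re (Hin (A y) y) \<le> 0" unfolding e by (intro mult_nonpos_nonneg) auto
qed

end

theorem theorem1:
  fixes l1 l2 \<alpha>1 \<beta>1 \<gamma>1 \<delta>1 \<tau>1 \<kappa>1 \<alpha>2 :: real
  assumes "l1 > 0" "l2 > 0" "\<alpha>1 > 0" "\<beta>1 > 0" "\<gamma>1 > 0" "\<delta>1 > 0" "\<tau>1 > 0" "\<kappa>1 > 0" "\<alpha>2 > 0"
  defines "H \<equiv> inH l1 l2"
      and "N \<equiv> (\<lambda>y. sqrt (Hnorm2 l1 l2 \<alpha>1 \<beta>1 \<gamma>1 \<delta>1 \<tau>1 \<kappa>1 \<alpha>2 y))"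
      and "D \<equiv> domA l1 l2 \<alpha>1 \<beta>1 \<delta>1 \<alpha>2"
      and "A \<equiv> opA l1 l2 \<alpha>1 \<beta>1 \<gamma>1 \<delta>1 \<tau>1 \<kappa>1 \<alpha>2"
  shows "(\<forall>y. D y \<longrightarrow>
            Re (Hinner l1 l2 \<alpha>1 \<beta>1 \<gamma>1 \<delta>1 \<tau>1 \<kappa>1 \<alpha>2 (A y) y) = - (\<gamma>1 / \<kappa>1) * nrm2 l1 (sq y)
          \<and> Re (Hinner l1 l2 \<alpha>1 \<beta>1 \<gamma>1 \<delta>1 \<tau>1 \<kappa>1 \<alpha>2 (A y) y) \<le> 0)
       \<and> zero_in_resolvent H N D A
       \<and> (\<exists>S. generates_C0_contraction H N D A S
              \<and> (\<forall>y. H y \<longrightarrow> ((\<lambda>t. N (S t y)) \<longlongrightarrow> 0) at_top))"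
proof -
  interpret coupled l1 l2 \<alpha>1 \<beta>1 \<gamma>1 \<delta>1 \<tau>1 \<kappa>1 \<alpha>2
    by unfold_locales (fact assms)+
  show ?thesis
    unfolding H_def N_def D_def A_def
    using dissipative_identity resolvent_zero semigroup_exists by blast
qed

end
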